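(* The permutadic structure of $\mathrm{permAs}_\infty$ is compatible with the boundary map of the permutohedra (i.e. the structure map $\mathbb{P}(\mathbb{P}(V))\to\mathbb{P}(V)$ commutes with the differentials). Hence $\mathrm{permAs}_\infty$ is a dg quasi-free permutad such that $$(\mathrm{permAs}_\infty)_n\cong C_\bullet(\mathtt{P}^{n-2})\qquad(n\ge2).$$
   Context: $\mathbb{K}$ is a commutative ring; $\underline{n}=\{1,\dots,n\}$. $\mathrm{Sur}(\underline{n},\underline{k})$ is the set of surjections $\underline{n}\to\underline{k}$; the elements of $\underline k$ are the vertices of $t$, the arity of a vertex $j$ being $\#t^{-1}(j)+1$; the unique element of $\mathrm{Sur}(\underline{n},\underline{1})$ is the corolla $c_{n+1}$. Substitution: for $t\in\mathrm{Sur}(\underline{n},\underline{k})$ and $t_j\in\mathrm{Sur}(\underline{i_j},\underline{m_j})$ with $i_j=\#t^{-1}(j)$, $(t;t_1,\dots,t_k):\underline{n}\to\underline{m_1+\cdots+m_k}$ is the surjection with $(t;t_1,\dots,t_k)(a)=m_1+\cdots+m_{j-1}+t_j(b)$ whenever $t(a)=j$ and $a$ is the $b$-th element of $t^{-1}(j)$ in increasing order. A permutad is an arity-graded module $\mathcal{P}=\{\mathcal{P}_n\}_{n\ge1}$ with $\mathcal{P}_1=\mathbb{K}\,\mathrm{id}$ together with linear maps $\Gamma(t;-,\dots,-):\bigotimes_{j=1}^k\mathcal{P}_{\#t^{-1}(j)+1}\to\mathcal{P}_{n+1}$ for all surjections $t:\underline{n}\to\underline{k}$, with $\Gamma(c_{n+1};\mu)=\mu$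 and compatible with substitution: $\Gamma((t;t_1,\dots,t_k);\lambda^1_1,\dots,\lambda^k_{m_k})=\Gamma(t;\Gamma(t_1;\lambda^1_1,\dots,\lambda^1_{m_1}),\dots,\Gamma(t_k;\lambda^k_1,\dots,\lambda^k_{m_k}))$. For an arity-graded module $M$, $\mathbb{P}(M)_1=\mathbb{K}\,\mathrm{id}$ and $\mathbb{P}(M)_{n+1}=\bigoplus_{k}\bigoplus_{t\in\mathrm{Sur}(\underline{n},\underline{k})}\bigotimes_{j=1}^kM_{\#t^{-1}(j)+1}$ ($n\ge1$); if $M_1=0$ this is, with $\Gamma$ induced by substitution, the free permutad on $M$. A dg permutad is defined by replacing $\mathbb{K}$-modules by chain complexes: for a dg arity-graded module $(M,d)$, $\mathbb{P}(M)$ has differential $d(t;\mu_1,\dots,\mu_k)=\sum_i(-1)^{|\mu_1|+\cdots+|\mu_{i-1}|}(t;\mu_1,\dots,d\mu_i,\dots,\mu_k)$, and the structure map $\Gamma:\mathbb{P}(\mathcal{P})\to\mathcal{P}$ is required to be a chain map. A dg permutad is quasi-free if, forgetting the differential, it is a free permutad. Permutohedron: $\mathtt{P}^{n-1}\subset\mathbb{R}^n$ is the convex hull of the points $(\sigma(1),\dots,\sigma(n))$, $\sigma\in\mathbb{S}_n$. Its cells are in bijection with the surjections with source $\underline{n}$; a surjection $t:\underline{n}\to\underline{k}$ corresponds to an $(n-k)$-dimensional cell of the form $\mathtt{P}^{i_1-1}\times\cdots\times\mathtt{P}^{i_k-1}$, $i_j=\#t^{-1}(j)$; the corolla corresponds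 to the big cell. $C_\bullet(\mathtt{P}^{n-1})$ is the cellular chain complex: $C_k$ is free on the surjections $\underline{n}\to\underline{n-k}$. Its boundary on the big cell is $\sum_t\mathrm{sgn}(t)\,t$, over all surjections $t:\underline{n}\to\underline{2}$, where $\mathrm{sgn}(t)=\mathrm{sgn}(\sigma_t)(-1)^{\#t^{-1}(1)}$ and $\sigma_t$ is the permutation whose list of values is $t^{-1}(1)$ in increasing order followed by $t^{-1}(2)$ in increasing order; on other cells it is the boundary of a product of permutohedra (with the signs $(-1)^{|\mu_1|+\cdots+|\mu_{i-1}|}$ above). The permutad $\mathrm{permAs}_\infty$: let $V$ be the arity-graded module with $V_1=0$ and $V_n=\mathbb{K}\,m_n$ for $n\ge2$, $m_n$ of homological degree $n-2$. As a permutad, $\mathrm{permAs}_\infty=\mathbb{P}(V)$. Decorating each vertex by the corresponding $m$ identifies $(\mathrm{permAs}_\infty)_n$ with the free module on surjections with source $\underline{n-1}$, i.e. on the cells of $\mathtt{P}^{n-2}$, $m_n$ corresponding to the big cell. The differential put on it is the boundary map of the permutohedron. *)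

theory Defs
  imports "HOL-Algebra.AbelCoset" "HOL-Algebra.Module" "HOL-Combinatorics.Permutations"
begin

section \<open>Modules over a commutative ring\<close>

definition linear_map ::
  "('r, 'x) ring_scheme \<Rightarrow> ('r, 'a) module \<Rightarrow> ('r, 'b) module \<Rightarrow> ('a \<Rightarrow> 'b) \<Rightarrow> bool" where
  "linear_map R M N f \<longleftrightarrow>
     f \<in> carrier M \<rightarrow> carrier N \<and>
     (\<forall>x\<in>carrier M. \<forall>y\<in>carrier M. f (x \<oplus>\<^bsub>M\<^esub> y) = f x \<oplus>\<^bsub>N\<^esub> f y) \<and>
     (\<forall>r\<in>carrier R. \<forall>x\<in>carrier M. f (r \<odot>\<^bsub>M\<^esub> x) = r \<odot>\<^bsub>N\<^esub> f x)"

definition module_span :: "('r, 'x) ring_scheme \<Rightarrow> ('r, 'a) module \<Rightarrow> 'a set \<Rightarrow> 'a set" where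
  "module_span R M S = \<Inter>{N. submodule N R M \<and> S \<subseteq> N}"

text \<open>The fields \<open>mult\<close> and \<open>one\<close> of a module record carry no meaning and are filled
  arbitrarily.\<close>

definition quotient_module :: "('r, 'a) module \<Rightarrow> 'a set \<Rightarrow> ('r, 'a set) module" where
  "quotient_module M N =
     \<lparr>carrier = a_rcosets\<^bsub>M\<^esub> N, monoid.mult = (\<lambda>A B. A), one = N,
      zero = N, add = (\<lambda>A B. A <+>\<^bsub>M\<^esub> B),
      smult = (\<lambda>r A. \<Union>a\<in>A. N +>\<^bsub>M\<^esub> (r \<odot>\<^bsub>M\<^esub> a))\<rparr>"

definition free_module :: "('r, 'x) ring_scheme \<Rightarrow> 'g set \<Rightarrow> ('r, 'g \<Rightarrow> 'r) module" where
  "free_module R S =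
     \<lparr>carrier = {f. (\<forall>s\<in>S. f s \<in> carrier R) \<and> (\<forall>s. s \<notin> S \<longrightarrow> f s = \<zero>\<^bsub>R\<^esub>) \<and> finite {s. f s \<noteq> \<zero>\<^bsub>R\<^esub>}},
      monoid.mult = (\<lambda>f g. f), one = (\<lambda>s. \<zero>\<^bsub>R\<^esub>),
      zero = (\<lambda>s. \<zero>\<^bsub>R\<^esub>), add = (\<lambda>f g s. f s \<oplus>\<^bsub>R\<^esub> g s),
      smult = (\<lambda>r f s. r \<otimes>\<^bsub>R\<^esub> f s)\<rparr>"

definition basis_elt :: "('r, 'x) ring_scheme \<Rightarrow> 'g \<Rightarrow> 'g \<Rightarrow> 'r" where
  "basis_elt R s = (\<lambda>s'. if s' = s then \<one>\<^bsub>R\<^esub> else \<zero>\<^bsub>R\<^esub>)"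

text \<open>Product of a family of modules; it is only used for finite index sets, where it is the
  direct sum.\<close>

definition sum_module :: "'i set \<Rightarrow> ('i \<Rightarrow> ('r, 'a) module) \<Rightarrow> ('r, 'i \<Rightarrow> 'a) module" where
  "sum_module I M =
     \<lparr>carrier = (\<Pi>\<^sub>E i\<in>I. carrier (M i)), monoid.mult = (\<lambda>x y. x), one = (\<lambda>i\<in>I. \<zero>\<^bsub>M i\<^esub>),
      zero = (\<lambda>i\<in>I. \<zero>\<^bsub>M i\<^esub>), add = (\<lambda>x y. \<lambda>i\<in>I. x i \<oplus>\<^bsub>M i\<^esub> y i),
      smult = (\<lambda>r x. \<lambda>i\<in>I. r \<odot>\<^bsub>M i\<^esub> x i)\<rparr>"


section \<open>Tensor products of finite lists of modules\<close>

definition tuples :: "('r, 'a) module list \<Rightarrow> 'a list set" where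
  "tuples Ms = {xs. list_all2 (\<lambda>x M. x \<in> carrier M) xs Ms}"

definition multilinear ::
  "('r, 'x) ring_scheme \<Rightarrow> ('r, 'a) module list \<Rightarrow> ('r, 'b) module \<Rightarrow> ('a list \<Rightarrow> 'b) \<Rightarrow> bool" where
  "multilinear R Ms N f \<longleftrightarrow>
     (\<forall>xs\<in>tuples Ms. f xs \<in> carrier N) \<and>
     (\<forall>xs\<in>tuples Ms. \<forall>i<length Ms.
        (\<forall>y\<in>carrier (Ms ! i).
           f (xs[i := xs ! i \<oplus>\<^bsub>Ms ! i\<^esub> y]) = f xs \<oplus>\<^bsub>N\<^esub> f (xs[i := y])) \<and>
        (\<forall>r\<in>carrier R. f (xs[i := r \<odot>\<^bsub>Ms ! i\<^esub> (xs ! i)]) = r \<odot>\<^bsub>N\<^esub> f xs))"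

definition tensor_relations ::
  "('r, 'x) ring_scheme \<Rightarrow> ('r, 'a) module list \<Rightarrow> ('a list \<Rightarrow> 'r) set" where
  "tensor_relations R Ms =
     (let F = free_module R (tuples Ms); e = basis_elt R in
      {e (xs[i := xs ! i \<oplus>\<^bsub>Ms ! i\<^esub> y]) \<ominus>\<^bsub>F\<^esub> (e xs \<oplus>\<^bsub>F\<^esub> e (xs[i := y])) | xs i y.
          xs \<in> tuples Ms \<and> i < length Ms \<and> y \<in> carrier (Ms ! i)} \<union>
      {e (xs[i := r \<odot>\<^bsub>Ms ! i\<^esub> (xs ! i)]) \<ominus>\<^bsub>F\<^esub> (r \<odot>\<^bsub>F\<^esub> e xs) | xs i r.
          xs \<in> tuples Ms \<and> i < length Ms \<and> r \<in> carrier R})"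

definition tensor ::
  "('r, 'x) ring_scheme \<Rightarrow> ('r, 'a) module list \<Rightarrow> ('r, ('a list \<Rightarrow> 'r) set) module" where
  "tensor R Ms =
     quotient_module (free_module R (tuples Ms))
       (module_span R (free_module R (tuples Ms)) (tensor_relations R Ms))"

definition pure ::
  "('r, 'x) ring_scheme \<Rightarrow> ('r, 'a) module list \<Rightarrow> 'a list \<Rightarrow> ('a list \<Rightarrow> 'r) set" where
  "pure R Ms xs =
     module_span R (free_module R (tuples Ms)) (tensor_relations R Ms)
       +>\<^bsub>free_module R (tuples Ms)\<^esub> basis_elt R xs"

text \<open>The map out of a tensor product induced by a multilinear map \<open>f\<close> into \<open>N\<close>; multilinearity
  of \<open>f\<close> makes the value independent of the chosen representative.\<close>

definition tensor_lift ::
  "('r, 'x) ring_scheme \<Rightarrow> ('r, 'b) module \<Rightarrow> ('a list \<Rightarrow> 'b) \<Rightarrow> ('a list \<Rightarrow> 'r) set \<Rightarrow> 'b" where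
  "tensor_lift R N f X =
     (let g = (SOME g. g \<in> X) in \<Oplus>\<^bsub>N\<^esub>xs\<in>{xs. g xs \<noteq> \<zero>\<^bsub>R\<^esub>}. g xs \<odot>\<^bsub>N\<^esub> f xs)"

text \<open>The concatenation \<open>(\<Otimes>L\<^sub>1) \<otimes> \<dots> \<otimes> (\<Otimes>L\<^sub>k) \<rightarrow> \<Otimes>(L\<^sub>1 @ \<dots> @ L\<^sub>k)\<close>.\<close>

fun tensor_concat ::
  "('r, 'x) ring_scheme \<Rightarrow> ('r, 'a) module list list \<Rightarrow> ('a list \<Rightarrow> 'r) set list
     \<Rightarrow> ('a list \<Rightarrow> 'r) set" where
  "tensor_concat R (L # Ls) (X # Xs) =
     tensor_lift R (tensor R (L @ concat Ls))
       (\<lambda>xs. tensor_lift R (tensor R (L @ concat Ls))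
          (\<lambda>ys. pure R (L @ concat Ls) (xs @ ys)) (tensor_concat R Ls Xs)) X"
| "tensor_concat R _ _ = pure R [] []"


section \<open>Graded and differential graded modules\<close>

text \<open>A grading of \<open>M\<close> is a family \<open>G\<close> of submodules of which \<open>M\<close> is the internal direct sum.\<close>

definition homogeneous_parts ::
  "('r, 'a) module \<Rightarrow> (int \<Rightarrow> 'a set) \<Rightarrow> 'a \<Rightarrow> (int \<Rightarrow> 'a) \<Rightarrow> bool" where
  "homogeneous_parts M G x c \<longleftrightarrow>
     (\<forall>p. c p \<in> G p) \<and> finite {p. c p \<noteq> \<zero>\<^bsub>M\<^esub>} \<and> (\<Oplus>\<^bsub>M\<^esub>p\<in>{p. c p \<noteq> \<zero>\<^bsub>M\<^esub>}. c p) = x"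

definition graded_module ::
  "('r, 'x) ring_scheme \<Rightarrow> ('r, 'a) module \<Rightarrow> (int \<Rightarrow> 'a set) \<Rightarrow> bool" where
  "graded_module R M G \<longleftrightarrow>
     module R M \<and> (\<forall>p. submodule (G p) R M) \<and>
     (\<forall>x\<in>carrier M. \<exists>!c. homogeneous_parts M G x c)"

definition dg_module ::
  "('r, 'x) ring_scheme \<Rightarrow> ('r, 'a) module \<Rightarrow> (int \<Rightarrow> 'a set) \<Rightarrow> ('a \<Rightarrow> 'a) \<Rightarrow> bool" where
  "dg_module R M G d \<longleftrightarrow>
     graded_module R M G \<and> linear_map R M M d \<and>
     (\<forall>p. d ` G p \<subseteq> G (p - 1)) \<and> (\<forall>x\<in>carrier M. d (d x) = \<zero>\<^bsub>M\<^esub>)"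

definition graded_iso ::
  "('r, 'x) ring_scheme \<Rightarrow> ('r, 'a) module \<Rightarrow> (int \<Rightarrow> 'a set)
     \<Rightarrow> ('r, 'b) module \<Rightarrow> (int \<Rightarrow> 'b set) \<Rightarrow> ('a \<Rightarrow> 'b) \<Rightarrow> bool" where
  "graded_iso R M G N H f \<longleftrightarrow>
     linear_map R M N f \<and> bij_betw f (carrier M) (carrier N) \<and> (\<forall>p. f ` G p = H p)"

definition dg_iso ::
  "('r, 'x) ring_scheme \<Rightarrow> ('r, 'a) module \<Rightarrow> (int \<Rightarrow> 'a set) \<Rightarrow> ('a \<Rightarrow> 'a)
     \<Rightarrow> ('r, 'b) module \<Rightarrow> (int \<Rightarrow> 'b set) \<Rightarrow> ('b \<Rightarrow> 'b) \<Rightarrow> ('a \<Rightarrow> 'b) \<Rightarrow> bool" where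
  "dg_iso R M G d N H e f \<longleftrightarrow>
     dg_module R M G d \<and> dg_module R N H e \<and>
     graded_iso R M G N H f \<and> (\<forall>x\<in>carrier M. f (d x) = e (f x))"

text \<open>The linear map multiplying a homogeneous element \<open>\<mu>\<close> by \<open>(-1)\<^bsup>|\<mu>|\<^esup>\<close>.\<close>

definition koszul :: "('r, 'a) module \<Rightarrow> (int \<Rightarrow> 'a set) \<Rightarrow> 'a \<Rightarrow> 'a" where
  "koszul M G x =
     (let c = (THE c. homogeneous_parts M G x c) in
      \<Oplus>\<^bsub>M\<^esub>p\<in>{p. c p \<noteq> \<zero>\<^bsub>M\<^esub>}. if even p then c p else \<ominus>\<^bsub>M\<^esub> c p)"

definition tensor_deg ::
  "('r, 'x) ring_scheme \<Rightarrow> ('r, 'a) module list \<Rightarrow> (int \<Rightarrow> 'a set) list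
     \<Rightarrow> int \<Rightarrow> ('a list \<Rightarrow> 'r) set set" where
  "tensor_deg R Ms Gs p =
     module_span R (tensor R Ms)
       {pure R Ms xs | xs ps.
          length xs = length Ms \<and> length ps = length Ms \<and>
          (\<forall>i<length Ms. xs ! i \<in> (Gs ! i) (ps ! i)) \<and> sum_list ps = p}"

text \<open>On homogeneous elements this is
  \<open>d (\<mu>\<^sub>1 \<otimes> \<dots> \<otimes> \<mu>\<^sub>k) =
     \<Sum>\<^sub>i (-1)\<^bsup>|\<mu>\<^sub>1| + \<dots> + |\<mu>\<^sub>i\<^sub>-\<^sub>1|\<^esup> \<mu>\<^sub>1 \<otimes> \<dots> \<otimes> d \<mu>\<^sub>i \<otimes> \<dots> \<otimes> \<mu>\<^sub>k\<close>.\<close>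

definition tensor_diff ::
  "('r, 'x) ring_scheme \<Rightarrow> ('r, 'a) module list \<Rightarrow> (int \<Rightarrow> 'a set) list \<Rightarrow> ('a \<Rightarrow> 'a) list
     \<Rightarrow> ('a list \<Rightarrow> 'r) set \<Rightarrow> ('a list \<Rightarrow> 'r) set" where
  "tensor_diff R Ms Gs ds =
     tensor_lift R (tensor R Ms)
       (\<lambda>xs. \<Oplus>\<^bsub>tensor R Ms\<^esub>i\<in>{..<length Ms}.
          pure R Ms (map (\<lambda>j. if j < i then koszul (Ms ! j) (Gs ! j) (xs ! j)
                               else if j = i then (ds ! j) (xs ! j)
                               else xs ! j) [0..<length Ms]))"


section \<open>Surjections and substitution\<close>

text \<open>A map \<open>t\<close> from an \<open>n\<close>-element to a \<open>k\<close>-element ordinal is encoded by its list of values, with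
  both ordinals numbered from \<open>0\<close>: the value at the element \<open>a < n\<close> is \<open>t ! a\<close>.\<close>

definition Sur :: "nat \<Rightarrow> nat \<Rightarrow> nat list set" where
  "Sur n k = {t. length t = n \<and> set t = {..<k}}"

definition Surs :: "nat \<Rightarrow> nat list set" where
  "Surs n = (\<Union>k. Sur n k)"

definition vertices :: "nat list \<Rightarrow> nat" where
  "vertices t = card (set t)"

definition arity_list :: "nat list \<Rightarrow> nat list" where
  "arity_list t = map (\<lambda>j. count_list t j + 1) [0..<vertices t]"

definition corolla :: "nat \<Rightarrow> nat list" where
  "corolla n = replicate n 0"

text \<open>The element \<open>a\<close> is preceded by \<open>count_list (take a t) (t ! a)\<close> elements of its block.\<close>

definition sur_subst :: "nat list \<Rightarrow> nat list list \<Rightarrow> nat list" where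
  "sur_subst t ts =
     map (\<lambda>a. (\<Sum>i<t ! a. vertices (ts ! i)) + ts ! (t ! a) ! count_list (take a t) (t ! a))
       [0..<length t]"

definition substitutable :: "nat list \<Rightarrow> nat list list \<Rightarrow> bool" where
  "substitutable t ts \<longleftrightarrow>
     length ts = vertices t \<and> (\<forall>j<vertices t. ts ! j \<in> Surs (count_list t j))"

definition sur_sign :: "nat list \<Rightarrow> int" where
  "sur_sign t =
     (let vs = filter (\<lambda>a. t ! a = 0) [0..<length t] @ filter (\<lambda>a. t ! a = 1) [0..<length t]
      in sign (\<lambda>i. if i < length t then vs ! i else i) * (- 1) ^ count_list t 0)"


section \<open>Permutads\<close>

text \<open>The identity operation, the generator of the arity-one component, is encoded as
  \<open>\<Gamma> [] []\<close>, the operation attached to the empty surjection (which has no vertices). Components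
  \<open>P n\<close> with \<open>n = 0\<close> are irrelevant throughout.\<close>

definition permutad ::
  "('r, 'x) ring_scheme \<Rightarrow> (nat \<Rightarrow> ('r, 'a) module) \<Rightarrow> (nat list \<Rightarrow> 'a list \<Rightarrow> 'a) \<Rightarrow> bool" where
  "permutad R P \<Gamma> \<longleftrightarrow>
     (\<forall>n\<ge>1. module R (P n)) \<and>
     \<Gamma> [] [] \<in> carrier (P 1) \<and>
     bij_betw (\<lambda>r. r \<odot>\<^bsub>P 1\<^esub> \<Gamma> [] []) (carrier R) (carrier (P 1)) \<and>
     (\<forall>n\<ge>1. \<forall>t\<in>Surs n. multilinear R (map P (arity_list t)) (P (n + 1)) (\<Gamma> t)) \<and>
     (\<forall>n\<ge>1. \<forall>\<mu>\<in>carrier (P (n + 1)). \<Gamma> (corolla n) [\<mu>] = \<mu>) \<and>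
     (\<forall>n\<ge>1. \<forall>t\<in>Surs n. \<forall>ts. substitutable t ts \<longrightarrow>
        (\<forall>\<nu>s. list_all2 (\<lambda>\<mu>s s. \<mu>s \<in> tuples (map P (arity_list s))) \<nu>s ts \<longrightarrow>
           \<Gamma> (sur_subst t ts) (concat \<nu>s) = \<Gamma> t (map2 \<Gamma> ts \<nu>s)))"

text \<open>The arity-graded module \<open>\<P>(M)\<close>. In arity one the only surjection is the empty one, whose
  tensor product over no factors is the ground ring; its generator is the identity.\<close>

definition trees ::
  "('r, 'x) ring_scheme \<Rightarrow> (nat \<Rightarrow> ('r, 'a) module)
     \<Rightarrow> nat \<Rightarrow> ('r, nat list \<Rightarrow> ('a list \<Rightarrow> 'r) set) module" where
  "trees R M n = sum_module (Surs (n - 1)) (\<lambda>t. tensor R (map M (arity_list t)))"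

definition trees_deg ::
  "('r, 'x) ring_scheme \<Rightarrow> (nat \<Rightarrow> ('r, 'a) module) \<Rightarrow> (nat \<Rightarrow> int \<Rightarrow> 'a set)
     \<Rightarrow> nat \<Rightarrow> int \<Rightarrow> (nat list \<Rightarrow> ('a list \<Rightarrow> 'r) set) set" where
  "trees_deg R M G n p =
     (\<Pi>\<^sub>E t\<in>Surs (n - 1). tensor_deg R (map M (arity_list t)) (map G (arity_list t)) p)"

definition trees_diff ::
  "('r, 'x) ring_scheme \<Rightarrow> (nat \<Rightarrow> ('r, 'a) module) \<Rightarrow> (nat \<Rightarrow> int \<Rightarrow> 'a set) \<Rightarrow> (nat \<Rightarrow> 'a \<Rightarrow> 'a)
     \<Rightarrow> nat \<Rightarrow> (nat list \<Rightarrow> ('a list \<Rightarrow> 'r) set) \<Rightarrow> (nat list \<Rightarrow> ('a list \<Rightarrow> 'r) set)" where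
  "trees_diff R M G d n x =
     (\<lambda>t\<in>Surs (n - 1).
        tensor_diff R (map M (arity_list t)) (map G (arity_list t)) (map d (arity_list t)) (x t))"

text \<open>The composition on \<open>\<P>(M)\<close> induced by substitution: it sends the decorated surjections
  \<open>(t\<^sub>1; \<mu>\<^sup>1), \<dots>, (t\<^sub>k; \<mu>\<^sup>k)\<close> to \<open>((t; t\<^sub>1, \<dots>, t\<^sub>k); \<mu>\<^sup>1 @ \<dots> @ \<mu>\<^sup>k)\<close>.\<close>

definition trees_comp ::
  "('r, 'x) ring_scheme \<Rightarrow> (nat \<Rightarrow> ('r, 'a) module) \<Rightarrow> nat list
     \<Rightarrow> (nat list \<Rightarrow> ('a list \<Rightarrow> 'r) set) list \<Rightarrow> (nat list \<Rightarrow> ('a list \<Rightarrow> 'r) set)" where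
  "trees_comp R M t xs =
     (\<lambda>u\<in>Surs (length t).
        \<Oplus>\<^bsub>tensor R (map M (arity_list u))\<^esub>ts\<in>{ts. substitutable t ts \<and> sur_subst t ts = u}.
          tensor_concat R (map (\<lambda>s. map M (arity_list s)) ts) (map2 (\<lambda>x s. x s) xs ts))"

definition structure_map ::
  "('r, 'x) ring_scheme \<Rightarrow> (nat \<Rightarrow> ('r, 'a) module) \<Rightarrow> (nat list \<Rightarrow> 'a list \<Rightarrow> 'a)
     \<Rightarrow> nat \<Rightarrow> (nat list \<Rightarrow> ('a list \<Rightarrow> 'r) set) \<Rightarrow> 'a" where
  "structure_map R P \<Gamma> n x = (\<Oplus>\<^bsub>P n\<^esub>t\<in>Surs (n - 1). tensor_lift R (P n) (\<Gamma> t) (x t))"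

definition structure_map_commutes ::
  "('r, 'x) ring_scheme \<Rightarrow> (nat \<Rightarrow> ('r, 'a) module) \<Rightarrow> (nat \<Rightarrow> int \<Rightarrow> 'a set) \<Rightarrow> (nat \<Rightarrow> 'a \<Rightarrow> 'a)
     \<Rightarrow> (nat list \<Rightarrow> 'a list \<Rightarrow> 'a) \<Rightarrow> bool" where
  "structure_map_commutes R P G d \<Gamma> \<longleftrightarrow>
     (\<forall>n\<ge>1. \<forall>x\<in>carrier (trees R P n).
        structure_map R P \<Gamma> n (trees_diff R P G d n x) = d n (structure_map R P \<Gamma> n x))"

text \<open>In arity one the last two conditions say that the identity has degree \<open>0\<close> and is a cycle.\<close>

definition dg_permutad ::
  "('r, 'x) ring_scheme \<Rightarrow> (nat \<Rightarrow> ('r, 'a) module) \<Rightarrow> (nat \<Rightarrow> int \<Rightarrow> 'a set) \<Rightarrow> (nat \<Rightarrow> 'a \<Rightarrow> 'a)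
     \<Rightarrow> (nat list \<Rightarrow> 'a list \<Rightarrow> 'a) \<Rightarrow> bool" where
  "dg_permutad R P G d \<Gamma> \<longleftrightarrow>
     permutad R P \<Gamma> \<and>
     (\<forall>n\<ge>1. dg_module R (P n) (G n) (d n)) \<and>
     (\<forall>n\<ge>1. \<forall>p. structure_map R P \<Gamma> n ` trees_deg R P G n p \<subseteq> G n p) \<and>
     structure_map_commutes R P G d \<Gamma>"

definition graded_permutad_iso ::
  "('r, 'x) ring_scheme
     \<Rightarrow> (nat \<Rightarrow> ('r, 'a) module) \<Rightarrow> (nat \<Rightarrow> int \<Rightarrow> 'a set) \<Rightarrow> (nat list \<Rightarrow> 'a list \<Rightarrow> 'a)
     \<Rightarrow> (nat \<Rightarrow> ('r, 'b) module) \<Rightarrow> (nat \<Rightarrow> int \<Rightarrow> 'b set) \<Rightarrow> (nat list \<Rightarrow> 'b list \<Rightarrow> 'b)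
     \<Rightarrow> (nat \<Rightarrow> 'a \<Rightarrow> 'b) \<Rightarrow> bool" where
  "graded_permutad_iso R P G \<Gamma> Q H \<Delta> f \<longleftrightarrow>
     (\<forall>n\<ge>1. graded_iso R (P n) (G n) (Q n) (H n) (f n)) \<and>
     (\<forall>n. \<forall>t\<in>Surs n. \<forall>xs\<in>tuples (map P (arity_list t)).
        f (n + 1) (\<Gamma> t xs) = \<Delta> t (map2 f (arity_list t) xs))"

text \<open>The graded permutad underlying a dg permutad \<open>(P, G, d, \<Gamma>)\<close> is free on the graded
  arity-graded module \<open>(M, H)\<close>.\<close>

definition quasi_free_on ::
  "('r, 'x) ring_scheme \<Rightarrow> (nat \<Rightarrow> ('r, 'm) module) \<Rightarrow> (nat \<Rightarrow> int \<Rightarrow> 'm set)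
     \<Rightarrow> (nat \<Rightarrow> ('r, 'a) module) \<Rightarrow> (nat \<Rightarrow> int \<Rightarrow> 'a set) \<Rightarrow> (nat list \<Rightarrow> 'a list \<Rightarrow> 'a) \<Rightarrow> bool" where
  "quasi_free_on R M H P G \<Gamma> \<longleftrightarrow>
     (\<forall>n\<ge>1. graded_module R (M n) (H n)) \<and> carrier (M 1) = {\<zero>\<^bsub>M 1\<^esub>} \<and>
     (\<exists>f. graded_permutad_iso R (trees R M) (trees_deg R M H) (trees_comp R M) P G \<Gamma> f)"


section \<open>The cellular chain complex of the permutohedron\<close>

text \<open>\<open>perm_chains R n\<close> is the complex of the permutohedron of dimension \<open>n - 1\<close>, spanned by
  its vertices \<open>(\<sigma>(1), \<dots>, \<sigma>(n))\<close>; its cells are the surjections with source of size \<open>n\<close>.\<close>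

definition perm_chains :: "('r, 'x) ring_scheme \<Rightarrow> nat \<Rightarrow> ('r, nat list \<Rightarrow> 'r) module" where
  "perm_chains R n = free_module R (Surs n)"

definition perm_chains_deg :: "('r, 'x) ring_scheme \<Rightarrow> nat \<Rightarrow> int \<Rightarrow> (nat list \<Rightarrow> 'r) set" where
  "perm_chains_deg R n p =
     {f \<in> carrier (perm_chains R n). \<forall>t. f t \<noteq> \<zero>\<^bsub>R\<^esub> \<longrightarrow> int n - int (vertices t) = p}"

text \<open>The cell \<open>t\<close> is a product of permutohedra, one of dimension \<open>count_list t i - 1\<close> for every
  vertex \<open>i\<close>. Its face in which the \<open>i\<close>-th factor is replaced by the facet \<open>s\<close> of that factor is
  the substitution of \<open>s\<close> at \<open>i\<close> and of corollas at the other vertices.\<close>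

definition cell_boundary :: "('r, 'x) ring_scheme \<Rightarrow> nat list \<Rightarrow> nat list \<Rightarrow> 'r" where
  "cell_boundary R t =
     (\<Oplus>\<^bsub>perm_chains R (length t)\<^esub>i\<in>{..<vertices t}.
      \<Oplus>\<^bsub>perm_chains R (length t)\<^esub>s\<in>Sur (count_list t i) 2.
        [((- 1) ^ (\<Sum>j<i. count_list t j - 1) * sur_sign s)] \<cdot>\<^bsub>perm_chains R (length t)\<^esub>
          basis_elt R
            (sur_subst t ((map (\<lambda>j. corolla (count_list t j)) [0..<vertices t])[i := s])))"

definition perm_boundary ::
  "('r, 'x) ring_scheme \<Rightarrow> nat \<Rightarrow> (nat list \<Rightarrow> 'r) \<Rightarrow> (nat list \<Rightarrow> 'r)" where
  "perm_boundary R n f =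
     (\<Oplus>\<^bsub>perm_chains R n\<^esub>t\<in>Surs n. f t \<odot>\<^bsub>perm_chains R n\<^esub> cell_boundary R t)"


section \<open>The permutad \<open>permAs\<^sub>\<infinity>\<close>\<close>

text \<open>The module \<open>V n\<close> is free of rank one on the generator \<open>m\<^sub>n = \<one>\<close> of degree \<open>n - 2\<close> for
  \<open>n \<ge> 2\<close>, and zero otherwise.\<close>

definition V :: "('r, 'x) ring_scheme \<Rightarrow> nat \<Rightarrow> ('r, 'r) module" where
  "V R n =
     \<lparr>carrier = (if n \<ge> 2 then carrier R else {\<zero>\<^bsub>R\<^esub>}), 
      monoid.mult = (\<lambda>x y. x), one = \<zero>\<^bsub>R\<^esub>,
      zero = \<zero>\<^bsub>R\<^esub>, add = (\<lambda>x y. x \<oplus>\<^bsub>R\<^esub> y), smult = (\<lambda>r x. r \<otimes>\<^bsub>R\<^esub> x)\<rparr>"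

definition V_deg :: "('r, 'x) ring_scheme \<Rightarrow> nat \<Rightarrow> int \<Rightarrow> 'r set" where
  "V_deg R n p = (if p = int n - 2 then carrier (V R n) else {\<zero>\<^bsub>R\<^esub>})"

definition permAs ::
  "('r, 'x) ring_scheme \<Rightarrow> nat \<Rightarrow> ('r, nat list \<Rightarrow> ('r list \<Rightarrow> 'r) set) module" where
  "permAs R = trees R (V R)"

definition permAs_deg ::
  "('r, 'x) ring_scheme \<Rightarrow> nat \<Rightarrow> int \<Rightarrow> (nat list \<Rightarrow> ('r list \<Rightarrow> 'r) set) set" where
  "permAs_deg R = trees_deg R (V R) (V_deg R)"

definition permAs_comp ::
  "('r, 'x) ring_scheme \<Rightarrow> nat list \<Rightarrow> (nat list \<Rightarrow> ('r list \<Rightarrow> 'r) set) list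
     \<Rightarrow> (nat list \<Rightarrow> ('r list \<Rightarrow> 'r) set)" where
  "permAs_comp R = trees_comp R (V R)"

text \<open>The identification of cellular chains with elements of arity \<open>n\<close>: the vertices of a
  surjection are decorated by the generators \<open>m\<close>.\<close>

definition decorate ::
  "('r, 'x) ring_scheme \<Rightarrow> nat \<Rightarrow> (nat list \<Rightarrow> 'r) \<Rightarrow> (nat list \<Rightarrow> ('r list \<Rightarrow> 'r) set)" where
  "decorate R n f =
     (\<lambda>t\<in>Surs (n - 1).
        f t \<odot>\<^bsub>tensor R (map (V R) (arity_list t))\<^esub>
          pure R (map (V R) (arity_list t)) (map (\<lambda>a. \<one>\<^bsub>R\<^esub>) (arity_list t)))"

definition permAs_diff ::
  "('r, 'x) ring_scheme \<Rightarrow> nat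
     \<Rightarrow> (nat list \<Rightarrow> ('r list \<Rightarrow> 'r) set) \<Rightarrow> (nat list \<Rightarrow> ('r list \<Rightarrow> 'r) set)" where
  "permAs_diff R n x =
     decorate R n (perm_boundary R (n - 1)
       (inv_into (carrier (perm_chains R (n - 1))) (decorate R n) x))"

end

theory Submission
  imports Defs
begin

text \<open>The tensor product of the rank one modules decorating a surjection is free on the tensor of the
  generators, so \<open>decorate\<close> identifies \<open>permAs\<close> in arity \<open>n + 1\<close> with the free module on the surjections
  with source of size \<open>n\<close>. All structure maps being multilinear, every identity may be checked on these
  basis elements, where composition is substitution of surjections. The permutad axioms become the
  associativity of substitution.

  The boundary is given by an integral incidence matrix. Splitting a vertex of \<open>t\<^sub>j\<close> inside
  \<open>(t; t\<^sub>1, \<dots>, t\<^sub>k)\<close> is the same as splitting it in \<open>t\<^sub>j\<close> first, and the sum of the degrees of the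
  vertices of \<open>t\<^sub>i\<close> is the degree of \<open>t\<^sub>i\<close>, so the Koszul signs agree and the structure map commutes with
  the differentials. For \<open>d\<^sup>2 = 0\<close> the matrix is read by columns: the entries of the column of \<open>u\<close>
  correspond to merging two adjacent blocks of \<open>u\<close>, and two merges commute with opposite signs.\<close>

section \<open>Linear maps and spans\<close>

text \<open>Read by rows, \<open>d^2 = 0\<close> would compare two splittings of a cell, in one
  factor or in two, with shuffle signs in each case. Read by columns there is a single family of
  pairs, because the cells with facet \<open>u\<close> are indexed by the gaps between consecutive
  blocks of \<open>u\<close>. The sign of the shuffle is a coboundary: an inversion of
  \<open>u\<close> either lies inside the two merged blocks or survives the merge, so rescaling each
  cell by -1 to the number of its inversions removes these signs. What remains at the gap
  \<open>p\<close> is the parity of \<open>p\<close> plus the number of elements in the blocks up to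
  \<open>p\<close>. A merge further down lowers the position of a higher gap by one but keeps the
  number of elements below it; this shift is the only source of the opposite sign. All signs are
  compared over the integers and mapped to \<open>R\<close> afterwards, so nothing depends on its
  characteristic.\<close>

lemma linear_mapI:
  assumes "\<And>x. x \<in> carrier M \<Longrightarrow> f x \<in> carrier N"
    and "\<And>x y. x \<in> carrier M \<Longrightarrow> y \<in> carrier M \<Longrightarrow> f (x \<oplus>\<^bsub>M\<^esub> y) = f x \<oplus>\<^bsub>N\<^esub> f y"
    and "\<And>r x. r \<in> carrier R \<Longrightarrow> x \<in> carrier M \<Longrightarrow> f (r \<odot>\<^bsub>M\<^esub> x) = r \<odot>\<^bsub>N\<^esub> f x"
  shows "linear_map R M N f"
  using assms by (simp add: linear_map_def)

lemma linear_mapD: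
  assumes "linear_map R M N f"
  shows "x \<in> carrier M \<Longrightarrow> f x \<in> carrier N"
    and "x \<in> carrier M \<Longrightarrow> y \<in> carrier M \<Longrightarrow> f (x \<oplus>\<^bsub>M\<^esub> y) = f x \<oplus>\<^bsub>N\<^esub> f y"
    and "r \<in> carrier R \<Longrightarrow> x \<in> carrier M \<Longrightarrow> f (r \<odot>\<^bsub>M\<^esub> x) = r \<odot>\<^bsub>N\<^esub> f x"
  using assms by (auto simp: linear_map_def)

lemma linear_map_zero:
  assumes "module R M" "module R N" "linear_map R M N f"
  shows "f \<zero>\<^bsub>M\<^esub> = \<zero>\<^bsub>N\<^esub>"
proof -
  interpret M: module R M by fact
  interpret N: module R N by fact
  have "f (\<zero>\<^bsub>R\<^esub> \<odot>\<^bsub>M\<^esub> \<zero>\<^bsub>M\<^esub>) = \<zero>\<^bsub>R\<^esub> \<odot>\<^bsub>N\<^esub> f \<zero>\<^bsub>M\<^esub>"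
    by (rule linear_mapD[OF assms(3)]) auto
  then show ?thesis using linear_mapD(1)[OF assms(3), of "\<zero>\<^bsub>M\<^esub>"] by simp
qed

lemma linear_map_minus:
  assumes "module R M" "module R N" "linear_map R M N f" "x \<in> carrier M"
  shows "f (\<ominus>\<^bsub>M\<^esub> x) = \<ominus>\<^bsub>N\<^esub> f x"
proof -
  interpret M: module R M by fact
  interpret N: module R N by fact
  have "f x \<oplus>\<^bsub>N\<^esub> f (\<ominus>\<^bsub>M\<^esub> x) = \<zero>\<^bsub>N\<^esub>"
    using linear_mapD(2)[OF assms(3), of x "\<ominus>\<^bsub>M\<^esub> x"] assms(4) linear_map_zero[OF assms(1-3)]
    by (simp add: M.r_neg)
  then show ?thesis
    using linear_mapD(1)[OF assms(3)] assms(4)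
    by (metis M.a_inv_closed N.a_comm N.minus_equality)
qed

lemma linear_map_finsum:
  assumes "module R M" "module R N" "linear_map R M N f" "g \<in> A \<rightarrow> carrier M"
  shows "f (\<Oplus>\<^bsub>M\<^esub>a\<in>A. g a) = (\<Oplus>\<^bsub>N\<^esub>a\<in>A. f (g a))"
proof -
  interpret M: module R M by fact
  interpret N: module R N by fact
  show ?thesis using assms(4)
  proof (induction A rule: infinite_finite_induct)
    case (insert x F)
    then show ?case using linear_mapD[OF assms(3)] by (simp add: Pi_def)
  \<comment> \<open>A sum over an infinite index set is zero by convention, so this case, like the
    empty one, is preservation of zero.\<close>
  qed (auto simp: linear_map_zero[OF assms(1-3)])
qed

lemma linear_map_comp:
  assumes "linear_map R M N f" "linear_map R N Q g"
  shows "linear_map R M Q (\<lambda>x. g (f x))"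
  by (rule linear_mapI) (auto simp: linear_mapD[OF assms(1)] linear_mapD[OF assms(2)])

lemma linear_map_id: "linear_map R M M (\<lambda>x. x)"
  by (auto simp: linear_map_def)

text \<open>\<open>linear_map\<close> constrains a function only on the carrier. The module
  structure ensures that the sums and multiples to which the function is applied lie in the carrier
  as well.\<close>

lemma linear_map_cong:
  assumes "\<And>x. x \<in> carrier M \<Longrightarrow> f x = g x" "module R M"
  shows "linear_map R M N f \<longleftrightarrow> linear_map R M N g"
proof -
  interpret M: module R M by fact
  show ?thesis using assms(1) unfolding linear_map_def Pi_def by simp
qed

lemma linear_map_add:
  assumes "module R N" "linear_map R M N f" "linear_map R M N g"
  shows "linear_map R M N (\<lambda>x. f x \<oplus>\<^bsub>N\<^esub> g x)"
proof -
  interpret N: module R N by fact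
  show ?thesis
    by (rule linear_mapI)
      (auto simp: linear_mapD[OF assms(2)] linear_mapD[OF assms(3)] N.smult_r_distr N.a_ac)
qed

lemma linear_map_smult:
  assumes "module R N" "linear_map R M N f" "r \<in> carrier R"
  shows "linear_map R M N (\<lambda>x. r \<odot>\<^bsub>N\<^esub> f x)"
proof -
  interpret N: module R N by fact
  show ?thesis
    by (rule linear_mapI)
      (use assms(3) in \<open>auto simp: linear_mapD[OF assms(2)] N.smult_r_distr
        N.smult_assoc1[symmetric] N.m_comm\<close>)
qed

lemma linear_map_sum:
  assumes "module R M" "module R N" "\<And>a. a \<in> A \<Longrightarrow> linear_map R M N (f a)"
  shows "linear_map R M N (\<lambda>x. \<Oplus>\<^bsub>N\<^esub>a\<in>A. f a x)"
proof -
  interpret N: module R N by fact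
  show ?thesis using assms(3)
  proof (induction A rule: infinite_finite_induct)
    case (insert a F)
    have *: "(\<Oplus>\<^bsub>N\<^esub>b\<in>insert a F. f b x) = f a x \<oplus>\<^bsub>N\<^esub> (\<Oplus>\<^bsub>N\<^esub>b\<in>F. f b x)" if "x \<in> carrier M" for x
      using insert that linear_mapD(1)[OF insert(4)] by (subst N.finsum_insert) (auto simp: Pi_def)
    have "linear_map R M N (\<lambda>x. f a x \<oplus>\<^bsub>N\<^esub> (\<Oplus>\<^bsub>N\<^esub>b\<in>F. f b x))"
      by (intro linear_map_add assms(2)) (use insert in auto)
    then show ?case by (subst linear_map_cong[OF _ assms(1)]) (use * in auto)
  qed (auto intro!: linear_mapI)
qed

lemma submoduleD:
  assumes "module R M" "submodule K R M"
  shows "x \<in> K \<Longrightarrow> x \<in> carrier M" and "\<zero>\<^bsub>M\<^esub> \<in> K"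
    and "x \<in> K \<Longrightarrow> y \<in> K \<Longrightarrow> x \<oplus>\<^bsub>M\<^esub> y \<in> K"
    and "r \<in> carrier R \<Longrightarrow> x \<in> K \<Longrightarrow> r \<odot>\<^bsub>M\<^esub> x \<in> K"
    and "x \<in> K \<Longrightarrow> \<ominus>\<^bsub>M\<^esub> x \<in> K"
  using module.submoduleE[OF assms] assms(2)
    subgroup.one_closed[OF submodule.axioms(1)[OF assms(2)]] by auto

lemma submodule_finsum:
  assumes "module R M" "submodule K R M" "\<And>a. a \<in> A \<Longrightarrow> f a \<in> K"
  shows "(\<Oplus>\<^bsub>M\<^esub>a\<in>A. f a) \<in> K"
proof -
  interpret M: module R M by fact
  note * = submoduleD[OF assms(1,2)]
  show ?thesis using assms(3)
    by (induction A rule: infinite_finite_induct) (auto simp: * Pi_def)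
qed

lemma submodule_zero:
  assumes "module R M"
  shows "submodule {\<zero>\<^bsub>M\<^esub>} R M"
proof -
  interpret M: module R M by fact
  show ?thesis by (rule M.submoduleI) auto
qed

lemma submodule_vimage:
  assumes "module R M" "module R N" "linear_map R M N f" "submodule K R N"
  shows "submodule {x \<in> carrier M. f x \<in> K} R M"
proof -
  interpret M: module R M by fact
  interpret N: module R N by fact
  show ?thesis
    by (rule M.submoduleI)
      (auto simp: linear_map_zero[OF assms(1-3)] linear_map_minus[OF assms(1-3)]
         linear_mapD[OF assms(3)] submoduleD[OF assms(2,4)])
qed

lemma submodule_eq:
  assumes "module R M" "module R N" "linear_map R M N f" "linear_map R M N g"
  shows "submodule {x \<in> carrier M. f x = g x} R M"
proof -
  interpret M: module R M by fact
  interpret N: module R N by fact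
  show ?thesis
    by (rule M.submoduleI)
      (auto simp: linear_map_zero[OF assms(1-3)] linear_map_minus[OF assms(1-3)]
         linear_mapD[OF assms(3)] linear_map_zero[OF assms(1,2,4)] linear_map_minus[OF assms(1,2,4)]
         linear_mapD[OF assms(4)])
qed

lemma submodule_image:
  assumes "module R M" "module R N" "linear_map R M N f" "submodule K R M"
  shows "submodule (f ` K) R N"
proof -
  interpret M: module R M by fact
  interpret N: module R N by fact
  note K = submoduleD[OF assms(1,4)] and f = linear_mapD[OF assms(3)]
  show ?thesis
  proof (rule N.submoduleI)
    show "f ` K \<subseteq> carrier N" using K(1) f(1) by auto
    show "\<zero>\<^bsub>N\<^esub> \<in> f ` K" using linear_map_zero[OF assms(1-3)] K(2) by (metis imageI)
    show "\<ominus>\<^bsub>N\<^esub> a \<in> f ` K" if "a \<in> f ` K" for a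
    proof -
      obtain x where x: "x \<in> K" "a = f x" using \<open>a \<in> f ` K\<close> by auto
      show ?thesis using x linear_map_minus[OF assms(1-3) K(1)[OF x(1)]] K(5)[OF x(1)] by (metis imageI)
    qed
    show "a \<oplus>\<^bsub>N\<^esub> b \<in> f ` K" if "a \<in> f ` K" "b \<in> f ` K" for a b
    proof -
      obtain x y where x: "x \<in> K" "a = f x" "y \<in> K" "b = f y" using \<open>a \<in> f ` K\<close> \<open>b \<in> f ` K\<close> by auto
      show ?thesis using x f(2)[OF K(1)[OF x(1)] K(1)[OF x(3)]] K(3)[OF x(1,3)] by (metis imageI)
    qed
    show "r \<odot>\<^bsub>N\<^esub> a \<in> f ` K" if "r \<in> carrier R" "a \<in> f ` K" for a r
    proof -
      obtain x where x: "x \<in> K" "a = f x" using \<open>a \<in> f ` K\<close> by auto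
      show ?thesis using x f(3)[OF \<open>r \<in> carrier R\<close> K(1)[OF x(1)]] K(4)[OF \<open>r \<in> carrier R\<close> x(1)]
        by (metis imageI)
    qed
  qed
qed

lemma span_superset: "S \<subseteq> module_span R M S"
  by (auto simp: module_span_def)

lemma span_least: "submodule K R M \<Longrightarrow> S \<subseteq> K \<Longrightarrow> module_span R M S \<subseteq> K"
  by (auto simp: module_span_def)

text \<open>The carrier is one of the submodules intersected in \<open>module_span\<close>, which
  keeps the intersection inside it.\<close>

lemma submodule_span:
  assumes "module R M" "S \<subseteq> carrier M"
  shows "submodule (module_span R M S) R M"
proof -
  interpret M: module R M by fact
  note D = submoduleD[OF assms(1)]
  show ?thesis
  proof (rule M.submoduleI)
    show "module_span R M S \<subseteq> carrier M"
      by (rule span_least[OF M.carrier_is_submodule assms(2)])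
  qed (auto simp: module_span_def D(2) intro: D(3-5))
qed

text \<open>The preimage of \<open>K\<close> is a submodule, so it contains the span as soon as it
  contains \<open>S\<close>.\<close>

lemma linear_span_subset:
  assumes "module R M" "module R N" "linear_map R M N f" "submodule K R N"
    and "S \<subseteq> carrier M" "\<And>x. x \<in> S \<Longrightarrow> f x \<in> K" "x \<in> module_span R M S"
  shows "f x \<in> K"
  using span_least[OF submodule_vimage[OF assms(1-4)], of S] assms(5-7) by auto

text \<open>The equalizer of two linear maps is a submodule. Identities are reduced to generators
  through this lemma or through its multilinear form.\<close>

lemma linear_eq_on_span:
  assumes "module R M" "module R N" "linear_map R M N f" "linear_map R M N g"
    and "S \<subseteq> carrier M" "\<And>x. x \<in> S \<Longrightarrow> f x = g x" "x \<in> module_span R M S"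
  shows "f x = g x"
  using span_least[OF submodule_eq[OF assms(1-4)], of S] assms(5-7) by auto

section \<open>Free modules, quotients, finite sums\<close>

lemma free_module_simps [simp]:
  "\<zero>\<^bsub>free_module R S\<^esub> = (\<lambda>s. \<zero>\<^bsub>R\<^esub>)"
  "f \<oplus>\<^bsub>free_module R S\<^esub> g = (\<lambda>s. f s \<oplus>\<^bsub>R\<^esub> g s)"
  "r \<odot>\<^bsub>free_module R S\<^esub> f = (\<lambda>s. r \<otimes>\<^bsub>R\<^esub> f s)"
  by (simp_all add: free_module_def)

lemma free_module_carrier:
  "f \<in> carrier (free_module R S) \<longleftrightarrow>
     (\<forall>s\<in>S. f s \<in> carrier R) \<and> (\<forall>s. s \<notin> S \<longrightarrow> f s = \<zero>\<^bsub>R\<^esub>) \<and> finite {s. f s \<noteq> \<zero>\<^bsub>R\<^esub>}"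
  by (simp add: free_module_def)

lemma free_module_app:
  fixes R (structure)
  assumes "cring R" "f \<in> carrier (free_module R S)" shows "f s \<in> carrier R"
proof -
  interpret cring R by fact
  show ?thesis using assms(2) by (cases "s \<in> S") (auto simp: free_module_carrier)
qed

lemma module_free_module:
  fixes R (structure)
  assumes "cring R" shows "module R (free_module R S)"
proof -
  interpret cring R by fact
  note app = free_module_app[OF assms]
  show ?thesis
  proof (rule moduleI[OF assms])
    show "abelian_group (free_module R S)"
    proof (rule abelian_groupI)
      fix f g assume fg: "f \<in> carrier (free_module R S)" "g \<in> carrier (free_module R S)"
      have "{s. f s \<oplus> g s \<noteq> \<zero>} \<subseteq> {s. f s \<noteq> \<zero>} \<union> {s. g s \<noteq> \<zero>}" by auto
      then show "f \<oplus>\<^bsub>free_module R S\<^esub> g \<in> carrier (free_module R S)"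
        using fg unfolding free_module_carrier by (auto intro: finite_subset)
      have "{s. \<ominus> f s \<noteq> \<zero>} \<subseteq> {s. f s \<noteq> \<zero>}" by auto
      then have "(\<lambda>s. \<ominus> f s) \<in> carrier (free_module R S)"
        using fg unfolding free_module_carrier by (auto intro: finite_subset)
      moreover have "(\<lambda>s. \<ominus> f s) \<oplus>\<^bsub>free_module R S\<^esub> f = \<zero>\<^bsub>free_module R S\<^esub>"
        using app[OF fg(1)] by (simp add: l_neg)
      ultimately show "\<exists>y\<in>carrier (free_module R S). y \<oplus>\<^bsub>free_module R S\<^esub> f = \<zero>\<^bsub>free_module R S\<^esub>"
        by blast
    qed (auto simp: app a_ac free_module_carrier[of "\<lambda>_. \<zero>"] intro!: ext)
  next
    fix r f assume rf: "r \<in> carrier R" "f \<in> carrier (free_module R S)"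
    have "{s. r \<otimes> f s \<noteq> \<zero>} \<subseteq> {s. f s \<noteq> \<zero>}" using rf by auto
    then show "r \<odot>\<^bsub>free_module R S\<^esub> f \<in> carrier (free_module R S)"
      using rf unfolding free_module_carrier by (auto intro: finite_subset)
  qed (auto simp: app l_distr r_distr m_assoc)
qed

lemma basis_elt_closed [simp]:
  fixes R (structure)
  assumes "cring R" "s \<in> S" shows "basis_elt R s \<in> carrier (free_module R S)"
proof -
  interpret cring R by fact
  have "{s'. basis_elt R s s' \<noteq> \<zero>} \<subseteq> {s}" by (auto simp: basis_elt_def)
  then show ?thesis using assms(2) unfolding free_module_carrier
    by (auto simp: basis_elt_def intro: finite_subset)
qed

lemma finsum_free_module_app:
  fixes R (structure)
  assumes "cring R" "f \<in> A \<rightarrow> carrier (free_module R S)"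
  shows "(\<Oplus>\<^bsub>free_module R S\<^esub>a\<in>A. f a) s = (\<Oplus>\<^bsub>R\<^esub>a\<in>A. f a s)"
proof -
  interpret cring R by fact
  interpret F: module R "free_module R S" by (rule module_free_module[OF assms(1)])
  show ?thesis using assms(2)
  proof (induction A rule: infinite_finite_induct)
    case (insert x F)
    then show ?case using free_module_app[OF assms(1), where S = S] by (subst F.finsum_insert) (auto simp: Pi_def)
  qed auto
qed

lemma finsum_single:
  assumes "abelian_monoid M" "finite A" "a \<in> A" "f a \<in> carrier M"
    and "\<And>b. b \<in> A \<Longrightarrow> b \<noteq> a \<Longrightarrow> f b = \<zero>\<^bsub>M\<^esub>"
  shows "(\<Oplus>\<^bsub>M\<^esub>b\<in>A. f b) = f a"
proof -
  interpret abelian_monoid M by fact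
  let ?f = "\<lambda>b. if b \<in> A then f b else \<zero>\<^bsub>M\<^esub>"
  have f: "?f \<in> A \<rightarrow> carrier M" using assms(4,5) by (auto simp: Pi_def) (metis zero_closed)
  have "(\<Oplus>\<^bsub>M\<^esub>b\<in>A. f b) = (\<Oplus>\<^bsub>M\<^esub>b\<in>A. if a = b then ?f b else \<zero>\<^bsub>M\<^esub>)"
    by (rule finsum_cong') (use assms in auto)
  also have "\<dots> = ?f a" by (rule finsum_singleton[OF assms(3,2) f])
  finally show ?thesis using assms(3) by simp
qed

text \<open>The index set may exceed the support, so that chains can be expanded over all of
  \<open>Surs n\<close> or over all cells of one degree.\<close>

lemma free_module_expand:
  fixes R (structure)
  assumes "cring R" "f \<in> carrier (free_module R S)" "finite A" "{s. f s \<noteq> \<zero>\<^bsub>R\<^esub>} \<subseteq> A" "A \<subseteq> S"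
  shows "f = (\<Oplus>\<^bsub>free_module R S\<^esub>s\<in>A. f s \<odot>\<^bsub>free_module R S\<^esub> basis_elt R s)"
proof
  interpret cring R by fact
  interpret F: module R "free_module R S" by (rule module_free_module[OF assms(1)])
  note app = free_module_app[OF assms(1,2)]
  have cl: "(\<lambda>s. f s \<odot>\<^bsub>free_module R S\<^esub> basis_elt R s) \<in> A \<rightarrow> carrier (free_module R S)"
    using assms by (auto simp: app simp del: free_module_simps intro!: F.smult_closed)
  fix x
  have "(\<Oplus>a\<in>A. f a \<otimes> basis_elt R a x) = f x"
  proof (cases "x \<in> A")
    case True
    then show ?thesis
      by (subst finsum_single[where a = x])
        (use True assms(3) app in \<open>auto simp: basis_elt_def abelian_monoid_axioms\<close>)
  next
    case False
    then have "(\<Oplus>a\<in>A. f a \<otimes> basis_elt R a x) = (\<Oplus>a\<in>A. \<zero>)"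
      by (intro finsum_cong') (auto simp: basis_elt_def app)
    moreover have "f x = \<zero>" using False assms(4) by auto
    ultimately show ?thesis by simp
  qed
  then show "f x = (\<Oplus>\<^bsub>free_module R S\<^esub>s\<in>A. f s \<odot>\<^bsub>free_module R S\<^esub> basis_elt R s) x"
    by (subst finsum_free_module_app[OF assms(1) cl]) simp
qed

lemma span_basis:
  assumes "cring R"
  shows "module_span R (free_module R S) (basis_elt R ` S) = carrier (free_module R S)"
proof
  let ?F = "free_module R S"
  interpret F: module R ?F by (rule module_free_module[OF assms(1)])
  have sub: "basis_elt R ` S \<subseteq> carrier ?F" using assms by auto
  note sm = submodule_span[OF F.module_axioms sub]
  show "module_span R ?F (basis_elt R ` S) \<subseteq> carrier ?F"
    using submoduleD(1)[OF F.module_axioms sm] by blast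
  show "carrier ?F \<subseteq> module_span R ?F (basis_elt R ` S)"
  proof
    fix f assume f: "f \<in> carrier ?F"
    let ?A = "{s. f s \<noteq> \<zero>\<^bsub>R\<^esub>}"
    have A: "finite ?A" "?A \<subseteq> S" using f by (auto simp: free_module_carrier)
    have "(\<Oplus>\<^bsub>?F\<^esub>s\<in>?A. f s \<odot>\<^bsub>?F\<^esub> basis_elt R s) \<in> module_span R ?F (basis_elt R ` S)"
      using A(2) span_superset[of "basis_elt R ` S" R ?F] free_module_app[OF assms f]
      by (intro submodule_finsum[OF F.module_axioms sm] submoduleD(4)[OF F.module_axioms sm]) auto
    then show "f \<in> module_span R ?F (basis_elt R ` S)"
      using free_module_expand[OF assms f A(1) _ A(2)] by simp
  qed
qed

lemma linear_eq_on_basis: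
  assumes "cring R" "module R N" "linear_map R (free_module R S) N f"
    "linear_map R (free_module R S) N g"
    "\<And>s. s \<in> S \<Longrightarrow> f (basis_elt R s) = g (basis_elt R s)" "x \<in> carrier (free_module R S)"
  shows "f x = g x"
  by (rule linear_eq_on_span[OF module_free_module[OF assms(1)] assms(2-4), of "basis_elt R ` S"])
    (use assms in \<open>auto simp: span_basis\<close>)

lemma quotient_module_simps [simp]:
  "\<zero>\<^bsub>quotient_module M N\<^esub> = N" "carrier (quotient_module M N) = a_rcosets\<^bsub>M\<^esub> N"
  "A \<oplus>\<^bsub>quotient_module M N\<^esub> B = A <+>\<^bsub>M\<^esub> B"
  "r \<odot>\<^bsub>quotient_module M N\<^esub> A = (\<Union>a\<in>A. N +>\<^bsub>M\<^esub> (r \<odot>\<^bsub>M\<^esub> a))"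
  by (simp_all add: quotient_module_def)

lemma abelian_subgroup_submodule:
  assumes "module R M" "submodule N R M" shows "abelian_subgroup N M"
proof -
  interpret M: module R M by fact
  show ?thesis
    by (rule abelian_subgroupI3[OF _ M.abelian_group_axioms])
      (rule additive_subgroupI[OF submodule.axioms(1)[OF assms(2)]])
qed

text \<open>The union that defines the scalar action is taken over equal cosets: two representatives
  differ by an element of \<open>N\<close>, and its multiples stay in \<open>N\<close>.\<close>

lemma quotient_smult_coset:
  assumes "module R M" "submodule N R M" "r \<in> carrier R" "x \<in> carrier M"
  shows "r \<odot>\<^bsub>quotient_module M N\<^esub> (N +>\<^bsub>M\<^esub> x) = N +>\<^bsub>M\<^esub> (r \<odot>\<^bsub>M\<^esub> x)"
proof -
  interpret M: module R M by fact
  interpret N: abelian_subgroup N M by (rule abelian_subgroup_submodule[OF assms(1,2)])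
  have *: "N +>\<^bsub>M\<^esub> (r \<odot>\<^bsub>M\<^esub> a) = N +>\<^bsub>M\<^esub> (r \<odot>\<^bsub>M\<^esub> x)" if "a \<in> N +>\<^bsub>M\<^esub> x" for a
  proof -
    obtain h where h: "h \<in> N" "a = h \<oplus>\<^bsub>M\<^esub> x" using \<open>a \<in> N +>\<^bsub>M\<^esub> x\<close> by (auto simp: a_r_coset_def')
    have "r \<odot>\<^bsub>M\<^esub> a = (r \<odot>\<^bsub>M\<^esub> h) \<oplus>\<^bsub>M\<^esub> (r \<odot>\<^bsub>M\<^esub> x)"
      using h assms(3,4) M.smult_r_distr[of r h x] by simp
    then have "r \<odot>\<^bsub>M\<^esub> a \<in> N +>\<^bsub>M\<^esub> (r \<odot>\<^bsub>M\<^esub> x)"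
      using submoduleD(4)[OF assms(1,2,3) h(1)] by (auto simp: a_r_coset_def')
    then show ?thesis
      by (rule M.a_repr_independence[OF _ _ N.a_subgroup, symmetric]) (simp add: assms(3,4))
  qed
  have "(\<Union>a\<in>N +>\<^bsub>M\<^esub> x. N +>\<^bsub>M\<^esub> (r \<odot>\<^bsub>M\<^esub> a)) = (\<Union>a\<in>N +>\<^bsub>M\<^esub> x. N +>\<^bsub>M\<^esub> (r \<odot>\<^bsub>M\<^esub> x))"
    by (rule SUP_cong[OF refl *])
  moreover have "x \<in> N +>\<^bsub>M\<^esub> x" using N.a_rcos_self assms(4) by simp
  ultimately show ?thesis by auto
qed

lemma module_quotient_module:
  assumes "module R M" "submodule N R M" shows "module R (quotient_module M N)"
proof -
  interpret M: module R M by fact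
  interpret N: abelian_subgroup N M by (rule abelian_subgroup_submodule[OF assms])
  have cos: "\<exists>x\<in>carrier M. A = N +>\<^bsub>M\<^esub> x" if "A \<in> a_rcosets\<^bsub>M\<^esub> N" for A
    using that by (auto simp: A_RCOSETS_def')
  have cl: "N +>\<^bsub>M\<^esub> x \<in> a_rcosets\<^bsub>M\<^esub> N" if "x \<in> carrier M" for x
    using that by (auto simp: A_RCOSETS_def')
  note sm = quotient_smult_coset[OF assms]
  show ?thesis
  proof (rule moduleI[OF M.cring_axioms])
    show "abelian_group (quotient_module M N)"
    proof (rule abelian_groupI)
      fix A assume A: "A \<in> carrier (quotient_module M N)"
      show "\<zero>\<^bsub>quotient_module M N\<^esub> \<oplus>\<^bsub>quotient_module M N\<^esub> A = A"
        using A N.rcosets_add_eq by simp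
      obtain x where x: "x \<in> carrier M" "A = N +>\<^bsub>M\<^esub> x" using A cos by auto
      have "N +>\<^bsub>M\<^esub> (\<ominus>\<^bsub>M\<^esub> x) <+>\<^bsub>M\<^esub> A = N"
        using x N.a_rcos_sum[of "\<ominus>\<^bsub>M\<^esub> x" x] M.l_neg[of x] M.a_coset_add_zero[OF N.a_subset] by simp
      then show "\<exists>y\<in>carrier (quotient_module M N). y \<oplus>\<^bsub>quotient_module M N\<^esub> A = \<zero>\<^bsub>quotient_module M N\<^esub>"
        using cl[of "\<ominus>\<^bsub>M\<^esub> x"] x by auto
      fix B assume B: "B \<in> carrier (quotient_module M N)"
      obtain y where y: "y \<in> carrier M" "B = N +>\<^bsub>M\<^esub> y" using B cos by auto
      show "A \<oplus>\<^bsub>quotient_module M N\<^esub> B \<in> carrier (quotient_module M N)"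
        using x y N.a_rcos_sum[of x y] cl by simp
      show "A \<oplus>\<^bsub>quotient_module M N\<^esub> B = B \<oplus>\<^bsub>quotient_module M N\<^esub> A"
        using x y N.a_rcos_sum[of x y] N.a_rcos_sum[of y x] M.a_comm[of x y] by simp
      fix C assume C: "C \<in> carrier (quotient_module M N)"
      obtain z where z: "z \<in> carrier M" "C = N +>\<^bsub>M\<^esub> z" using C cos by auto
      show "A \<oplus>\<^bsub>quotient_module M N\<^esub> B \<oplus>\<^bsub>quotient_module M N\<^esub> C =
        A \<oplus>\<^bsub>quotient_module M N\<^esub> (B \<oplus>\<^bsub>quotient_module M N\<^esub> C)"
        using x y z by (simp add: N.a_rcos_sum M.a_assoc)
    qed (use cl[of "\<zero>\<^bsub>M\<^esub>"] N.a_subgroup_in_rcosets in simp)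
  next
    fix r A assume r: "r \<in> carrier R" and "A \<in> carrier (quotient_module M N)"
    then obtain x where x: "x \<in> carrier M" "A = N +>\<^bsub>M\<^esub> x" using cos[of A] by auto
    show "r \<odot>\<^bsub>quotient_module M N\<^esub> A \<in> carrier (quotient_module M N)"
      using sm[OF r x(1)] x cl r by simp
    fix B assume "B \<in> carrier (quotient_module M N)"
    then obtain y where y: "y \<in> carrier M" "B = N +>\<^bsub>M\<^esub> y" using cos by auto
    have "r \<odot>\<^bsub>quotient_module M N\<^esub> (N +>\<^bsub>M\<^esub> (x \<oplus>\<^bsub>M\<^esub> y)) = N +>\<^bsub>M\<^esub> (r \<odot>\<^bsub>M\<^esub> x) <+>\<^bsub>M\<^esub> (N +>\<^bsub>M\<^esub> (r \<odot>\<^bsub>M\<^esub> y))"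
      using r x y by (subst sm) (auto simp: M.smult_r_distr N.a_rcos_sum)
    then show "r \<odot>\<^bsub>quotient_module M N\<^esub> (A \<oplus>\<^bsub>quotient_module M N\<^esub> B) =
      r \<odot>\<^bsub>quotient_module M N\<^esub> A \<oplus>\<^bsub>quotient_module M N\<^esub> r \<odot>\<^bsub>quotient_module M N\<^esub> B"
      unfolding x y sm[OF r x(1)] sm[OF r y(1)] by (simp add: N.a_rcos_sum x y)
  next
    fix r s A assume r: "r \<in> carrier R" "s \<in> carrier R" and "A \<in> carrier (quotient_module M N)"
    then obtain x where x: "x \<in> carrier M" "A = N +>\<^bsub>M\<^esub> x" using cos[of A] by auto
    show "(r \<oplus>\<^bsub>R\<^esub> s) \<odot>\<^bsub>quotient_module M N\<^esub> A =
      r \<odot>\<^bsub>quotient_module M N\<^esub> A \<oplus>\<^bsub>quotient_module M N\<^esub> s \<odot>\<^bsub>quotient_module M N\<^esub> A"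
      unfolding x sm[OF r(1) x(1)] sm[OF r(2) x(1)] sm[OF M.R.a_closed[OF r] x(1)]
      using r x by (simp add: N.a_rcos_sum M.smult_l_distr)
    show "r \<otimes>\<^bsub>R\<^esub> s \<odot>\<^bsub>quotient_module M N\<^esub> A = r \<odot>\<^bsub>quotient_module M N\<^esub> (s \<odot>\<^bsub>quotient_module M N\<^esub> A)"
      unfolding x sm[OF r(2) x(1)] sm[OF M.R.m_closed[OF r] x(1)]
        sm[OF r(1) M.smult_closed[OF r(2) x(1)]] using r x by (simp add: M.smult_assoc1)
  next
    fix A assume "A \<in> carrier (quotient_module M N)"
    then obtain x where x: "x \<in> carrier M" "A = N +>\<^bsub>M\<^esub> x" using cos[of A] by auto
    show "\<one>\<^bsub>R\<^esub> \<odot>\<^bsub>quotient_module M N\<^esub> A = A"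
      unfolding x sm[OF M.R.one_closed x(1)] using x by simp
  qed
qed

lemma sum_module_simps:
  "\<zero>\<^bsub>sum_module I M\<^esub> = (\<lambda>i\<in>I. \<zero>\<^bsub>M i\<^esub>)" "carrier (sum_module I M) = (\<Pi>\<^sub>E i\<in>I. carrier (M i))"
  "x \<oplus>\<^bsub>sum_module I M\<^esub> y = (\<lambda>i\<in>I. x i \<oplus>\<^bsub>M i\<^esub> y i)"
  "r \<odot>\<^bsub>sum_module I M\<^esub> x = (\<lambda>i\<in>I. r \<odot>\<^bsub>M i\<^esub> x i)"
  by (simp_all add: sum_module_def)

lemma module_sum_module:
  assumes "cring R" "\<And>i. i \<in> I \<Longrightarrow> module R (M i)" shows "module R (sum_module I M)"
proof (rule moduleI[OF assms(1)])
  note ag = module.axioms(2)[OF assms(2)]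
  interpret R: cring R by fact
  show "abelian_group (sum_module I M)"
  proof (rule abelian_groupI)
    fix x assume x: "x \<in> carrier (sum_module I M)"
    have "(\<lambda>i\<in>I. \<ominus>\<^bsub>M i\<^esub> x i) \<in> carrier (sum_module I M)"
      using x by (auto simp: sum_module_simps PiE_iff abelian_group.a_inv_closed[OF ag])
    moreover have "(\<lambda>i\<in>I. \<ominus>\<^bsub>M i\<^esub> x i) \<oplus>\<^bsub>sum_module I M\<^esub> x = \<zero>\<^bsub>sum_module I M\<^esub>"
      using x by (auto simp: sum_module_simps PiE_iff abelian_group.l_neg[OF ag])
    ultimately show "\<exists>y\<in>carrier (sum_module I M). y \<oplus>\<^bsub>sum_module I M\<^esub> x = \<zero>\<^bsub>sum_module I M\<^esub>"
      by blast
  qed (auto simp: sum_module_simps PiE_iff fun_eq_iff extensional_def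
      abelian_monoid.zero_closed[OF abelian_group.axioms(1)[OF ag]]
      abelian_monoid.l_zero[OF abelian_group.axioms(1)[OF ag]]
      abelian_monoid.a_closed[OF abelian_group.axioms(1)[OF ag]]
      abelian_monoid.a_assoc[OF abelian_group.axioms(1)[OF ag]]
      abelian_monoid.r_zero[OF abelian_group.axioms(1)[OF ag]]
      abelian_monoid.a_lcomm[OF abelian_group.axioms(1)[OF ag]]
      abelian_monoid.a_comm[OF abelian_group.axioms(1)[OF ag]])
qed (auto simp: sum_module_simps PiE_iff fun_eq_iff extensional_def module.smult_closed[OF assms(2)]
    module.smult_l_distr[OF assms(2)] module.smult_r_distr[OF assms(2)] module.smult_assoc1[OF assms(2)]
    module.smult_one[OF assms(2)])

lemma linear_map_component:
  assumes "i \<in> I" shows "linear_map R (sum_module I M) (M i) (\<lambda>x. x i)"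
  using assms by (intro linear_mapI) (auto simp: sum_module_simps)

section \<open>Multilinear maps\<close>

lemma tuples_iff:
  "xs \<in> tuples Ms \<longleftrightarrow> length xs = length Ms \<and> (\<forall>i<length Ms. xs ! i \<in> carrier (Ms ! i))"
  by (auto simp: tuples_def list_all2_conv_all_nth)

lemma tuples_update:
  "xs \<in> tuples Ms \<Longrightarrow> y \<in> carrier (Ms ! i) \<Longrightarrow> xs[i := y] \<in> tuples Ms"
  by (cases "i < length xs") (auto simp: tuples_iff nth_list_update)

text \<open>The definition of \<open>multilinear\<close> compares a tuple with updates of its own
  entries. Putting an arbitrary entry into the slot turns this into linearity in that slot, the form
  used from here on; \<open>multilinear_linear\<close> is the converse.\<close>

lemma multilinearI:
  assumes "\<And>xs. xs \<in> tuples Ms \<Longrightarrow> f xs \<in> carrier N"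
    and "\<And>xs i. xs \<in> tuples Ms \<Longrightarrow> i < length Ms \<Longrightarrow> linear_map R (Ms ! i) N (\<lambda>y. f (xs[i := y]))"
  shows "multilinear R Ms N f"
  unfolding multilinear_def
proof (intro conjI ballI allI impI)
  fix xs i assume xs: "xs \<in> tuples Ms" "i < length Ms"
  have x: "xs ! i \<in> carrier (Ms ! i)" using xs by (simp add: tuples_iff)
  note l = linear_mapD[OF assms(2)[OF xs]]
  show "f (xs[i := xs ! i \<oplus>\<^bsub>Ms ! i\<^esub> y]) = f xs \<oplus>\<^bsub>N\<^esub> f (xs[i := y])" if "y \<in> carrier (Ms ! i)" for y
    using l(2)[OF x that] by simp
  show "f (xs[i := r \<odot>\<^bsub>Ms ! i\<^esub> xs ! i]) = r \<odot>\<^bsub>N\<^esub> f xs" if "r \<in> carrier R" for r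
    using l(3)[OF that x] by simp
qed (rule assms(1))

lemma multilinear_closed: "multilinear R Ms N f \<Longrightarrow> xs \<in> tuples Ms \<Longrightarrow> f xs \<in> carrier N"
  by (auto simp: multilinear_def)

lemma multilinear_linear:
  assumes "multilinear R Ms N f" "xs \<in> tuples Ms" "i < length Ms"
  shows "linear_map R (Ms ! i) N (\<lambda>y. f (xs[i := y]))"
proof (rule linear_mapI)
  have len: "length xs = length Ms" using assms(2) by (simp add: tuples_iff)
  have upd: "xs[i := x] \<in> tuples Ms" "xs[i := x] ! i = x" if "x \<in> carrier (Ms ! i)" for x
    using tuples_update[OF assms(2) that] len assms(3) by auto
  show "f (xs[i := x]) \<in> carrier N" if "x \<in> carrier (Ms ! i)" for x
    by (rule multilinear_closed[OF assms(1) upd(1)[OF that]])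
  show "f (xs[i := x \<oplus>\<^bsub>Ms ! i\<^esub> y]) = f (xs[i := x]) \<oplus>\<^bsub>N\<^esub> f (xs[i := y])"
    if "x \<in> carrier (Ms ! i)" "y \<in> carrier (Ms ! i)" for x y
    using assms(1,3) upd[OF that(1)] that(2) unfolding multilinear_def by fastforce
  show "f (xs[i := r \<odot>\<^bsub>Ms ! i\<^esub> x]) = r \<odot>\<^bsub>N\<^esub> f (xs[i := x])"
    if "r \<in> carrier R" "x \<in> carrier (Ms ! i)" for r x
    using assms(1,3) upd[OF that(2)] that(1) unfolding multilinear_def by fastforce
qed

lemma multilinear_cong:
  assumes "\<And>xs. xs \<in> tuples Ms \<Longrightarrow> f xs = g xs" "\<And>M. M \<in> set Ms \<Longrightarrow> module R M" "multilinear R Ms N g"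
  shows "multilinear R Ms N f"
proof (rule multilinearI)
  fix xs i assume xs: "xs \<in> tuples Ms" "i < length Ms"
  show "linear_map R (Ms ! i) N (\<lambda>y. f (xs[i := y]))"
    by (subst linear_map_cong[OF _ assms(2)[OF nth_mem[OF xs(2)]]])
      (use multilinear_linear[OF assms(3) xs] assms(1)[OF tuples_update[OF xs(1)]] in auto)
qed (use assms multilinear_closed in fastforce)

lemma multilinear_comp_linear:
  assumes "multilinear R Ms N f" "linear_map R N Q g"
  shows "multilinear R Ms Q (\<lambda>xs. g (f xs))"
  by (rule multilinearI)
    (auto intro: linear_mapD(1)[OF assms(2)] multilinear_closed[OF assms(1)]
      linear_map_comp[OF multilinear_linear[OF assms(1)] assms(2)])

lemma multilinear_sum:
  assumes "module R N" "\<And>M. M \<in> set Ms \<Longrightarrow> module R M" "\<And>a. a \<in> A \<Longrightarrow> multilinear R Ms N (f a)"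
  shows "multilinear R Ms N (\<lambda>xs. \<Oplus>\<^bsub>N\<^esub>a\<in>A. f a xs)"
proof (rule multilinearI)
  interpret N: module R N by fact
  show "(\<Oplus>\<^bsub>N\<^esub>a\<in>A. f a xs) \<in> carrier N" if "xs \<in> tuples Ms" for xs
    using multilinear_closed[OF assms(3)] that by (intro N.finsum_closed) auto
  show "linear_map R (Ms ! i) N (\<lambda>y. \<Oplus>\<^bsub>N\<^esub>a\<in>A. f a (xs[i := y]))"
    if xs: "xs \<in> tuples Ms" "i < length Ms" for xs i
  proof (rule linear_map_sum[OF assms(2)[OF nth_mem[OF xs(2)]] assms(1)])
    show "linear_map R (Ms ! i) N (\<lambda>y. f a (xs[i := y]))" if "a \<in> A" for a
      by (rule multilinear_linear[OF assms(3)[OF that] xs])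
  qed
qed

lemma multilinear_map:
  assumes "multilinear R Ms' N f" "length Ms' = length Ms"
    and g: "\<And>i. i < length Ms \<Longrightarrow> linear_map R (Ms ! i) (Ms' ! i) (g i)"
  shows "multilinear R Ms N (\<lambda>xs. f (map (\<lambda>i. g i (xs ! i)) [0..<length Ms]))"
proof (rule multilinearI)
  have tup: "map (\<lambda>i. g i (xs ! i)) [0..<length Ms] \<in> tuples Ms'" if "xs \<in> tuples Ms" for xs
    using that linear_mapD(1)[OF g] assms(2) by (auto simp: tuples_iff)
  show "f (map (\<lambda>i. g i (xs ! i)) [0..<length Ms]) \<in> carrier N" if "xs \<in> tuples Ms" for xs
    by (rule multilinear_closed[OF assms(1) tup[OF that]])
  fix xs i assume xs: "xs \<in> tuples Ms" "i < length Ms"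
  have "map (\<lambda>j. g j (xs[i := y] ! j)) [0..<length Ms] = (map (\<lambda>i. g i (xs ! i)) [0..<length Ms])[i := g i y]" for y
    using xs by (intro nth_equalityI) (auto simp: tuples_iff nth_list_update)
  then show "linear_map R (Ms ! i) N (\<lambda>y. f (map (\<lambda>j. g j (xs[i := y] ! j)) [0..<length Ms]))"
    using linear_map_comp[OF g[OF xs(2)] multilinear_linear[OF assms(1) tup[OF xs(1)]]] xs(2) assms(2) by simp
qed

lemma multilinear_append:
  assumes "multilinear R (As @ Ms @ Bs) N f" "as \<in> tuples As" "bs \<in> tuples Bs"
  shows "multilinear R Ms N (\<lambda>xs. f (as @ xs @ bs))"
proof (rule multilinearI)
  have tup: "as @ xs @ bs \<in> tuples (As @ Ms @ Bs)" if "xs \<in> tuples Ms" for xs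
    using assms(2,3) that unfolding tuples_def by (auto intro!: list_all2_appendI)
  show "f (as @ xs @ bs) \<in> carrier N" if "xs \<in> tuples Ms" for xs
    by (rule multilinear_closed[OF assms(1) tup[OF that]])
  fix xs i assume xs: "xs \<in> tuples Ms" "i < length Ms"
  have len: "length xs = length Ms" "length as = length As" using xs assms(2) by (auto simp: tuples_iff)
  have "as @ xs[i := y] @ bs = (as @ xs @ bs)[length As + i := y]" for y
    using len xs(2) by (auto simp: list_update_append)
  moreover have "(As @ Ms @ Bs) ! (length As + i) = Ms ! i"
    using xs(2) by (simp add: nth_append)
  ultimately show "linear_map R (Ms ! i) N (\<lambda>y. f (as @ xs[i := y] @ bs))"
    using multilinear_linear[OF assms(1) tup[OF xs(1)], of "length As + i"] xs(2) by simp
qed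

text \<open>Passes from special entries \<open>B\<close> to general entries \<open>C\<close> one
  coordinate at a time: the induction on \<open>k\<close> treats tuples whose first \<open>k\<close>
  entries are general and whose other entries are special. It is kept free of modules because it
  serves twice, for tuples of module elements and for tuples whose entries are themselves
  lists.\<close>

lemma coordinate_induct:
  assumes "length xs = n" "\<And>i. i < n \<Longrightarrow> xs ! i \<in> C i" "\<And>i. i < n \<Longrightarrow> B i \<subseteq> C i"
    and base: "\<And>xs. length xs = n \<Longrightarrow> (\<And>i. i < n \<Longrightarrow> xs ! i \<in> B i) \<Longrightarrow> Q xs"
    and step: "\<And>xs i. length xs = n \<Longrightarrow> (\<And>j. j < n \<Longrightarrow> xs ! j \<in> C j) \<Longrightarrow> i < n \<Longrightarrow>
      (\<And>y. y \<in> B i \<Longrightarrow> Q (xs[i := y])) \<Longrightarrow> Q xs"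
  shows "Q xs"
proof -
  have "Q ys" if "k \<le> n" "length ys = n" "\<And>i. i < k \<Longrightarrow> ys ! i \<in> C i" "\<And>i. k \<le> i \<Longrightarrow> i < n \<Longrightarrow> ys ! i \<in> B i"
    for k ys
    using that
  proof (induction k arbitrary: ys)
    case 0
    then show ?case by (intro base) auto
  next
    case (Suc k)
    show ?case
    proof (rule step[OF Suc.prems(2)])
      show "ys ! j \<in> C j" if "j < n" for j
        using Suc.prems(3)[of j] Suc.prems(4)[of j] assms(3)[of j] that by fastforce
      show "k < n" using Suc.prems(1) by simp
      fix y assume y: "y \<in> B k"
      show "Q (ys[k := y])"
      proof (rule Suc.IH)
        fix i assume i: "k \<le> i" "i < n"
        show "ys[k := y] ! i \<in> B i"
          using i y Suc.prems(2,4) by (cases "i = k") auto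
      qed (use Suc.prems in auto)
    qed
  qed
  from this[of n xs] show ?thesis using assms(1,2) by simp
qed

lemma multilinear_span_subset:
  assumes "module R N" "\<And>M. M \<in> set Ms \<Longrightarrow> module R M" "multilinear R Ms N f" "submodule K R N"
    and S: "\<And>i. i < length Ms \<Longrightarrow> S i \<subseteq> carrier (Ms ! i)"
    and base: "\<And>xs. length xs = length Ms \<Longrightarrow> (\<And>i. i < length Ms \<Longrightarrow> xs ! i \<in> S i) \<Longrightarrow> f xs \<in> K"
    and xs: "length xs = length Ms" "\<And>i. i < length Ms \<Longrightarrow> xs ! i \<in> module_span R (Ms ! i) (S i)"
  shows "f xs \<in> K"
proof (rule coordinate_induct[where Q = "\<lambda>xs. f xs \<in> K" and B = S, OF xs span_superset base])
  fix xs i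
  assume xs: "length xs = length Ms" "\<And>j. j < length Ms \<Longrightarrow> xs ! j \<in> module_span R (Ms ! j) (S j)"
    and i: "i < length Ms" and K: "\<And>y. y \<in> S i \<Longrightarrow> f (xs[i := y]) \<in> K"
  have m: "module R (Ms ! j)" if "j < length Ms" for j using that by (simp add: assms(2))
  have tup: "xs \<in> tuples Ms"
    using xs submoduleD(1)[OF m submodule_span[OF m S]] by (auto simp: tuples_iff)
  have "f (xs[i := xs ! i]) \<in> K"
    by (rule linear_span_subset[OF m[OF i] assms(1) multilinear_linear[OF assms(3) tup i] assms(4) S[OF i] K xs(2)[OF i]])
  then show "f xs \<in> K" by simp
qed

text \<open>With the other coordinates held fixed, \<open>linear_eq_on_span\<close> passes from
  generators to their span in one coordinate.\<close>

lemma multilinear_eq_on_span: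
  assumes "module R N" "\<And>M. M \<in> set Ms \<Longrightarrow> module R M" "multilinear R Ms N f" "multilinear R Ms N g"
    and S: "\<And>i. i < length Ms \<Longrightarrow> S i \<subseteq> carrier (Ms ! i)"
    and base: "\<And>xs. length xs = length Ms \<Longrightarrow> (\<And>i. i < length Ms \<Longrightarrow> xs ! i \<in> S i) \<Longrightarrow> f xs = g xs"
    and xs: "length xs = length Ms" "\<And>i. i < length Ms \<Longrightarrow> xs ! i \<in> module_span R (Ms ! i) (S i)"
  shows "f xs = g xs"
proof (rule coordinate_induct[where Q = "\<lambda>xs. f xs = g xs" and B = S, OF xs span_superset base])
  fix xs i
  assume xs: "length xs = length Ms" "\<And>j. j < length Ms \<Longrightarrow> xs ! j \<in> module_span R (Ms ! j) (S j)"
    and i: "i < length Ms" and K: "\<And>y. y \<in> S i \<Longrightarrow> f (xs[i := y]) = g (xs[i := y])"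
  have m: "module R (Ms ! j)" if "j < length Ms" for j using that by (simp add: assms(2))
  have tup: "xs \<in> tuples Ms"
    using xs submoduleD(1)[OF m submodule_span[OF m S]] by (auto simp: tuples_iff)
  have "f (xs[i := xs ! i]) = g (xs[i := xs ! i])"
    by (rule linear_eq_on_span[OF m[OF i] assms(1) multilinear_linear[OF assms(3) tup i]
          multilinear_linear[OF assms(4) tup i] S[OF i] K xs(2)[OF i]])
  then show "f xs = g xs" by simp
qed

section \<open>Tensor products\<close>

lemma tensor_relations_closed:
  assumes "cring R" "\<And>M. M \<in> set Ms \<Longrightarrow> module R M"
  shows "tensor_relations R Ms \<subseteq> carrier (free_module R (tuples Ms))"
proof -
  let ?F = "free_module R (tuples Ms)"
  interpret F: module R ?F by (rule module_free_module[OF assms(1)])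
  have m: "module R (Ms ! i)" if "i < length Ms" for i using that by (simp add: assms(2))
  have b: "basis_elt R xs \<in> carrier ?F" if "xs \<in> tuples Ms" for xs using that assms(1) by simp
  have upd: "xs[i := xs ! i \<oplus>\<^bsub>Ms ! i\<^esub> y] \<in> tuples Ms" "xs[i := y] \<in> tuples Ms"
    if "xs \<in> tuples Ms" "i < length Ms" "y \<in> carrier (Ms ! i)" for xs i y
  proof -
    interpret Mi: module R "Ms ! i" by (rule m[OF that(2)])
    show "xs[i := xs ! i \<oplus>\<^bsub>Ms ! i\<^esub> y] \<in> tuples Ms" "xs[i := y] \<in> tuples Ms"
      using that(1,2) by (auto intro!: tuples_update[OF that(1)] Mi.a_closed that(3)) (simp add: tuples_iff)
  qed
  have upd2: "xs[i := r \<odot>\<^bsub>Ms ! i\<^esub> xs ! i] \<in> tuples Ms"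
    if "xs \<in> tuples Ms" "i < length Ms" "r \<in> carrier R" for xs i r
  proof -
    interpret Mi: module R "Ms ! i" by (rule m[OF that(2)])
    show ?thesis by (rule tuples_update[OF that(1)]) (use that in \<open>auto simp: tuples_iff\<close>)
  qed
  show ?thesis
    unfolding tensor_relations_def Let_def
    by (auto simp del: free_module_simps intro!: F.minus_closed F.smult_closed F.a_closed b intro: upd upd2)
qed

text \<open>The sum inside \<open>tensor_lift\<close> before a representative is chosen, that is,
  the linear extension of \<open>f\<close> from the basis to the free module.\<close>

definition free_lift where
  "free_lift R N f g = (\<Oplus>\<^bsub>N\<^esub>s\<in>{s. g s \<noteq> \<zero>\<^bsub>R\<^esub>}. g s \<odot>\<^bsub>N\<^esub> f s)"

text \<open>Two functions have different supports; a common larger index set is what allows their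
  lifts to be added.\<close>

lemma free_lift_superset:
  assumes "module R N" "f \<in> S \<rightarrow> carrier N" "g \<in> carrier (free_module R S)"
    and "finite A" "{s. g s \<noteq> \<zero>\<^bsub>R\<^esub>} \<subseteq> A" "A \<subseteq> S"
  shows "free_lift R N f g = (\<Oplus>\<^bsub>N\<^esub>s\<in>A. g s \<odot>\<^bsub>N\<^esub> f s)"
proof -
  interpret N: module R N by fact
  note app = free_module_app[OF N.cring_axioms assms(3)]
  show ?thesis unfolding free_lift_def
  proof (rule N.M.add.finprod_mono_neutral_cong_left[OF assms(4,5)])
    show "g i \<odot>\<^bsub>N\<^esub> f i = \<zero>\<^bsub>N\<^esub>" if "i \<in> A - {s. g s \<noteq> \<zero>\<^bsub>R\<^esub>}" for i
      using assms(2,6) that by (auto simp: Pi_def subset_iff)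
    show "(\<lambda>s. g s \<odot>\<^bsub>N\<^esub> f s) \<in> A \<rightarrow> carrier N"
      using assms(2,6) app by (auto simp: Pi_def subset_iff)
  qed auto
qed

lemma linear_free_lift:
  assumes "module R N" "f \<in> S \<rightarrow> carrier N"
  shows "linear_map R (free_module R S) N (free_lift R N f)"
proof -
  interpret N: module R N by fact
  interpret F: module R "free_module R S" by (rule module_free_module[OF N.cring_axioms])
  note app = free_module_app[OF N.cring_axioms]
  note fin = free_module_carrier[of _ R S]
  show ?thesis
  proof (rule linear_mapI)
    fix g assume g: "g \<in> carrier (free_module R S)"
    have fS: "f s \<in> carrier N" if "g s \<noteq> \<zero>\<^bsub>R\<^esub>" for s using g assms(2) that by (auto simp: fin)
    show "free_lift R N f g \<in> carrier N"
      unfolding free_lift_def using app[OF g] fS by (intro N.finsum_closed) auto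
    fix h assume h: "h \<in> carrier (free_module R S)"
    let ?A = "{s. g s \<noteq> \<zero>\<^bsub>R\<^esub>} \<union> {s. h s \<noteq> \<zero>\<^bsub>R\<^esub>}"
    have A: "finite ?A" "?A \<subseteq> S" using g h by (auto simp: fin)
    have gh: "g \<oplus>\<^bsub>free_module R S\<^esub> h \<in> carrier (free_module R S)" using g h by (rule F.a_closed)
    have fA: "f \<in> ?A \<rightarrow> carrier N" using A(2) assms(2) by auto
    have "free_lift R N f (g \<oplus>\<^bsub>free_module R S\<^esub> h) = (\<Oplus>\<^bsub>N\<^esub>s\<in>?A. (g s \<oplus>\<^bsub>R\<^esub> h s) \<odot>\<^bsub>N\<^esub> f s)"
      by (subst free_lift_superset[OF assms gh A(1) _ A(2)]) auto
    also have "\<dots> = (\<Oplus>\<^bsub>N\<^esub>s\<in>?A. g s \<odot>\<^bsub>N\<^esub> f s \<oplus>\<^bsub>N\<^esub> h s \<odot>\<^bsub>N\<^esub> f s)"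
      using fA app[OF g] app[OF h] by (intro N.finsum_cong') (auto simp: Pi_def intro!: N.smult_l_distr)
    also have "\<dots> = (\<Oplus>\<^bsub>N\<^esub>s\<in>?A. g s \<odot>\<^bsub>N\<^esub> f s) \<oplus>\<^bsub>N\<^esub> (\<Oplus>\<^bsub>N\<^esub>s\<in>?A. h s \<odot>\<^bsub>N\<^esub> f s)"
      using fA app[OF g] app[OF h] by (intro N.finsum_addf) (auto simp: Pi_def)
    also have "(\<Oplus>\<^bsub>N\<^esub>s\<in>?A. g s \<odot>\<^bsub>N\<^esub> f s) = free_lift R N f g"
      by (subst free_lift_superset[OF assms g A(1) _ A(2)]) auto
    also have "(\<Oplus>\<^bsub>N\<^esub>s\<in>?A. h s \<odot>\<^bsub>N\<^esub> f s) = free_lift R N f h"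
      by (subst free_lift_superset[OF assms h A(1) _ A(2)]) auto
    finally show "free_lift R N f (g \<oplus>\<^bsub>free_module R S\<^esub> h) = free_lift R N f g \<oplus>\<^bsub>N\<^esub> free_lift R N f h" .
  next
    fix r g assume r: "r \<in> carrier R" and g: "g \<in> carrier (free_module R S)"
    let ?A = "{s. g s \<noteq> \<zero>\<^bsub>R\<^esub>}"
    have A: "finite ?A" "?A \<subseteq> S" using g by (auto simp: fin)
    have fA: "f \<in> ?A \<rightarrow> carrier N" using A(2) assms(2) by auto
    have rg: "r \<odot>\<^bsub>free_module R S\<^esub> g \<in> carrier (free_module R S)" using r g by (rule F.smult_closed)
    have "free_lift R N f (r \<odot>\<^bsub>free_module R S\<^esub> g) = (\<Oplus>\<^bsub>N\<^esub>s\<in>?A. (r \<otimes>\<^bsub>R\<^esub> g s) \<odot>\<^bsub>N\<^esub> f s)"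
      using r by (subst free_lift_superset[OF assms rg A(1) _ A(2)]) auto
    also have "\<dots> = (\<Oplus>\<^bsub>N\<^esub>s\<in>?A. r \<odot>\<^bsub>N\<^esub> (g s \<odot>\<^bsub>N\<^esub> f s))"
      using fA app[OF g] r by (intro N.finsum_cong') (auto simp: Pi_def intro!: N.smult_assoc1)
    also have "\<dots> = r \<odot>\<^bsub>N\<^esub> free_lift R N f g"
      unfolding free_lift_def using fA app[OF g] r A by (intro N.finsum_smult_ldistr[symmetric]) (auto simp: Pi_def)
    finally show "free_lift R N f (r \<odot>\<^bsub>free_module R S\<^esub> g) = r \<odot>\<^bsub>N\<^esub> free_lift R N f g" .
  qed
qed

lemma free_lift_basis:
  assumes "module R N" "f \<in> S \<rightarrow> carrier N" "s \<in> S"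
  shows "free_lift R N f (basis_elt R s) = f s"
proof -
  interpret N: module R N by fact
  have "free_lift R N f (basis_elt R s) = (\<Oplus>\<^bsub>N\<^esub>s'\<in>{s}. basis_elt R s s' \<odot>\<^bsub>N\<^esub> f s')"
    by (rule free_lift_superset[OF assms(1,2)]) (use assms(3) basis_elt_closed[OF N.cring_axioms, of s S] in \<open>auto simp: basis_elt_def\<close>)
  then show ?thesis using assms(2,3) by (auto simp: basis_elt_def Pi_def)
qed

section \<open>Universal property of the tensor product\<close>

context
  fixes R :: "('r, 'x) ring_scheme" and Ms :: "('r, 'a) module list"
  assumes R: "cring R" and Ms: "\<And>M. M \<in> set Ms \<Longrightarrow> module R M"
begin

private abbreviation (input) "F \<equiv> free_module R (tuples Ms)"
private abbreviation (input) "K \<equiv> module_span R F (tensor_relations R Ms)"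

private lemma F: "module R F" by (rule module_free_module[OF R])

private lemma K: "submodule K R F"
  by (rule submodule_span[OF F tensor_relations_closed[OF R Ms]])

lemma module_tensor: "module R (tensor R Ms)"
  unfolding tensor_def by (rule module_quotient_module[OF F K])

private lemma coset_linear: "linear_map R F (tensor R Ms) (\<lambda>g. K +>\<^bsub>F\<^esub> g)"
proof -
  interpret F: module R F by (rule F)
  interpret K: abelian_subgroup K F by (rule abelian_subgroup_submodule[OF F K])
  show ?thesis
    unfolding tensor_def
    by (rule linear_mapI)
      (auto simp: A_RCOSETS_def' K.a_rcos_sum quotient_smult_coset[OF F K] simp del: free_module_simps quotient_module_simps(4))
qed

private lemma tensor_cosetE:
  assumes "X \<in> carrier (tensor R Ms)" obtains g where "g \<in> carrier F" "X = K +>\<^bsub>F\<^esub> g"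
  using assms unfolding tensor_def by (auto simp: A_RCOSETS_def')

lemma pure_closed: "xs \<in> tuples Ms \<Longrightarrow> pure R Ms xs \<in> carrier (tensor R Ms)"
  unfolding pure_def by (rule linear_mapD(1)[OF coset_linear]) (simp add: R)

text \<open>Pure tensors are the images of the basis elements under the linear and surjective coset
  map.\<close>

lemma tensor_span: "module_span R (tensor R Ms) (pure R Ms ` tuples Ms) = carrier (tensor R Ms)"
proof
  have sub: "pure R Ms ` tuples Ms \<subseteq> carrier (tensor R Ms)" using pure_closed by auto
  note sm = submodule_span[OF module_tensor sub]
  show "module_span R (tensor R Ms) (pure R Ms ` tuples Ms) \<subseteq> carrier (tensor R Ms)"
    using submoduleD(1)[OF module_tensor sm] by auto
  show "carrier (tensor R Ms) \<subseteq> module_span R (tensor R Ms) (pure R Ms ` tuples Ms)"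
  proof
    fix X assume "X \<in> carrier (tensor R Ms)"
    then obtain g where g: "g \<in> carrier F" "X = K +>\<^bsub>F\<^esub> g" by (rule tensor_cosetE)
    show "X \<in> module_span R (tensor R Ms) (pure R Ms ` tuples Ms)"
      unfolding g(2)
    proof (rule linear_span_subset[OF F module_tensor coset_linear sm, of "basis_elt R ` tuples Ms"])
      show "g \<in> module_span R F (basis_elt R ` tuples Ms)" using g(1) span_basis[OF R] by blast
      show "K +>\<^bsub>F\<^esub> x \<in> module_span R (tensor R Ms) (pure R Ms ` tuples Ms)" if "x \<in> basis_elt R ` tuples Ms" for x
        using that span_superset[of "pure R Ms ` tuples Ms" R "tensor R Ms"] by (auto simp: pure_def)
    qed (auto simp: R)
  qed
qed

private lemma coset_eqI:
  assumes "x \<in> carrier F" "y \<in> carrier F" "x \<ominus>\<^bsub>F\<^esub> y \<in> K"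
  shows "K +>\<^bsub>F\<^esub> x = K +>\<^bsub>F\<^esub> y"
proof -
  interpret F: module R F by (rule F)
  interpret K: abelian_subgroup K F by (rule abelian_subgroup_submodule[OF F K])
  have "x = (x \<ominus>\<^bsub>F\<^esub> y) \<oplus>\<^bsub>F\<^esub> y"
    using assms(1,2) by (simp add: a_minus_def F.M.a_assoc F.M.l_neg del: free_module_simps)
  then have "x \<in> K +>\<^bsub>F\<^esub> y" using assms(3) by (auto simp: a_r_coset_def' simp del: free_module_simps)
  then show ?thesis using F.a_repr_independence[OF _ assms(2) K.a_subgroup] by simp
qed

lemma pure_multilinear: "multilinear R Ms (tensor R Ms) (pure R Ms)"
  unfolding multilinear_def
proof (intro conjI ballI allI impI)
  interpret F: module R F by (rule F)
  fix xs i assume xs: "xs \<in> tuples Ms" and i: "i < length Ms"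
  interpret Mi: module R "Ms ! i" using i Ms by simp
  have xi: "xs ! i \<in> carrier (Ms ! i)" using xs i by (simp add: tuples_iff)
  have b: "basis_elt R ys \<in> carrier F" if "ys \<in> tuples Ms" for ys using that R by simp
  {
    fix y assume y: "y \<in> carrier (Ms ! i)"
    have "basis_elt R (xs[i := xs ! i \<oplus>\<^bsub>Ms ! i\<^esub> y]) \<ominus>\<^bsub>F\<^esub> (basis_elt R xs \<oplus>\<^bsub>F\<^esub> basis_elt R (xs[i := y])) \<in> tensor_relations R Ms"
      unfolding tensor_relations_def Let_def using xs i y by blast
    then have rel: "basis_elt R (xs[i := xs ! i \<oplus>\<^bsub>Ms ! i\<^esub> y]) \<ominus>\<^bsub>F\<^esub> (basis_elt R xs \<oplus>\<^bsub>F\<^esub> basis_elt R (xs[i := y])) \<in> K"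
      using span_superset[of "tensor_relations R Ms" R F] by blast
    have tup: "xs[i := xs ! i \<oplus>\<^bsub>Ms ! i\<^esub> y] \<in> tuples Ms" "xs[i := y] \<in> tuples Ms"
      using xi y by (auto intro!: tuples_update[OF xs])
    show "pure R Ms (xs[i := xs ! i \<oplus>\<^bsub>Ms ! i\<^esub> y]) = pure R Ms xs \<oplus>\<^bsub>tensor R Ms\<^esub> pure R Ms (xs[i := y])"
      using coset_eqI[OF b[OF tup(1)] F.a_closed[OF b[OF xs] b[OF tup(2)]] rel]
        linear_mapD(2)[OF coset_linear b[OF xs] b[OF tup(2)]] unfolding pure_def by simp
  }
  fix r assume r: "r \<in> carrier R"
  have "basis_elt R (xs[i := r \<odot>\<^bsub>Ms ! i\<^esub> xs ! i]) \<ominus>\<^bsub>F\<^esub> (r \<odot>\<^bsub>F\<^esub> basis_elt R xs) \<in> tensor_relations R Ms"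
    unfolding tensor_relations_def Let_def using xs i r by blast
  then have rel: "basis_elt R (xs[i := r \<odot>\<^bsub>Ms ! i\<^esub> xs ! i]) \<ominus>\<^bsub>F\<^esub> (r \<odot>\<^bsub>F\<^esub> basis_elt R xs) \<in> K"
    using span_superset[of "tensor_relations R Ms" R F] by blast
  have tup: "xs[i := r \<odot>\<^bsub>Ms ! i\<^esub> xs ! i] \<in> tuples Ms"
    using xi r by (auto intro!: tuples_update[OF xs])
  show "pure R Ms (xs[i := r \<odot>\<^bsub>Ms ! i\<^esub> xs ! i]) = r \<odot>\<^bsub>tensor R Ms\<^esub> pure R Ms xs"
    using coset_eqI[OF b[OF tup] F.smult_closed[OF r b[OF xs]] rel]
      linear_mapD(3)[OF coset_linear r b[OF xs]] unfolding pure_def by simp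
qed (rule pure_closed)

context
  fixes N :: "('r, 'b) module" and f :: "'a list \<Rightarrow> 'b"
  assumes N: "module R N" and f: "multilinear R Ms N f"
begin

private lemma f_Pi: "f \<in> tuples Ms \<rightarrow> carrier N" using multilinear_closed[OF f] by auto

private lemmas lin = linear_free_lift[OF N f_Pi]

text \<open>Multilinearity of \<open>f\<close> says that its linear extension kills each defining
  relation, hence also their span.\<close>

private lemma free_lift_K: "g \<in> K \<Longrightarrow> free_lift R N f g = \<zero>\<^bsub>N\<^esub>"
proof -
  interpret F: module R F by (rule F)
  interpret N: module R N by (rule N)
  have b: "basis_elt R ys \<in> carrier F" if "ys \<in> tuples Ms" for ys using that R by simp
  have fb: "free_lift R N f (basis_elt R xs) = f xs" if "xs \<in> tuples Ms" for xs
    by (rule free_lift_basis[OF N f_Pi that])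
  have diff: "free_lift R N f (x \<ominus>\<^bsub>F\<^esub> y) = \<zero>\<^bsub>N\<^esub>"
    if "free_lift R N f x = free_lift R N f y" "x \<in> carrier F" "y \<in> carrier F" for x y
    unfolding a_minus_def linear_mapD(2)[OF lin that(2) F.a_inv_closed[OF that(3)]] linear_map_minus[OF F N lin that(3)] that(1)
    by (rule N.r_neg[OF linear_mapD(1)[OF lin that(3)]])
  have rel: "free_lift R N f g \<in> {\<zero>\<^bsub>N\<^esub>}" if "g \<in> tensor_relations R Ms" for g
    using that unfolding tensor_relations_def Let_def
  proof (elim UnE CollectE exE conjE)
    fix xs i y
    assume g: "g = basis_elt R (xs[i := xs ! i \<oplus>\<^bsub>Ms ! i\<^esub> y]) \<ominus>\<^bsub>F\<^esub> (basis_elt R xs \<oplus>\<^bsub>F\<^esub> basis_elt R (xs[i := y]))"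
      and xs: "xs \<in> tuples Ms" "i < length Ms" "y \<in> carrier (Ms ! i)"
    interpret Mi: module R "Ms ! i" using xs Ms by simp
    have tup: "xs[i := xs ! i \<oplus>\<^bsub>Ms ! i\<^esub> y] \<in> tuples Ms" "xs[i := y] \<in> tuples Ms"
      using xs(1,2) by (auto intro!: tuples_update[OF xs(1)] Mi.a_closed xs(3)) (simp add: tuples_iff)
    show "free_lift R N f g \<in> {\<zero>\<^bsub>N\<^esub>}"
      unfolding g
      using diff[OF _ b[OF tup(1)] F.a_closed[OF b[OF xs(1)] b[OF tup(2)]]]
        linear_mapD(2)[OF lin b[OF xs(1)] b[OF tup(2)]] fb[OF tup(1)] fb[OF tup(2)] fb[OF xs(1)] f xs
      by (simp add: multilinear_def)
  next
    fix xs i r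
    assume g: "g = basis_elt R (xs[i := r \<odot>\<^bsub>Ms ! i\<^esub> xs ! i]) \<ominus>\<^bsub>F\<^esub> (r \<odot>\<^bsub>F\<^esub> basis_elt R xs)"
      and xs: "xs \<in> tuples Ms" "i < length Ms" "r \<in> carrier R"
    interpret Mi: module R "Ms ! i" using xs Ms by simp
    have tup: "xs[i := r \<odot>\<^bsub>Ms ! i\<^esub> xs ! i] \<in> tuples Ms"
      by (rule tuples_update[OF xs(1)]) (use xs in \<open>auto simp: tuples_iff\<close>)
    show "free_lift R N f g \<in> {\<zero>\<^bsub>N\<^esub>}"
      unfolding g
      using diff[OF _ b[OF tup] F.smult_closed[OF xs(3) b[OF xs(1)]]]
        linear_mapD(3)[OF lin xs(3) b[OF xs(1)]] fb[OF tup] fb[OF xs(1)] f xs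
      by (simp add: multilinear_def)
  qed
  show "g \<in> K \<Longrightarrow> free_lift R N f g = \<zero>\<^bsub>N\<^esub>"
    using linear_span_subset[OF F N lin submodule_zero[OF N] tensor_relations_closed[OF R Ms] rel] by blast
qed

text \<open>The representative picked by \<open>SOME\<close> differs from \<open>g\<close> by an
  element of \<open>K\<close>, on which the lift vanishes. This removes the choice from all later
  arguments.\<close>

private lemma tensor_lift_coset: "g \<in> carrier F \<Longrightarrow> tensor_lift R N f (K +>\<^bsub>F\<^esub> g) = free_lift R N f g"
proof -
  interpret F: module R F by (rule F)
  interpret N: module R N by (rule N)
  interpret K: abelian_subgroup K F by (rule abelian_subgroup_submodule[OF F K])
  assume g: "g \<in> carrier F"
  let ?h = "SOME h. h \<in> K +>\<^bsub>F\<^esub> g"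
  have "?h \<in> K +>\<^bsub>F\<^esub> g" by (rule someI[of "\<lambda>h. h \<in> K +>\<^bsub>F\<^esub> g", OF K.a_rcos_self[OF g]])
  then obtain k where k: "k \<in> K" "?h = k \<oplus>\<^bsub>F\<^esub> g" by (auto simp: a_r_coset_def')
  have kF: "k \<in> carrier F" using k(1) K.a_subset by auto
  have "free_lift R N f ?h = free_lift R N f k \<oplus>\<^bsub>N\<^esub> free_lift R N f g"
    unfolding k(2) by (rule linear_mapD(2)[OF lin kF g])
  then have "free_lift R N f ?h = free_lift R N f g"
    using free_lift_K[OF k(1)] linear_mapD(1)[OF lin g] by simp
  then show "tensor_lift R N f (K +>\<^bsub>F\<^esub> g) = free_lift R N f g"
    by (simp add: tensor_lift_def free_lift_def Let_def)
qed

lemma tensor_lift_pure: "xs \<in> tuples Ms \<Longrightarrow> tensor_lift R N f (pure R Ms xs) = f xs"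
  unfolding pure_def using tensor_lift_coset[of "basis_elt R xs"] R free_lift_basis[OF N f_Pi] by simp

lemma tensor_lift_linear: "linear_map R (tensor R Ms) N (tensor_lift R N f)"
proof (rule linear_mapI)
  interpret F: module R F by (rule F)
  fix X assume "X \<in> carrier (tensor R Ms)"
  then obtain g where g: "g \<in> carrier F" "X = K +>\<^bsub>F\<^esub> g" by (rule tensor_cosetE)
  show "tensor_lift R N f X \<in> carrier N"
    using tensor_lift_coset[OF g(1)] linear_mapD(1)[OF lin g(1)] g by simp
  fix Y assume "Y \<in> carrier (tensor R Ms)"
  then obtain h where h: "h \<in> carrier F" "Y = K +>\<^bsub>F\<^esub> h" by (rule tensor_cosetE)
  show "tensor_lift R N f (X \<oplus>\<^bsub>tensor R Ms\<^esub> Y) = tensor_lift R N f X \<oplus>\<^bsub>N\<^esub> tensor_lift R N f Y"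
    unfolding g(2) h(2) linear_mapD(2)[OF coset_linear g(1) h(1), symmetric]
      tensor_lift_coset[OF g(1)] tensor_lift_coset[OF h(1)] tensor_lift_coset[OF F.a_closed[OF g(1) h(1)]]
    by (rule linear_mapD(2)[OF lin g(1) h(1)])
next
  interpret F: module R F by (rule F)
  fix r X assume r: "r \<in> carrier R" and "X \<in> carrier (tensor R Ms)"
  then obtain g where g: "g \<in> carrier F" "X = K +>\<^bsub>F\<^esub> g" by (metis tensor_cosetE)
  show "tensor_lift R N f (r \<odot>\<^bsub>tensor R Ms\<^esub> X) = r \<odot>\<^bsub>N\<^esub> tensor_lift R N f X"
    unfolding g(2) linear_mapD(3)[OF coset_linear r g(1), symmetric]
      tensor_lift_coset[OF g(1)] tensor_lift_coset[OF F.smult_closed[OF r g(1)]]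
    by (rule linear_mapD(3)[OF lin r g(1)])
qed

end

lemma linear_eq_on_tensor:
  assumes "module R N" "linear_map R (tensor R Ms) N f" "linear_map R (tensor R Ms) N g"
    "\<And>xs. xs \<in> tuples Ms \<Longrightarrow> f (pure R Ms xs) = g (pure R Ms xs)" "X \<in> carrier (tensor R Ms)"
  shows "f X = g X"
  by (rule linear_eq_on_span[OF module_tensor assms(1-3), of "pure R Ms ` tuples Ms"])
    (use assms(4,5) pure_closed in \<open>auto simp: tensor_span\<close>)

end

section \<open>Surjections\<close>

text \<open>The target of a surjection is determined by its word, as the number of distinct
  letters.\<close>

lemma Surs_iff: "t \<in> Surs n \<longleftrightarrow> length t = n \<and> set t = {..<vertices t}"
  unfolding Surs_def Sur_def vertices_def by (metis (mono_tags, lifting) UNIV_I UN_iff card_lessThan mem_Collect_eq)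

lemma Sur_iff: "t \<in> Sur n k \<longleftrightarrow> t \<in> Surs n \<and> vertices t = k"
  unfolding Surs_iff Sur_def vertices_def by (metis (mono_tags, lifting) card_lessThan mem_Collect_eq)

lemma finite_Surs [simp]: "finite (Surs n)"
proof (rule finite_subset)
  show "Surs n \<subseteq> {t. set t \<subseteq> {..<n} \<and> length t = n}"
  proof
    fix t assume t: "t \<in> Surs n"
    then have "vertices t \<le> n" using card_length[of t] by (simp add: Surs_iff vertices_def)
    then show "t \<in> {t. set t \<subseteq> {..<n} \<and> length t = n}" using t by (auto simp: Surs_iff)
  qed
qed (rule finite_lists_length_eq; simp)

lemma Surs_0: "Surs 0 = {[]}"
  unfolding set_eq_iff Surs_iff by (auto simp: vertices_def)

lemma count_list_pos: "t \<in> Surs n \<Longrightarrow> j < vertices t \<Longrightarrow> 0 < count_list t j"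
  unfolding Surs_iff by (metis count_list_0_iff gr0I lessThan_iff)

lemma Surs_nth: "t \<in> Surs n \<Longrightarrow> a < n \<Longrightarrow> t ! a < vertices t"
  by (metis Surs_iff lessThan_iff nth_mem)

lemma sum_count_list: "t \<in> Surs n \<Longrightarrow> (\<Sum>j<vertices t. count_list t j) = n"
  by (simp add: Surs_iff sum_count_set)

text \<open>Recognises surjections by multiplicities, which are easy to follow through substitution,
  merging and splitting.\<close>

lemma Surs_countI:
  assumes "length t = n" "\<And>x. 0 < count_list t x \<longleftrightarrow> x < k"
  shows "t \<in> Surs n" "vertices t = k"
proof -
  have "set t = {..<k}" using assms(2) by (metis count_list_0_iff gr0I lessThan_iff less_irrefl subsetI subset_antisym)
  then show "vertices t = k" "t \<in> Surs n" using assms(1) by (auto simp: Surs_iff vertices_def)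
qed

text \<open>The prefix count is the rank of \<open>a\<close> in its block, numbered from
  \<open>0\<close>. The bound makes it a valid index into the surjection substituted for that
  block.\<close>

lemma count_take_less:
  assumes "a < length t" shows "count_list (take a t) (t ! a) < count_list t (t ! a)"
proof -
  have "t = take a t @ t ! a # drop (Suc a) t" using assms by (rule id_take_nth_drop)
  then have "count_list t (t ! a) = count_list (take a t @ t ! a # drop (Suc a) t) (t ! a)" by simp
  then show ?thesis by simp
qed

section \<open>Offsets\<close>

text \<open>Substitution gives the vertex \<open>w\<close> of the \<open>j\<close>-th surjection the
  number \<open>sum v {..<j} + w\<close>. For \<open>j < j'\<close> the interval of \<open>j\<close>
  ends before that of \<open>j'\<close> begins, so the numbering is injective;
  \<open>offset_cover\<close> shows that it exhausts an initial segment.\<close>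

lemma offset_inject:
  fixes v :: "nat \<Rightarrow> nat"
  assumes "w < v j" "w' < v j'" "sum v {..<j} + w = sum v {..<j'} + w'"
  shows "j = j' \<and> w = w'"
proof -
  have *: "\<not> j < j'" if "w < v j" "sum v {..<j} + w = sum v {..<j'} + w'" for j j' w w'
  proof
    assume "j < j'"
    then have "sum v {..<Suc j} \<le> sum v {..<j'}" by (intro sum_mono2) auto
    then show False using that by simp
  qed
  have "j = j'" using *[OF assms(1,3)] *[OF assms(2) assms(3)[symmetric]] by simp
  then show ?thesis using assms(3) by simp
qed

lemma offset_cover:
  fixes v :: "nat \<Rightarrow> nat"
  shows "m < sum v {..<k} \<longleftrightarrow> (\<exists>j<k. \<exists>w<v j. m = sum v {..<j} + w)"
proof (induction k)
  case (Suc k)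
  show ?case
  proof
    assume m: "m < sum v {..<Suc k}"
    show "\<exists>j<Suc k. \<exists>w<v j. m = sum v {..<j} + w"
    proof (cases "m < sum v {..<k}")
      case True then show ?thesis using Suc by (metis less_SucI)
    next
      case False
      then have "m - sum v {..<k} < v k" "m = sum v {..<k} + (m - sum v {..<k})" using m by auto
      then show ?thesis by blast
    qed
  next
    assume "\<exists>j<Suc k. \<exists>w<v j. m = sum v {..<j} + w"
    then obtain j w where j: "j < Suc k" "w < v j" "m = sum v {..<j} + w" by blast
    have "sum v {..<Suc j} \<le> sum v {..<Suc k}" using j(1) by (intro sum_mono2) auto
    then show "m < sum v {..<Suc k}" using j by simp
  qed
qed auto

lemma map_upt_concat:
  fixes v :: "nat \<Rightarrow> nat"
  shows "map f [0..<sum v {..<k}] = concat (map (\<lambda>j. map (\<lambda>w. f (sum v {..<j} + w)) [0..<v j]) [0..<k])"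
proof (induction k)
  case (Suc k)
  have "map (\<lambda>w. c + w) [0..<b] = [c..<c + b]" for b c :: nat
    by (induction b) auto
  then have "[0..<sum v {..<k} + v k] = [0..<sum v {..<k}] @ map (\<lambda>w. sum v {..<k} + w) [0..<v k]"
    using upt_add_eq_append[of 0 "sum v {..<k}" "v k"] by simp
  then show ?case using Suc by simp
qed simp

lemma sum_lessThan_concat:
  fixes v :: "nat \<Rightarrow> nat" and f :: "nat \<Rightarrow> 'a :: comm_monoid_add"
  shows "sum f {..<sum v {..<k}} = (\<Sum>j<k. \<Sum>w<v j. f (sum v {..<j} + w))"
proof (induction k)
  case (Suc k)
  have "sum f {..<a + b} = sum f {..<a} + (\<Sum>w<b. f (a + w))" for a b :: nat
    by (induction b) (auto simp: add.assoc)
  then show ?case using Suc by simp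
qed simp

lemma concat_nth_offset:
  "j < length xss \<Longrightarrow> w < length (xss ! j) \<Longrightarrow>
    concat xss ! ((\<Sum>i<j. length (xss ! i)) + w) = xss ! j ! w"
proof (induction xss arbitrary: j)
  case (Cons xs xss)
  show ?case
  proof (cases j)
    case (Suc j')
    have "(\<Sum>i<j. length ((xs # xss) ! i)) = length xs + (\<Sum>i<j'. length (xss ! i))"
      unfolding Suc sum.lessThan_Suc_shift by simp
    then show ?thesis using Cons Suc by (simp add: nth_append add.assoc)
  qed (use Cons.prems in \<open>simp add: nth_append\<close>)
qed simp

lemma concat_update_offset:
  "j < length xss \<Longrightarrow> w < length (xss ! j) \<Longrightarrow>
    (concat xss)[(\<Sum>i<j. length (xss ! i)) + w := y] = concat (xss[j := (xss ! j)[w := y]])"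
proof (induction xss arbitrary: j)
  case (Cons xs xss)
  show ?case
  proof (cases j)
    case (Suc j')
    have "(\<Sum>i<j. length ((xs # xss) ! i)) = length xs + (\<Sum>i<j'. length (xss ! i))"
      unfolding Suc sum.lessThan_Suc_shift by simp
    then show ?thesis using Cons Suc by (simp add: list_update_append add.assoc)
  qed (use Cons.prems in \<open>simp add: list_update_append\<close>)
qed simp

lemma length_concat_sum: "length (concat xss) = (\<Sum>i<length xss. length (xss ! i))"
  by (induction xss) (simp_all add: sum.lessThan_Suc_shift del: sum.lessThan_Suc)

section \<open>Substitution\<close>

lemma substitutableD:
  assumes "substitutable t ts"
  shows "length ts = vertices t" "j < vertices t \<Longrightarrow> ts ! j \<in> Surs (count_list t j)"
  using assms by (auto simp: substitutable_def)

lemma length_sur_subst [simp]: "length (sur_subst t ts) = length t"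
  by (simp add: sur_subst_def)

lemma sur_subst_nth:
  "a < length t \<Longrightarrow> sur_subst t ts ! a =
    (\<Sum>i<t ! a. vertices (ts ! i)) + ts ! (t ! a) ! count_list (take a t) (t ! a)"
  by (simp add: sur_subst_def)

context
  fixes t n ts
  assumes t: "t \<in> Surs n" and ts: "substitutable t ts"
begin

private abbreviation (input) "off j \<equiv> (\<Sum>i<j. vertices (ts ! i))"

private lemma len: "length t = n" using t by (simp add: Surs_iff)

lemma sur_subst_entry: "a < n \<Longrightarrow> ts ! (t ! a) ! count_list (take a t) (t ! a) < vertices (ts ! (t ! a))"
  using Surs_nth[OF substitutableD(2)[OF ts Surs_nth[OF t]]] count_take_less[of a t] len by blast

text \<open>Reading the composite from left to right reads each \<open>ts ! j\<close> from left to
  right, at the positions of block \<open>j\<close>. Prefixes and not only total counts are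
  followed, because the position inside a further substituted surjection is itself a prefix
  count.\<close>

lemma count_take_sur_subst:
  assumes "j < vertices t" "w < vertices (ts ! j)" "a \<le> n"
  shows "count_list (take a (sur_subst t ts)) (off j + w) =
    count_list (take (count_list (take a t) j) (ts ! j)) w"
  using assms(3)
proof (induction a)
  case (Suc a)
  let ?u = "sur_subst t ts" and ?b = "count_list (take a t) (t ! a)"
  have a: "a < n" using Suc.prems by simp
  have tk: "take (Suc a) ?u = take a ?u @ [?u ! a]" "take (Suc a) t = take a t @ [t ! a]"
    using a len by (auto simp: take_Suc_conv_app_nth)
  have ua: "?u ! a = off (t ! a) + ts ! (t ! a) ! ?b" using a len by (simp add: sur_subst_nth)
  show ?case
  proof (cases "t ! a = j")
    case True
    have "?b < count_list t j" using count_take_less[of a t] a len True by simp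
    then have "?b < length (ts ! j)" using substitutableD(2)[OF ts assms(1)] by (simp add: Surs_iff)
    then have "take (Suc ?b) (ts ! j) = take ?b (ts ! j) @ [ts ! j ! ?b]" by (simp add: take_Suc_conv_app_nth)
    then show ?thesis using Suc.IH a ua True tk by simp
  next
    case False
    \<comment> \<open>A letter coming from another block lies in another interval of vertex
      numbers.\<close>
    then have "?u ! a \<noteq> off j + w"
      using offset_inject[of w "\<lambda>i. vertices (ts ! i)" j] assms(2) sur_subst_entry[OF a] ua by metis
    then show ?thesis using Suc.IH a False tk by simp
  qed
qed simp

lemma count_sur_subst:
  assumes "j < vertices t" "w < vertices (ts ! j)"
  shows "count_list (sur_subst t ts) (off j + w) = count_list (ts ! j) w"
  using count_take_sur_subst[OF assms, of n] len substitutableD(2)[OF ts assms(1)]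
  by (simp add: Surs_iff)

lemma sur_subst_Surs: "sur_subst t ts \<in> Surs n"
  and vertices_sur_subst: "vertices (sur_subst t ts) = (\<Sum>j<vertices t. vertices (ts ! j))"
proof -
  have "0 < count_list (sur_subst t ts) x \<longleftrightarrow> x < (\<Sum>j<vertices t. vertices (ts ! j))" for x
  proof
    assume "0 < count_list (sur_subst t ts) x"
    then have "x \<in> set (sur_subst t ts)" by (metis count_notin less_irrefl)
    then obtain a where a: "a < n" "x = sur_subst t ts ! a" using len by (metis in_set_conv_nth length_sur_subst)
    then show "x < (\<Sum>j<vertices t. vertices (ts ! j))"
      using sur_subst_nth[of a t ts] sur_subst_entry[OF a(1)] Surs_nth[OF t a(1)] len
      unfolding offset_cover by metis
  next
    assume "x < (\<Sum>j<vertices t. vertices (ts ! j))"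
    then obtain j w where j: "j < vertices t" "w < vertices (ts ! j)" "x = off j + w" unfolding offset_cover by blast
    then show "0 < count_list (sur_subst t ts) x"
      using count_sur_subst[OF j(1,2)] count_list_pos[OF substitutableD(2)[OF ts j(1)] j(2)] by simp
  qed
  from Surs_countI[OF _ this, of n] len
  show "sur_subst t ts \<in> Surs n" "vertices (sur_subst t ts) = (\<Sum>j<vertices t. vertices (ts ! j))" by auto
qed

text \<open>The function \<open>f\<close> is left open because the lemma is used both for arities
  and for the list of corollas.\<close>

lemma map_vertices_sur_subst:
  "map (\<lambda>j. f (count_list (sur_subst t ts) j)) [0..<vertices (sur_subst t ts)] =
    concat (map (\<lambda>s. map (\<lambda>j. f (count_list s j)) [0..<vertices s]) ts)"
proof -
  have *: "map (\<lambda>w. f (count_list (sur_subst t ts) (off j + w))) [0..<vertices (ts ! j)] =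
      map (\<lambda>w. f (count_list (ts ! j) w)) [0..<vertices (ts ! j)]" if "j < vertices t" for j
    using count_sur_subst[OF that] by auto
  have "map (\<lambda>j. f (count_list (sur_subst t ts) j)) [0..<vertices (sur_subst t ts)] =
    concat (map (\<lambda>j. map (\<lambda>w. f (count_list (ts ! j) w)) [0..<vertices (ts ! j)]) [0..<vertices t])"
    unfolding vertices_sur_subst map_upt_concat using * by (intro arg_cong[where f = concat]) auto
  also have "\<dots> = concat (map (\<lambda>s. map (\<lambda>j. f (count_list s j)) [0..<vertices s]) (map (\<lambda>j. ts ! j) [0..<length ts]))"
    using substitutableD(1)[OF ts] by (simp add: comp_def)
  finally show ?thesis by (simp only: map_nth)
qed

lemma arity_list_sur_subst: "arity_list (sur_subst t ts) = concat (map arity_list ts)"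
  unfolding arity_list_def[abs_def] by (rule map_vertices_sur_subst)

end

text \<open>Both bracketings number the innermost vertices lexicographically by \<open>j\<close>, by
  the vertex \<open>w\<close> of \<open>ts ! j\<close> and by the vertex of
  \<open>rss ! j ! w\<close>. At a position \<open>a\<close> they therefore add the same three
  terms: the vertices from earlier \<open>j\<close>, those from earlier \<open>w\<close> at the same
  \<open>j\<close>, and a letter of \<open>rss ! j ! w\<close>, whose index agrees by
  \<open>count_take_sur_subst\<close>.\<close>

lemma sur_subst_assoc:
  assumes t: "t \<in> Surs n" and ts: "substitutable t ts"
    and rss: "length rss = vertices t" "\<And>j. j < vertices t \<Longrightarrow> substitutable (ts ! j) (rss ! j)"
  shows substitutable_concat: "substitutable (sur_subst t ts) (concat rss)"
    and substitutable_map2: "substitutable t (map2 sur_subst ts rss)"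
    and "sur_subst (sur_subst t ts) (concat rss) = sur_subst t (map2 sur_subst ts rss)"
proof -
  define off where "off j = (\<Sum>i<j. vertices (ts ! i))" for j
  let ?u = "sur_subst t ts" and ?m = "map2 sur_subst ts rss"
  have len: "length t = n" "length ts = vertices t" using t ts by (auto simp: Surs_iff substitutable_def)
  have tsj: "ts ! j \<in> Surs (count_list t j)" if "j < vertices t" for j by (rule substitutableD(2)[OF ts that])
  have len_rss: "length (rss ! j) = vertices (ts ! j)" if "j < vertices t" for j
    using substitutableD(1)[OF rss(2)[OF that]] .
  have concat_rss: "concat rss ! (off j + w) = rss ! j ! w" if "j < vertices t" "w < vertices (ts ! j)" for j w
  proof -
    have "off j = (\<Sum>i<j. length (rss ! i))" unfolding off_def using that(1) len_rss by (intro sum.cong) auto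
    then show ?thesis using concat_nth_offset[of j rss w] that rss(1) len_rss by simp
  qed
  have m: "?m ! j = sur_subst (ts ! j) (rss ! j)" if "j < vertices t" for j
    using that len rss(1) by simp
  show "substitutable ?u (concat rss)"
    unfolding substitutable_def
  proof (intro conjI allI impI)
    show "length (concat rss) = vertices ?u"
      unfolding length_concat_sum vertices_sur_subst[OF t ts] rss(1) by (intro sum.cong) (auto simp: len_rss)
    fix m assume "m < vertices ?u"
    then obtain j w where j: "j < vertices t" "w < vertices (ts ! j)" "m = off j + w"
      unfolding vertices_sur_subst[OF t ts] offset_cover off_def by blast
    then show "concat rss ! m \<in> Surs (count_list ?u m)"
      using substitutableD(2)[OF rss(2)[OF j(1)] j(2)] concat_rss[OF j(1,2)]
        count_sur_subst[OF t ts j(1,2)] by (simp add: off_def)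
  qed
  show "substitutable t ?m"
    unfolding substitutable_def
    using len rss(1) m sur_subst_Surs[OF tsj rss(2)] by simp
  show "sur_subst ?u (concat rss) = sur_subst t ?m"
  proof (rule nth_equalityI)
    fix a assume "a < length (sur_subst ?u (concat rss))"
    then have a: "a < n" using len by simp
    define j where "j = t ! a"
    define b where "b = count_list (take a t) j"
    define w where "w = ts ! j ! b"
    have j: "j < vertices t" unfolding j_def by (rule Surs_nth[OF t a])
    have w: "w < vertices (ts ! j)"
      using sur_subst_entry[OF t ts a] by (simp add: j_def b_def w_def)
    have b: "b < length (ts ! j)"
      using count_take_less[of a t] a len tsj[OF j] by (simp add: b_def j_def Surs_iff)
    have ua: "?u ! a = off j + w" using a len by (simp add: sur_subst_nth j_def b_def w_def off_def)
    have "sur_subst ?u (concat rss) ! a =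
      (\<Sum>i<off j + w. vertices (concat rss ! i)) + rss ! j ! w ! count_list (take b (ts ! j)) w"
      using a len concat_rss[OF j w] count_take_sur_subst[OF t ts j w, of a]
      by (simp add: sur_subst_nth ua b_def off_def)
    also have "(\<Sum>i<off j + w. vertices (concat rss ! i)) =
      (\<Sum>i<off j. vertices (concat rss ! i)) + (\<Sum>l<w. vertices (concat rss ! (off j + l)))"
      by (induction w) auto
    also have "(\<Sum>i<off j. vertices (concat rss ! i)) = (\<Sum>i<j. \<Sum>l<vertices (ts ! i). vertices (concat rss ! (off i + l)))"
      unfolding off_def by (rule sum_lessThan_concat)
    also have "\<dots> = (\<Sum>i<j. vertices (?m ! i))"
    proof (rule sum.cong[OF refl])
      fix i assume "i \<in> {..<j}"
      then have i: "i < vertices t" using j by simp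
      show "(\<Sum>l<vertices (ts ! i). vertices (concat rss ! (off i + l))) = vertices (?m ! i)"
        unfolding m[OF i] vertices_sur_subst[OF tsj[OF i] rss(2)[OF i]]
        using concat_rss[OF i] by simp
    qed
    also have "(\<Sum>l<w. vertices (concat rss ! (off j + l))) = (\<Sum>l<w. vertices (rss ! j ! l))"
      using concat_rss[OF j] w by simp
    also have "(\<Sum>i<j. vertices (?m ! i)) + (\<Sum>l<w. vertices (rss ! j ! l)) +
      rss ! j ! w ! count_list (take b (ts ! j)) w = sur_subst t ?m ! a"
      using a len b m[OF j] by (simp add: sur_subst_nth j_def[symmetric] b_def[symmetric] w_def)
    finally show "sur_subst ?u (concat rss) ! a = sur_subst t ?m ! a" .
  qed simp
qed

text \<open>The units of substitution, one for each vertex. Replacing a single one of them changes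
  \<open>t\<close> at that vertex only.\<close>

definition corollas :: "nat list \<Rightarrow> nat list list" where
  "corollas t = map (\<lambda>j. corolla (count_list t j)) [0..<vertices t]"

lemma corolla_Surs: "0 < n \<Longrightarrow> corolla n \<in> Surs n" and vertices_corolla: "0 < n \<Longrightarrow> vertices (corolla n) = 1"
proof -
  assume n: "0 < n"
  have "count_list (corolla n) x = (if x = 0 then n else 0)" for x
    unfolding corolla_def by (induction n) auto
  then have "0 < count_list (corolla n) x \<longleftrightarrow> x < 1" for x using n by auto
  from Surs_countI[OF _ this, of n] show "corolla n \<in> Surs n" "vertices (corolla n) = 1"
    by (auto simp: corolla_def)
qed

lemma length_corollas [simp]: "length (corollas t) = vertices t"
  by (simp add: corollas_def)

lemma corollas_nth: "j < vertices t \<Longrightarrow> corollas t ! j = corolla (count_list t j)"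
  by (simp add: corollas_def)

lemma substitutable_corollas: "t \<in> Surs n \<Longrightarrow> substitutable t (corollas t)"
  by (auto simp: substitutable_def corollas_nth intro!: corolla_Surs count_list_pos)

lemma substitutable_update:
  "substitutable t ts \<Longrightarrow> s \<in> Surs (count_list t j) \<Longrightarrow> substitutable t (ts[j := s])"
  by (cases "j < length ts") (auto simp: substitutable_def nth_list_update)

lemma sur_subst_corollas:
  assumes "t \<in> Surs n" shows "sur_subst t (corollas t) = t"
proof (rule nth_equalityI)
  fix a assume "a < length (sur_subst t (corollas t))"
  then have a: "a < n" "a < length t" using assms by (auto simp: Surs_iff)
  have ta: "t ! a < vertices t" by (rule Surs_nth[OF assms a(1)])
  have "(\<Sum>i<t ! a. vertices (corollas t ! i)) = (\<Sum>i<t ! a. 1)"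
    using ta by (intro sum.cong refl) (simp add: corollas_nth vertices_corolla count_list_pos[OF assms])
  then show "sur_subst t (corollas t) ! a = t ! a"
    using ta count_take_less[OF a(2)] by (simp add: sur_subst_nth[OF a(2)] corollas_nth corolla_def)
qed simp

lemma count_corolla: "count_list (corolla n) 0 = n"
  unfolding corolla_def by (induction n) auto

lemma take_corolla: "a \<le> n \<Longrightarrow> take a (corolla n) = corolla a"
  by (simp add: corolla_def min_def)

lemma sur_subst_corolla:
  assumes "length s = n" shows "sur_subst (corolla n) [s] = s"
proof (rule nth_equalityI)
  fix a assume "a < length (sur_subst (corolla n) [s])"
  then have a: "a < n" by (simp add: corolla_def)
  then have "corolla n ! a = 0" by (simp add: corolla_def)
  then show "sur_subst (corolla n) [s] ! a = s ! a"
    using a take_corolla[of a n] by (simp add: sur_subst_nth corolla_def[of n] count_corolla[unfolded corolla_def] corolla_def)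
qed (use assms in \<open>simp add: corolla_def\<close>)

text \<open>With this, a facet of a composite is a double substitution, to which associativity
  applies.\<close>

lemma concat_corollas:
  assumes "t \<in> Surs n" "substitutable t ts"
  shows "concat (map corollas ts) = corollas (sur_subst t ts)"
  unfolding corollas_def[abs_def] by (rule map_vertices_sur_subst[OF assms, symmetric])

section \<open>Inversions and the sign of a facet\<close>

fun inversions :: "nat list \<Rightarrow> nat" where
  "inversions [] = 0"
| "inversions (x # xs) = length (filter (\<lambda>y. y < x) xs) + inversions xs"

lemma inversions_snoc: "inversions (xs @ [x]) = inversions xs + length (filter (\<lambda>y. x < y) xs)"
  by (induction xs) auto

text \<open>For \<open>c \<le> m\<close>, precomposing with this cycle of length
  \<open>m - c + 1\<close> moves the entry at position \<open>m\<close> to position \<open>c\<close>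
  and pushes the entries in between one place up.\<close>

definition rotation :: "nat \<Rightarrow> nat \<Rightarrow> nat \<Rightarrow> nat" where
  "rotation c m i = (if i < c \<or> m < i then i else if i = c then m else i - 1)"

text \<open>Lengthening the cycle by one place multiplies it by one adjacent transposition.\<close>

lemma rotation_permutation: "permutation (rotation c (c + k)) \<and> sign (rotation c (c + k)) = (- 1) ^ k"
proof (induction k)
  case 0
  have "rotation c (c + 0) = id" by (auto simp: rotation_def)
  then show ?case by (simp add: permutation_id sign_id)
next
  case (Suc k)
  have *: "rotation c (c + Suc k) = transpose (c + k) (c + Suc k) \<circ> rotation c (c + k)"
    by (auto simp: rotation_def transpose_def fun_eq_iff)
  have p: "permutation (transpose (c + k) (c + Suc k))" "permutation (rotation c (c + k))"
    using Suc by (auto simp: permutation_swap_id)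
  have "sign (rotation c (c + Suc k)) = - ((- 1) ^ k)"
    unfolding * sign_compose[OF p] using Suc by (simp add: sign_swap_id)
  moreover have "permutation (rotation c (c + Suc k))" unfolding * by (rule permutation_compose[OF p])
  ultimately show ?case by simp
qed

text \<open>The list of values of the permutation \<open>\<sigma>\<^sub>t\<close> of a word \<open>t\<close> in \<open>0\<close> and \<open>1\<close>.\<close>

definition block_list :: "nat list \<Rightarrow> nat list" where
  "block_list t = filter (\<lambda>a. t ! a = 0) [0..<length t] @ filter (\<lambda>a. t ! a = 1) [0..<length t]"

lemma filter_nth_snoc:
  "filter (\<lambda>a. (t @ [x]) ! a = v) [0..<length (t @ [x])] =
    filter (\<lambda>a. t ! a = v) [0..<length t] @ (if x = v then [length t] else [])"
  by (auto simp: nth_append intro!: filter_cong)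

lemma length_filter_nth: "length (filter (\<lambda>a. t ! a = v) [0..<length t]) = count_list t v"
proof (induction t rule: rev_induct)
  case (snoc x t)
  show ?case unfolding filter_nth_snoc using snoc by simp
qed simp

lemma length_block_list: "set t \<subseteq> {0, 1} \<Longrightarrow> length (block_list t) = length t"
  unfolding block_list_def length_append length_filter_nth by (induction t) auto

text \<open>Induction on the last letter. A final \<open>1\<close> leaves the permutation unchanged.
  A final \<open>0\<close> puts the new index in front of the indices of all letters
  \<open>1\<close>, by a cycle with one transposition for each of them, and each of these letters
  forms an inversion with the final \<open>0\<close>.\<close>

lemma block_list_sign:
  assumes "set t \<subseteq> {0, 1}"
  defines "\<sigma> \<equiv> \<lambda>t i. if i < length t then block_list t ! i else i"
  shows "permutation (\<sigma> t) \<and> sign (\<sigma> t) = (- 1) ^ inversions t"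
  using assms(1)
proof (induction t rule: rev_induct)
  case Nil
  have "\<sigma> [] = id" by (auto simp: \<sigma>_def)
  then show ?case by (simp add: permutation_id sign_id)
next
  case (snoc x t)
  let ?n = "length t" and ?z = "filter (\<lambda>a. t ! a = 0) [0..<length t]" and ?o = "filter (\<lambda>a. t ! a = 1) [0..<length t]"
  have t: "set t \<subseteq> {0, 1}" using snoc.prems by simp
  note IH = snoc.IH[OF t]
  have x: "x = 0 \<or> x = 1" using snoc.prems by auto
  have ls: "length ?z + length ?o = ?n" using length_block_list[OF t] by (simp add: block_list_def)
  have inv: "inversions (t @ [x]) = inversions t + (if x = 0 then length ?o else 0)"
  proof -
    have "length (filter (\<lambda>y. x < y) t) = (if x = 0 then count_list t 1 else 0)"
      using t x by (induction t) auto
    then show ?thesis by (simp add: inversions_snoc length_filter_nth)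
  qed
  show ?case
  proof (cases "x = 0")
    case True
    have b: "block_list (t @ [x]) = ?z @ [?n] @ ?o"
      unfolding block_list_def filter_nth_snoc using True by simp
    have rot: "rotation (length ?z) ?n = rotation (length ?z) (length ?z + length ?o)" using ls by simp
    have "\<sigma> (t @ [x]) = \<sigma> t \<circ> rotation (length ?z) ?n"
    proof
      fix i
      have b': "block_list t = ?z @ ?o" by (simp add: block_list_def)
      consider "i < length ?z" | "i = length ?z" | "length ?z < i" "i \<le> ?n" | "?n < i" by linarith
      then show "\<sigma> (t @ [x]) i = (\<sigma> t \<circ> rotation (length ?z) ?n) i"
      proof cases
        case 1
        then show ?thesis using ls by (simp add: \<sigma>_def b b' rotation_def nth_append)
      next
        case 2
        then show ?thesis using ls by (simp add: \<sigma>_def b b' rotation_def nth_append)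
      next
        case 3
        then show ?thesis using ls by (auto simp: \<sigma>_def b b' rotation_def nth_append nth_Cons')
      next
        case 4
        then show ?thesis using ls by (simp add: \<sigma>_def rotation_def)
      qed
    qed
    then have \<sigma>: "\<sigma> (t @ [x]) = \<sigma> t \<circ> rotation (length ?z) (length ?z + length ?o)" unfolding rot .
    have p: "permutation (\<sigma> t)" "permutation (rotation (length ?z) (length ?z + length ?o))"
      using IH rotation_permutation by auto
    have "sign (\<sigma> (t @ [x])) = (- 1) ^ inversions (t @ [x])"
      unfolding \<sigma> sign_compose[OF p] inv using IH rotation_permutation True by (simp add: power_add)
    moreover have "permutation (\<sigma> (t @ [x]))" unfolding \<sigma> by (rule permutation_compose[OF p])
    ultimately show ?thesis by (intro conjI)
  next
    case False
    have b: "block_list (t @ [x]) = block_list t @ [?n]"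
      unfolding block_list_def filter_nth_snoc using False x by simp
    have "\<sigma> (t @ [x]) = \<sigma> t"
      using length_block_list[OF t] by (auto simp: \<sigma>_def b nth_append fun_eq_iff)
    then show ?thesis using IH inv False by simp
  qed
qed

lemma sur_sign_eq:
  assumes "set t \<subseteq> {0, 1}"
  shows "sur_sign t = (- 1) ^ (inversions t + count_list t 0)"
  unfolding sur_sign_def block_list_def[symmetric] Let_def
  using block_list_sign[OF assms] by (simp add: power_add)

section \<open>Facets of a cell\<close>

definition facet :: "nat list \<Rightarrow> nat \<Rightarrow> nat list \<Rightarrow> nat list" where
  "facet t i s = sur_subst t ((corollas t)[i := s])"

text \<open>The cells having \<open>u\<close> as a facet are the \<open>merge_blocks p u\<close>, which join the blocks \<open>p\<close> and
  \<open>p + 1\<close> of \<open>u\<close>.\<close>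

definition merge_blocks :: "nat \<Rightarrow> nat list \<Rightarrow> nat list" where
  "merge_blocks p u = map (\<lambda>v. if p < v then v - 1 else v) u"

text \<open>What \<open>merge_blocks p\<close> forgets: from the merged word and this one,
  \<open>u\<close> is recovered in \<open>facet_merge\<close>.\<close>

definition split_of :: "nat \<Rightarrow> nat list \<Rightarrow> nat list" where
  "split_of p u = map (\<lambda>v. v - p) (filter (\<lambda>v. v = p \<or> v = Suc p) u)"

text \<open>An inverted pair of letters of \<open>u\<close> is either \<open>Suc p\<close> before
  \<open>p\<close>, and then it is an inversion of the split word, or it remains strictly decreasing
  after the merge.\<close>

lemma inversions_merge: "inversions u = inversions (merge_blocks p u) + inversions (split_of p u)"
proof (induction u)
  case (Cons x xs)
  have 1: "length (filter (\<lambda>y. y < Suc p) xs) = length (filter (\<lambda>y. y < p) xs) + length (filter (\<lambda>y. y = p) xs)"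
    by (induction xs) auto
  have "length (filter (\<lambda>y. y < x) xs) =
    length (filter (\<lambda>y. y < (if p < x then x - 1 else x)) (merge_blocks p xs)) +
    (if x = Suc p then length (filter (\<lambda>y. y = p) xs) else 0)"
  proof (cases "x = Suc p")
    case True
    have "length (filter (\<lambda>y. y < p) (merge_blocks p xs)) = length (filter (\<lambda>y. y < p) xs)"
      by (induction xs) (auto simp: merge_blocks_def)
    then show ?thesis using True 1 by simp
  next
    case False
    then have "length (filter (\<lambda>y. y < x) xs) = length (filter (\<lambda>y. y < (if p < x then x - 1 else x)) (merge_blocks p xs))"
      by (induction xs) (auto simp: merge_blocks_def)
    then show ?thesis using False by simp
  qed
  moreover have "length (filter (\<lambda>y. y < Suc 0) (split_of p xs)) = length (filter (\<lambda>y. y = p) xs)"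
    by (induction xs) (auto simp: split_of_def)
  moreover have "merge_blocks p (x # xs) = (if p < x then x - 1 else x) # merge_blocks p xs" by (simp add: merge_blocks_def)
  moreover have "split_of p (x # xs) = (if x = p then [0] else if x = Suc p then [1] else []) @ split_of p xs"
    by (simp add: split_of_def)
  moreover have "length (filter (\<lambda>y. y < 0) zs) = 0" for zs :: "nat list" by simp
  ultimately show ?case using Cons.IH by auto
qed (simp add: merge_blocks_def split_of_def)

lemma merge_merge:
  assumes "p \<le> q" shows "merge_blocks q (merge_blocks p u) = merge_blocks p (merge_blocks (Suc q) u)"
  using assms by (auto simp: merge_blocks_def)

lemma count_merge_low: "j < p \<Longrightarrow> count_list (merge_blocks p u) j = count_list u j"
  by (induction u) (auto simp: merge_blocks_def)

lemma count_merge: "count_list (merge_blocks p u) p = count_list u p + count_list u (Suc p)"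
  by (induction u) (auto simp: merge_blocks_def)

lemma count_merge_high: "p < j \<Longrightarrow> count_list (merge_blocks p u) j = count_list u (Suc j)"
  by (induction u) (auto simp: merge_blocks_def)

lemma count_split_of: "count_list (split_of p u) 0 = count_list u p"
  "count_list (split_of p u) (Suc 0) = count_list u (Suc p)"
  by (induction u) (auto simp: split_of_def)

lemma length_split_of: "length (split_of p u) = count_list u p + count_list u (Suc p)"
  by (induction u) (auto simp: split_of_def)

lemma set_split_of: "set (split_of p u) \<subseteq> {0, 1}"
  by (auto simp: split_of_def)

lemma merge_Surs:
  assumes "u \<in> Surs n" "Suc p < vertices u"
  shows "merge_blocks p u \<in> Surs n" "vertices (merge_blocks p u) = vertices u - 1"
proof -
  have pos: "0 < count_list u x \<longleftrightarrow> x < vertices u" for x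
    using assms(1) unfolding Surs_iff by (metis count_list_0_iff gr0I lessThan_iff less_irrefl)
  have "0 < count_list (merge_blocks p u) x \<longleftrightarrow> x < vertices u - 1" for x
    using assms(2) pos[of x] pos[of "Suc x"]
    by (cases x p rule: linorder_cases) (auto simp: count_merge_low count_merge count_merge_high)
  from Surs_countI[OF _ this, of n] assms(1)
  show "merge_blocks p u \<in> Surs n" "vertices (merge_blocks p u) = vertices u - 1" by (auto simp: merge_blocks_def Surs_iff)
qed

lemma split_of_Sur:
  assumes "u \<in> Surs n" "Suc p < vertices u"
  shows "split_of p u \<in> Sur (count_list (merge_blocks p u) p) 2"
proof -
  have "0 < count_list (split_of p u) x \<longleftrightarrow> x < 2" for x
  proof -
    consider "x = 0" | "x = Suc 0" | "2 \<le> x" by linarith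
    then show ?thesis
    proof cases
      case 3
      then have "x \<notin> set (split_of p u)" using set_split_of[of p u] by auto
      then show ?thesis using 3 by simp
    qed (use assms count_list_pos[OF assms(1)] in \<open>auto simp: count_split_of\<close>)
  qed
  from Surs_countI[OF _ this] show ?thesis by (simp add: Sur_iff length_split_of count_merge)
qed

context
  fixes t n i s
  assumes t: "t \<in> Surs n" and i: "i < vertices t" and s: "s \<in> Surs (count_list t i)"
begin

lemma substitutable_facet: "substitutable t ((corollas t)[i := s])"
  by (rule substitutable_update[OF substitutable_corollas[OF t] s])

lemma facet_Surs: "facet t i s \<in> Surs n"
  unfolding facet_def by (rule sur_subst_Surs[OF t substitutable_facet])

private lemma facet_vertices: "j < vertices t \<Longrightarrow> vertices ((corollas t)[i := s] ! j) = (if j = i then vertices s else 1)"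
  using t by (auto simp: nth_list_update corollas_nth vertices_corolla count_list_pos)

text \<open>Every corolla has one vertex, and beyond \<open>i\<close> one of them has been exchanged
  for the \<open>vertices s\<close> vertices of \<open>s\<close>.\<close>

private lemma facet_offset:
  "j \<le> vertices t \<Longrightarrow> (\<Sum>l<j. vertices ((corollas t)[i := s] ! l)) = (if j \<le> i then j else j - 1 + vertices s)"
  by (induction j) (auto simp: facet_vertices)

lemma vertices_facet: "vertices (facet t i s) = vertices t - 1 + vertices s"
  unfolding facet_def vertices_sur_subst[OF t substitutable_facet] using facet_offset[of "vertices t"] i by simp

lemma facet_nth:
  assumes "a < n"
  shows "facet t i s ! a = (if t ! a < i then t ! a else
    if t ! a = i then i + s ! count_list (take a t) i else t ! a - 1 + vertices s)"
proof -
  have a: "a < length t" "t ! a < vertices t" using assms t Surs_nth[OF t assms] by (auto simp: Surs_iff)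
  have "(corollas t)[i := s] ! (t ! a) ! count_list (take a t) (t ! a) =
    (if t ! a = i then s ! count_list (take a t) i else 0)"
    using a count_take_less[OF a(1)] by (auto simp: nth_list_update corollas_nth corolla_def)
  then show ?thesis unfolding facet_def sur_subst_nth[OF a(1)] facet_offset[OF less_imp_le[OF a(2)]] by auto
qed

end

text \<open>Together with \<open>split_of_facet\<close> and \<open>facet_merge\<close> this gives a
  bijection between triples \<open>(t, i, s)\<close>, a cell with a chosen facet, and pairs
  \<open>(u, p)\<close>, a cell with a chosen pair of adjacent blocks.\<close>

lemma merge_facet:
  assumes "t \<in> Surs n" "i < vertices t" "s \<in> Sur (count_list t i) 2"
  shows "merge_blocks i (facet t i s) = t"
proof (rule nth_equalityI)
  have s: "s \<in> Surs (count_list t i)" "vertices s = 2" using assms(3) by (auto simp: Sur_iff)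
  show len: "length (merge_blocks i (facet t i s)) = length t" by (simp add: merge_blocks_def facet_def)
  fix a assume "a < length (merge_blocks i (facet t i s))"
  then have a: "a < n" "a < length (facet t i s)" "a < length t" using assms(1) len by (auto simp: Surs_iff merge_blocks_def)
  have "s ! count_list (take a t) i < 2" if "t ! a = i"
    using Surs_nth[OF s(1), of "count_list (take a t) i"] count_take_less[OF a(3)] that s(2) by auto
  then show "merge_blocks i (facet t i s) ! a = t ! a"
    unfolding merge_blocks_def using a(2) facet_nth[OF assms(1,2) s(1) a(1)] s(2) by auto
qed

lemma split_of_facet:
  assumes "t \<in> Surs n" "i < vertices t" "s \<in> Sur (count_list t i) 2"
  shows "split_of i (facet t i s) = s"
proof -
  have s: "s \<in> Surs (count_list t i)" "vertices s = 2" using assms(3) by (auto simp: Sur_iff)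
  have len: "length t = n" "length (facet t i s) = n" "length s = count_list t i"
    using assms(1) s(1) by (auto simp: Surs_iff facet_def)
  have s2: "s ! b < 2" if "b < count_list t i" for b using Surs_nth[OF s(1) that] s(2) by simp
  \<comment> \<open>The prefix of the facet has met as many letters of \<open>s\<close> as the same
    prefix of \<open>t\<close> has elements in block \<open>i\<close>.\<close>
  have "split_of i (take a (facet t i s)) = take (count_list (take a t) i) s" if "a \<le> n" for a
    using that
  proof (induction a)
    case (Suc a)
    have a: "a < n" "a < length t" using Suc.prems len by auto
    have tk: "take (Suc a) (facet t i s) = take a (facet t i s) @ [facet t i s ! a]" "take (Suc a) t = take a t @ [t ! a]"
      using a len by (auto simp: take_Suc_conv_app_nth)
    have sp: "split_of i (xs @ [x]) = split_of i xs @ (if x = i \<or> x = Suc i then [x - i] else [])" for xs x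
      by (simp add: split_of_def)
    show ?case
    proof (cases "t ! a = i")
      case True
      have b: "count_list (take a t) i < count_list t i" using count_take_less[OF a(2)] True by simp
      then have "take (Suc (count_list (take a t) i)) s = take (count_list (take a t) i) s @ [s ! count_list (take a t) i]"
        using len by (simp add: take_Suc_conv_app_nth)
      then show ?thesis unfolding tk sp
        using True Suc s2[OF b] facet_nth[OF assms(1,2) s(1) a(1)] by auto
    next
      case False
      then show ?thesis unfolding tk sp
        using Suc s(2) facet_nth[OF assms(1,2) s(1) a(1)] by auto
    qed
  qed (simp add: split_of_def)
  from this[of n] show ?thesis using len by simp
qed

lemma facet_merge:
  assumes "u \<in> Surs n" "Suc p < vertices u"
  shows "facet (merge_blocks p u) p (split_of p u) = u"
proof (rule nth_equalityI)
  note m = merge_Surs[OF assms] and s = split_of_Sur[OF assms]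
  have p: "p < vertices (merge_blocks p u)" using m(2) assms(2) by simp
  have s': "split_of p u \<in> Surs (count_list (merge_blocks p u) p)" "vertices (split_of p u) = 2" using s by (auto simp: Sur_iff)
  show len: "length (facet (merge_blocks p u) p (split_of p u)) = length u" by (simp add: facet_def merge_blocks_def)
  fix a assume "a < length (facet (merge_blocks p u) p (split_of p u))"
  then have a: "a < n" "a < length u" using len assms(1) by (auto simp: Surs_iff)
  \<comment> \<open>The rank of \<open>a\<close> in the merged block is the number of letters of
    \<open>split_of p u\<close> contributed before \<open>a\<close>, so the entry at this rank is
    the one contributed by \<open>a\<close> itself.\<close>
  have "split_of p u ! count_list (take a (merge_blocks p u)) p = u ! a - p" if "u ! a = p \<or> u ! a = Suc p"
  proof -
    have "count_list (take a (merge_blocks p u)) p = length (split_of p (take a u))"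
      by (simp add: length_split_of count_merge[symmetric] merge_blocks_def take_map)
    moreover have "split_of p u = split_of p (take a u) @ (u ! a - p) # split_of p (drop (Suc a) u)"
    proof -
      have "split_of p u = split_of p (take a u @ u ! a # drop (Suc a) u)" using id_take_nth_drop[OF a(2)] by simp
      then show ?thesis using that by (simp add: split_of_def)
    qed
    ultimately show ?thesis by simp
  qed
  then show "facet (merge_blocks p u) p (split_of p u) ! a = u ! a"
    unfolding facet_nth[OF m(1) p s'(1) a(1)] using a(2) s'(2) by (auto simp: merge_blocks_def)
qed


section \<open>The integral boundary matrix\<close>

definition facet_coeff :: "nat list \<Rightarrow> nat \<Rightarrow> nat list \<Rightarrow> int" where
  "facet_coeff t i s = (- 1) ^ (\<Sum>j<i. count_list t j - 1) * sur_sign s"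

text \<open>The boundary matrix, with the cell as row and the face as column. Its entries are
  integers, so that cancellations are settled independently of the ring.\<close>

definition incidence :: "nat list \<Rightarrow> nat list \<Rightarrow> int" where
  "incidence t u = (\<Sum>i<vertices t. \<Sum>s\<in>Sur (count_list t i) 2. if u = facet t i s then facet_coeff t i s else 0)"

text \<open>Since the inversions of \<open>u\<close> are those of \<open>merge_blocks p u\<close> and those of the facet \<open>s\<close>, the sign
  \<open>sgn(\<sigma>\<^sub>s)\<close> is the quotient of the signs of \<open>u\<close> and \<open>merge_blocks p u\<close>. Up to this rescaling of the
  cells the coefficient only depends on \<open>p\<close> and on the number of elements in the blocks up to \<open>p\<close>.\<close>

definition merge_coeff :: "nat list \<Rightarrow> nat \<Rightarrow> int" where
  "merge_coeff u p = (- 1) ^ (p + (\<Sum>j<Suc p. count_list u j) + inversions u + inversions (merge_blocks p u))"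

lemma finite_Sur [simp]: "finite (Sur n k)"
  by (rule finite_subset[OF _ finite_Surs[of n]]) (auto simp: Sur_iff)

text \<open>Stated as an addition because subtraction of natural numbers is truncated.\<close>

lemma sum_minus_one:
  fixes f :: "nat \<Rightarrow> nat"
  assumes "\<And>j. j < k \<Longrightarrow> 0 < f j"
  shows "(\<Sum>j<k. f j - 1) + k = (\<Sum>j<k. f j)"
  using assms
proof (induction k)
  case (Suc k)
  have "0 < f k" using Suc.prems by simp
  moreover have "(\<Sum>j<k. f j - 1) + k = (\<Sum>j<k. f j)" using Suc by simp
  ultimately show ?case by simp
qed simp

text \<open>Modulo two, the dimensions of the factors before \<open>p\<close> add up to the number
  of elements in these blocks plus \<open>p\<close>. The count of \<open>0\<close> in the sign of
  the facet adds the block \<open>p\<close> of \<open>u\<close>, and \<open>inversions_merge\<close>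
  rewrites the inversions of the facet.\<close>

lemma facet_coeff_merge:
  assumes u: "u \<in> Surs n" "Suc p < vertices u"
  shows "facet_coeff (merge_blocks p u) p (split_of p u) = merge_coeff u p"
proof -
  have 1: "(\<Sum>j<p. count_list (merge_blocks p u) j - 1) = (\<Sum>j<p. count_list u j - 1)"
    by (intro sum.cong) (auto simp: count_merge_low)
  have 2: "(\<Sum>j<p. count_list u j - 1) + p = (\<Sum>j<p. count_list u j)"
    using u by (intro sum_minus_one count_list_pos[OF u(1)]) auto
  have "even ((\<Sum>j<p. count_list u j - 1) + (inversions (split_of p u) + count_list u p)) =
    even (p + (\<Sum>j<Suc p. count_list u j) + inversions u + inversions (merge_blocks p u))"
    using inversions_merge[of u p] by (auto simp: 2[symmetric])
  then show ?thesis
    unfolding facet_coeff_def merge_coeff_def sur_sign_eq[OF set_split_of] 1 count_split_of power_add[symmetric]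
    by (simp only: minus_one_power_iff)
qed

text \<open>The transposed description. The vertex \<open>i\<close> of \<open>t\<close> contributes
  only if merging the blocks \<open>i\<close> and \<open>i + 1\<close> of \<open>u\<close> gives
  \<open>t\<close>, and then through the single facet \<open>split_of i u\<close>. There are
  \<open>vertices u - 1\<close> adjacent pairs.\<close>

lemma incidence_eq:
  assumes u: "u \<in> Surs n" and t: "t \<in> Surs n"
  shows "incidence t u = (\<Sum>p<vertices u - 1. if t = merge_blocks p u then merge_coeff u p else 0)"
proof -
  have "(\<Sum>s\<in>Sur (count_list t i) 2. if u = facet t i s then facet_coeff t i s else 0) =
    (if Suc i < vertices u \<and> t = merge_blocks i u then merge_coeff u i else 0)" if i: "i < vertices t" for i
  proof (cases "Suc i < vertices u \<and> t = merge_blocks i u")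
    case True
    have "u = facet t i s \<longleftrightarrow> s = split_of i u" if "s \<in> Sur (count_list t i) 2" for s
      using True split_of_facet[OF t i that] facet_merge[OF u, of i] by auto
    then have "(\<Sum>s\<in>Sur (count_list t i) 2. if u = facet t i s then facet_coeff t i s else 0) =
      (\<Sum>s\<in>Sur (count_list t i) 2. if s = split_of i u then facet_coeff t i s else 0)"
      by (intro sum.cong) auto
    then show ?thesis using True split_of_Sur[OF u, of i] facet_coeff_merge[OF u, of i] by simp
  next
    case False
    have "u \<noteq> facet t i s" if s: "s \<in> Sur (count_list t i) 2" for s
    proof
      assume "u = facet t i s"
      then show False
        using False merge_facet[OF t i s] vertices_facet[OF t i, of s] s i by (auto simp: Sur_iff)
    qed
    then show ?thesis unfolding if_not_P[OF False] by (intro sum.neutral) auto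
  qed
  then have "incidence t u = (\<Sum>i<vertices t. if Suc i < vertices u \<and> t = merge_blocks i u then merge_coeff u i else 0)"
    unfolding incidence_def by (intro sum.cong) auto
  \<comment> \<open>A cell obtained from \<open>u\<close> by a merge has
    \<open>vertices u - 1\<close> vertices, so the bound on \<open>i\<close> coming from
    \<open>t\<close> is implied by the other conditions.\<close>
  also have "\<dots> = (\<Sum>i\<in>{i. Suc i < vertices u \<and> t = merge_blocks i u}. merge_coeff u i)"
    using merge_Surs(2)[OF u] by (intro sum.mono_neutral_cong) (auto intro: finite_subset[of _ "{..<vertices u}"])
  also have "\<dots> = (\<Sum>p<vertices u - 1. if t = merge_blocks p u then merge_coeff u p else 0)"
    by (intro sum.mono_neutral_cong) (auto intro: finite_subset[of _ "{..<vertices u}"])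
  finally show ?thesis .
qed

text \<open>Together with \<open>merge_merge\<close>, a simplicial identity for codegeneracies, this makes the terms of
  \<open>d\<^sup>2\<close> cancel in pairs.\<close>

lemma merge_coeff_anticommute:
  assumes "p \<le> q"
  shows "merge_coeff u (Suc q) * merge_coeff (merge_blocks (Suc q) u) p = - (merge_coeff u p * merge_coeff (merge_blocks p u) q)"
proof -
  \<comment> \<open>The merge takes place above block \<open>p\<close> and leaves the blocks up to
    \<open>p\<close> alone.\<close>
  have 1: "(\<Sum>j<Suc p. count_list (merge_blocks (Suc q) u) j) = (\<Sum>j<Suc p. count_list u j)"
    using assms by (intro sum.cong) (auto simp: count_merge_low)
  \<comment> \<open>Merging \<open>p\<close> and \<open>p + 1\<close> renumbers block
    \<open>Suc q\<close> as \<open>q\<close>, but the same elements lie in the blocks up to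
    there.\<close>
  have 2: "(\<Sum>j<Suc q. count_list (merge_blocks p u) j) = (\<Sum>j<Suc (Suc q). count_list u j)"
    using assms
  proof (induction q rule: dec_induct)
    case base
    have "(\<Sum>j<p. count_list (merge_blocks p u) j) = (\<Sum>j<p. count_list u j)"
      by (intro sum.cong) (auto simp: count_merge_low)
    then show ?case by (simp add: count_merge)
  next
    case (step q)
    then show ?case by (simp add: count_merge_high)
  qed
  have sg: "(-1) ^ a = - ((-1) ^ b :: int)" if "odd (a + b)" for a b :: nat
    using that by (auto simp: minus_one_power_iff)
  \<comment> \<open>The inversion numbers of the intermediate cells occur twice, those of the outer
    cells agree on both sides and so do the element counts. The exponents differ modulo two only by
    \<open>Suc q\<close> against \<open>q\<close>.\<close>
  show ?thesis
    unfolding merge_coeff_def power_add[symmetric] 1 2 merge_merge[OF assms]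
    by (rule sg) (use assms in auto)
qed

lemma incidence_incidence:
  assumes t: "t \<in> Surs n" and u: "u \<in> Surs n"
  shows "(\<Sum>v\<in>Surs n. incidence t v * incidence v u) = 0"
proof -
  define m where "m = vertices u - 1"
  define G where "G p q = (if t = merge_blocks q (merge_blocks p u) then merge_coeff u p * merge_coeff (merge_blocks p u) q else 0)" for p q
  have mp: "merge_blocks p u \<in> Surs n" "vertices (merge_blocks p u) - 1 = m - 1" if "p < m" for p
    using merge_Surs[OF u, of p] that by (auto simp: m_def)
  have "(\<Sum>v\<in>Surs n. incidence t v * incidence v u) =
    (\<Sum>v\<in>Surs n. \<Sum>p<m. if v = merge_blocks p u then incidence t v * merge_coeff u p else 0)"
    by (intro sum.cong) (auto simp: incidence_eq[OF u] sum_distrib_left m_def intro!: sum.cong)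
  also have "\<dots> = (\<Sum>p<m. incidence t (merge_blocks p u) * merge_coeff u p)"
    unfolding sum.swap[of _ _ "Surs n"] using mp(1) by (intro sum.cong) auto
  also have "\<dots> = (\<Sum>p<m. \<Sum>q<m - 1. G p q)"
    using mp by (intro sum.cong) (auto simp: incidence_eq[OF mp(1) t] G_def sum_distrib_right mp(2) intro!: sum.cong)
  also have "\<dots> = (\<Sum>(p, q)\<in>{..<m} \<times> {..<m - 1}. G p q)"
    by (simp add: sum.cartesian_product)
  also have "\<dots> = (\<Sum>(p, q)\<in>{(p, q). p \<le> q \<and> q < m - 1} \<union> {(p, q). q < p \<and> p < m}. G p q)"
    by (intro sum.cong) auto
  also have "\<dots> = (\<Sum>(p, q)\<in>{(p, q). p \<le> q \<and> q < m - 1}. G p q) + (\<Sum>(p, q)\<in>{(p, q). q < p \<and> p < m}. G p q)"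
    by (rule sum.union_disjoint) (auto intro: finite_subset[of _ "{..<m} \<times> {..<m}"])
  also have "(\<Sum>(p, q)\<in>{(p, q). q < p \<and> p < m}. G p q) = (\<Sum>(p, q)\<in>{(p, q). p \<le> q \<and> q < m - 1}. - G p q)"
  \<comment> \<open>Merging at \<open>p\<close> first and at the lower gap \<open>q\<close> second
    gives the same cell as merging at \<open>q\<close> first and then at \<open>p - 1\<close>, the
    new number of the gap \<open>p\<close>.\<close>
  proof (rule sum.reindex_bij_witness[of _ "\<lambda>(p, q). (Suc q, p)" "\<lambda>(p, q). (q, p - 1)"])
    fix a assume "a \<in> {(p, q). q < p \<and> p < m}"
    then obtain p q where a: "a = (p, q)" "q < p" "p < m" by auto
    then have "G (Suc (p - 1)) q = - G q (p - 1)"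
      using merge_coeff_anticommute[of q "p - 1" u] merge_merge[of q "p - 1" u] by (simp add: G_def)
    then show "(case case a of (p, q) \<Rightarrow> (q, p - 1) of (p, q) \<Rightarrow> - G p q) = (case a of (p, q) \<Rightarrow> G p q)"
      using a by simp
  qed auto
  finally show ?thesis by (simp add: sum_negf case_prod_unfold)
qed

section \<open>Boundary of a substituted surjection\<close>

lemma sum_count_minus_one: "t \<in> Surs n \<Longrightarrow> (\<Sum>j<vertices t. count_list t j - 1) = n - vertices t"
  using sum_minus_one[of "vertices t" "count_list t"] count_list_pos[of t n] sum_count_list[of t n] by simp

text \<open>Both sides substitute corollas at every vertex of the \<open>ts\<close> except one,
  where \<open>s\<close> is inserted; \<open>sur_subst_assoc\<close> identifies the two
  bracketings.\<close>

lemma facet_sur_subst: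
  assumes t: "t \<in> Surs n" and ts: "substitutable t ts" and j: "j < vertices t" and w: "w < vertices (ts ! j)"
    and s: "s \<in> Surs (count_list (ts ! j) w)"
  shows "facet (sur_subst t ts) ((\<Sum>i<j. vertices (ts ! i)) + w) s = sur_subst t (ts[j := facet (ts ! j) w s])"
proof -
  let ?c = "map corollas ts"
  let ?r = "?c[j := (?c ! j)[w := s]]"
  have len: "length ts = vertices t" using substitutableD(1)[OF ts] .
  have tsj: "ts ! i \<in> Surs (count_list t i)" if "i < vertices t" for i by (rule substitutableD(2)[OF ts that])
  have rj: "substitutable (ts ! i) (?r ! i)" if "i < vertices t" for i
    using substitutable_corollas[OF tsj[OF that]] substitutable_facet[OF tsj w s] j that len
    by (cases "i = j") auto
  have "(\<Sum>i<j. vertices (ts ! i)) = (\<Sum>i<j. length (?c ! i))"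
    using j len by (intro sum.cong) auto
  then have "(corollas (sur_subst t ts))[(\<Sum>i<j. vertices (ts ! i)) + w := s] = concat ?r"
    unfolding concat_corollas[OF t ts, symmetric]
    using concat_update_offset[of j ?c w s] j w len by simp
  moreover have "map2 sur_subst ts ?r = ts[j := facet (ts ! j) w s]"
    using len j sur_subst_corollas[OF tsj]
    by (intro nth_equalityI) (auto simp: nth_list_update facet_def)
  ultimately show ?thesis
    using sur_subst_assoc(3)[OF t ts, of ?r] rj len by (simp add: facet_def)
qed

text \<open>The Leibniz rule for incidence numbers. The vertices of the composite are grouped by
  \<open>j\<close>. The exponent of the sign at vertex \<open>w\<close> of \<open>ts ! j\<close>
  splits into the degrees of the earlier \<open>ts ! i\<close>, by
  \<open>sum_count_minus_one\<close>, and the exponent that this vertex has inside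
  \<open>ts ! j\<close>.\<close>

lemma incidence_sur_subst:
  assumes t: "t \<in> Surs n" and ts: "substitutable t ts"
  shows "incidence (sur_subst t ts) u =
    (\<Sum>j<vertices t. (- 1) ^ (\<Sum>i<j. count_list t i - vertices (ts ! i)) *
      (\<Sum>v\<in>Surs (count_list t j). if u = sur_subst t (ts[j := v]) then incidence (ts ! j) v else 0))"
proof -
  let ?o = "\<lambda>j. \<Sum>i<j. vertices (ts ! i)" and ?u = "sur_subst t ts"
  have tsj: "ts ! i \<in> Surs (count_list t i)" if "i < vertices t" for i by (rule substitutableD(2)[OF ts that])
  have "incidence ?u u = (\<Sum>j<vertices t. \<Sum>w<vertices (ts ! j). \<Sum>s\<in>Sur (count_list ?u (?o j + w)) 2.
      if u = facet ?u (?o j + w) s then facet_coeff ?u (?o j + w) s else 0)"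
    unfolding incidence_def vertices_sur_subst[OF t ts] sum_lessThan_concat ..
  also have "\<dots> = (\<Sum>j<vertices t. (- 1) ^ (\<Sum>i<j. count_list t i - vertices (ts ! i)) *
      (\<Sum>v\<in>Surs (count_list t j). if u = sur_subst t (ts[j := v]) then incidence (ts ! j) v else 0))"
  proof (rule sum.cong[OF refl])
    fix j assume "j \<in> {..<vertices t}"
    then have j: "j < vertices t" by simp
    let ?e = "(- 1) ^ (\<Sum>i<j. count_list t i - vertices (ts ! i)) :: int"
    have cnt: "count_list ?u (?o i + w) = count_list (ts ! i) w" if "i < vertices t" "w < vertices (ts ! i)" for i w
      by (rule count_sur_subst[OF t ts that])
    have coeff: "facet_coeff ?u (?o j + w) s = ?e * facet_coeff (ts ! j) w s" if w: "w < vertices (ts ! j)" for w s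
    proof -
      have "(\<Sum>l<?o j + w. count_list ?u l - 1) =
          (\<Sum>l<?o j. count_list ?u l - 1) + (\<Sum>l<w. count_list ?u (?o j + l) - 1)"
        by (induction w) auto
      also have "(\<Sum>l<?o j. count_list ?u l - 1) = (\<Sum>i<j. \<Sum>l<vertices (ts ! i). count_list ?u (?o i + l) - 1)"
        by (rule sum_lessThan_concat)
      also have "\<dots> = (\<Sum>i<j. count_list t i - vertices (ts ! i))"
        using j by (intro sum.cong refl) (simp add: cnt sum_count_minus_one[OF tsj] del: One_nat_def)
      also have "(\<Sum>l<w. count_list ?u (?o j + l) - 1) = (\<Sum>l<w. count_list (ts ! j) l - 1)"
        using j w by (intro sum.cong refl) (simp add: cnt)
      finally show ?thesis by (simp add: facet_coeff_def power_add)
    qed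
    have "(\<Sum>w<vertices (ts ! j). \<Sum>s\<in>Sur (count_list ?u (?o j + w)) 2.
        if u = facet ?u (?o j + w) s then facet_coeff ?u (?o j + w) s else 0) =
      (\<Sum>w<vertices (ts ! j). \<Sum>s\<in>Sur (count_list (ts ! j) w) 2.
        if u = sur_subst t (ts[j := facet (ts ! j) w s]) then ?e * facet_coeff (ts ! j) w s else 0)"
      using facet_sur_subst[OF t ts j] coeff by (intro sum.cong) (auto simp: cnt[OF j] Sur_iff)
    \<comment> \<open>The auxiliary sum over \<open>v\<close> collects the splittings of
      \<open>ts ! j\<close> by the resulting cell, so that \<open>incidence (ts ! j) v\<close> can
      be recognised after exchanging the sums.\<close>
    also have "\<dots> = (\<Sum>w<vertices (ts ! j). \<Sum>s\<in>Sur (count_list (ts ! j) w) 2. \<Sum>v\<in>Surs (count_list t j).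
        if v = facet (ts ! j) w s then if u = sur_subst t (ts[j := v]) then ?e * facet_coeff (ts ! j) w s else 0 else 0)"
      using facet_Surs[OF tsj[OF j]] by (intro sum.cong refl) (auto simp: Sur_iff)
    also have "\<dots> = (\<Sum>v\<in>Surs (count_list t j). \<Sum>w<vertices (ts ! j). \<Sum>s\<in>Sur (count_list (ts ! j) w) 2.
        if v = facet (ts ! j) w s then if u = sur_subst t (ts[j := v]) then ?e * facet_coeff (ts ! j) w s else 0 else 0)"
      unfolding sum.swap[of _ _ "Surs (count_list t j)"] ..
    also have "\<dots> = ?e * (\<Sum>v\<in>Surs (count_list t j). if u = sur_subst t (ts[j := v]) then incidence (ts ! j) v else 0)"
      unfolding sum_distrib_left incidence_def
      by (intro sum.cong refl) (auto simp: sum_distrib_left intro!: sum.cong sum.neutral)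
    finally show "(\<Sum>w<vertices (ts ! j). \<Sum>s\<in>Sur (count_list ?u (?o j + w)) 2.
        if u = facet ?u (?o j + w) s then facet_coeff ?u (?o j + w) s else 0) =
      ?e * (\<Sum>v\<in>Surs (count_list t j). if u = sur_subst t (ts[j := v]) then incidence (ts ! j) v else 0)" .
  qed
  finally show ?thesis .
qed

section \<open>Concatenation of tensors\<close>

lemma multilinear_zero:
  assumes "module R N" "\<And>M. M \<in> set Ms \<Longrightarrow> module R M" "multilinear R Ms N f"
    and "xs \<in> tuples Ms" "i < length Ms" "xs ! i = \<zero>\<^bsub>Ms ! i\<^esub>"
  shows "f xs = \<zero>\<^bsub>N\<^esub>"
proof -
  have "f (xs[i := \<zero>\<^bsub>Ms ! i\<^esub>]) = \<zero>\<^bsub>N\<^esub>"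
    by (rule linear_map_zero[OF assms(2)[OF nth_mem[OF assms(5)]] assms(1) multilinear_linear[OF assms(3-5)]])
  then show ?thesis using assms(6) by (metis list_update_id)
qed

lemma multilinear_sum_module:
  assumes "\<And>i. i \<in> I \<Longrightarrow> multilinear R Ms (N i) (g i)"
  shows "multilinear R Ms (sum_module I N) (\<lambda>xs. \<lambda>i\<in>I. g i xs)"
proof (rule multilinearI)
  fix xs assume xs: "xs \<in> tuples Ms"
  show "(\<lambda>i\<in>I. g i xs) \<in> carrier (sum_module I N)"
    using multilinear_closed[OF assms xs] by (simp add: sum_module_simps)
  fix j assume j: "j < length Ms"
  note lin = linear_mapD[OF multilinear_linear[OF assms xs j]]
  show "linear_map R (Ms ! j) (sum_module I N) (\<lambda>y. \<lambda>i\<in>I. g i (xs[j := y]))"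
    by (rule linear_mapI) (auto simp: sum_module_simps lin)
qed

section \<open>Concatenation of two tensors as a bilinear map\<close>

context
  fixes R :: "('r, 'x) ring_scheme"
    and L1 L2 :: "('r, 'a) module list"
  assumes R: "cring R" and L1: "\<And>M. M \<in> set L1 \<Longrightarrow> module R M" and L2: "\<And>M. M \<in> set L2 \<Longrightarrow> module R M"
begin

private abbreviation (input) "T \<equiv> tensor R (L1 @ L2)"
private abbreviation (input) "h xs Y \<equiv> tensor_lift R T (\<lambda>ys. pure R (L1 @ L2) (xs @ ys)) Y"
private abbreviation (input) "B X Y \<equiv> tensor_lift R T (\<lambda>xs. h xs Y) X"

private lemma L12: "M \<in> set (L1 @ L2) \<Longrightarrow> module R M" using L1 L2 by auto
private lemma T: "module R T" by (rule module_tensor[OF R L12])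

private lemma pure_l: "ys \<in> tuples L2 \<Longrightarrow> multilinear R L1 T (\<lambda>xs. pure R (L1 @ L2) (xs @ ys))"
  using multilinear_append[of R "[]" L1 L2 T "pure R (L1 @ L2)" "[]" ys] pure_multilinear[OF R, of "L1 @ L2"] L12
  by (simp add: tuples_iff)

private lemma pure_r: "xs \<in> tuples L1 \<Longrightarrow> multilinear R L2 T (\<lambda>ys. pure R (L1 @ L2) (xs @ ys))"
  using multilinear_append[of R L1 L2 "[]" T "pure R (L1 @ L2)" xs "[]"] pure_multilinear[OF R, of "L1 @ L2"] L12
  by (simp add: tuples_iff)

private lemma h_linear: "xs \<in> tuples L1 \<Longrightarrow> linear_map R (tensor R L2) T (\<lambda>Y. h xs Y)"
  by (rule tensor_lift_linear[OF R L2 T pure_r])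

private lemma h_pure: "xs \<in> tuples L1 \<Longrightarrow> ys \<in> tuples L2 \<Longrightarrow> h xs (pure R L2 ys) = pure R (L1 @ L2) (xs @ ys)"
  by (rule tensor_lift_pure[OF R L2 T pure_r])

text \<open>The outer lift requires multilinearity in the left tuple for a fixed tensor
  \<open>Y\<close>. For pure \<open>Y\<close> it is multilinearity of \<open>pure\<close>, and both
  sides of each identity are linear in \<open>Y\<close>.\<close>

private lemma h_multilinear:
  assumes Y: "Y \<in> carrier (tensor R L2)" shows "multilinear R L1 T (\<lambda>xs. h xs Y)"
proof (rule multilinearI)
  show "h xs Y \<in> carrier T" if "xs \<in> tuples L1" for xs by (rule linear_mapD(1)[OF h_linear[OF that] Y])
  fix xs i assume xs: "xs \<in> tuples L1" and i: "i < length L1"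
  interpret Mi: module R "L1 ! i" using L1 i by simp
  note upd = tuples_update[OF xs]
  show "linear_map R (L1 ! i) T (\<lambda>y. h (xs[i := y]) Y)"
  proof (rule linear_mapI)
    fix x assume x: "x \<in> carrier (L1 ! i)"
    show "h (xs[i := x]) Y \<in> carrier T" by (rule linear_mapD(1)[OF h_linear[OF upd[OF x]] Y])
    fix y assume y: "y \<in> carrier (L1 ! i)"
    show "h (xs[i := x \<oplus>\<^bsub>L1 ! i\<^esub> y]) Y = h (xs[i := x]) Y \<oplus>\<^bsub>T\<^esub> h (xs[i := y]) Y"
    proof (rule linear_eq_on_tensor[OF R L2 T h_linear linear_map_add[OF T h_linear h_linear] _ Y])
      fix ys assume ys: "ys \<in> tuples L2"
      show "h (xs[i := x \<oplus>\<^bsub>L1 ! i\<^esub> y]) (pure R L2 ys) = h (xs[i := x]) (pure R L2 ys) \<oplus>\<^bsub>T\<^esub> h (xs[i := y]) (pure R L2 ys)"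
        unfolding h_pure[OF upd[OF x] ys] h_pure[OF upd[OF y] ys] h_pure[OF upd[OF Mi.a_closed[OF x y]] ys]
        by (rule linear_mapD(2)[OF multilinear_linear[OF pure_l[OF ys] xs i] x y])
    qed (use upd x y in auto)
  next
    fix r x assume r: "r \<in> carrier R" and x: "x \<in> carrier (L1 ! i)"
    show "h (xs[i := r \<odot>\<^bsub>L1 ! i\<^esub> x]) Y = r \<odot>\<^bsub>T\<^esub> h (xs[i := x]) Y"
    proof (rule linear_eq_on_tensor[OF R L2 T h_linear linear_map_smult[OF T h_linear r] _ Y])
      fix ys assume ys: "ys \<in> tuples L2"
      show "h (xs[i := r \<odot>\<^bsub>L1 ! i\<^esub> x]) (pure R L2 ys) = r \<odot>\<^bsub>T\<^esub> h (xs[i := x]) (pure R L2 ys)"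
        unfolding h_pure[OF upd[OF x] ys] h_pure[OF upd[OF Mi.smult_closed[OF r x]] ys]
        by (rule linear_mapD(3)[OF multilinear_linear[OF pure_l[OF ys] xs i] r x])
    qed (use upd x r in auto)
  qed
qed

lemma tensor_append_linear_left:
  "Y \<in> carrier (tensor R L2) \<Longrightarrow> linear_map R (tensor R L1) T (\<lambda>X. B X Y)"
  by (rule tensor_lift_linear[OF R L1 T h_multilinear])

private lemma B_pure: "xs \<in> tuples L1 \<Longrightarrow> Y \<in> carrier (tensor R L2) \<Longrightarrow> B (pure R L1 xs) Y = h xs Y"
  by (rule tensor_lift_pure[OF R L1 T h_multilinear])

lemma tensor_append_pure:
  "xs \<in> tuples L1 \<Longrightarrow> ys \<in> tuples L2 \<Longrightarrow> B (pure R L1 xs) (pure R L2 ys) = pure R (L1 @ L2) (xs @ ys)"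
  using B_pure pure_closed[OF R L2] h_pure by simp

text \<open>For pure \<open>X\<close> the map \<open>B\<close> is the inner lift, which is linear in
  \<open>Y\<close>; linearity on the left extends this to all \<open>X\<close>.\<close>

lemma tensor_append_linear_right:
  assumes X: "X \<in> carrier (tensor R L1)" shows "linear_map R (tensor R L2) T (\<lambda>Y. B X Y)"
proof -
  interpret T2: module R "tensor R L2" by (rule module_tensor[OF R L2])
  note l = tensor_append_linear_left
  show ?thesis
  proof (rule linear_mapI)
    fix Y assume Y: "Y \<in> carrier (tensor R L2)"
    show "B X Y \<in> carrier T" by (rule linear_mapD(1)[OF l[OF Y] X])
    fix Y' assume Y': "Y' \<in> carrier (tensor R L2)"
    show "B X (Y \<oplus>\<^bsub>tensor R L2\<^esub> Y') = B X Y \<oplus>\<^bsub>T\<^esub> B X Y'"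
    proof (rule linear_eq_on_tensor[OF R L1 T l linear_map_add[OF T l l] _ X])
      show "B (pure R L1 xs) (Y \<oplus>\<^bsub>tensor R L2\<^esub> Y') = B (pure R L1 xs) Y \<oplus>\<^bsub>T\<^esub> B (pure R L1 xs) Y'"
        if "xs \<in> tuples L1" for xs
        unfolding B_pure[OF that Y] B_pure[OF that Y'] B_pure[OF that T2.a_closed[OF Y Y']]
        by (rule linear_mapD(2)[OF h_linear[OF that] Y Y'])
    qed (use Y Y' in auto)
  next
    fix r Y assume r: "r \<in> carrier R" and Y: "Y \<in> carrier (tensor R L2)"
    show "B X (r \<odot>\<^bsub>tensor R L2\<^esub> Y) = r \<odot>\<^bsub>T\<^esub> B X Y"
    proof (rule linear_eq_on_tensor[OF R L1 T l linear_map_smult[OF T l r] _ X])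
      show "B (pure R L1 xs) (r \<odot>\<^bsub>tensor R L2\<^esub> Y) = r \<odot>\<^bsub>T\<^esub> B (pure R L1 xs) Y"
        if "xs \<in> tuples L1" for xs
        unfolding B_pure[OF that Y] B_pure[OF that T2.smult_closed[OF r Y]]
        by (rule linear_mapD(3)[OF h_linear[OF that] r Y])
    qed (use Y r in auto)
  qed
qed

end

lemma tuples_Cons: "xs \<in> tuples (M # Ms) \<longleftrightarrow> (\<exists>y ys. xs = y # ys \<and> y \<in> carrier M \<and> ys \<in> tuples Ms)"
  by (auto simp: tuples_def list_all2_Cons2)

lemma multilinear_tensor_concat:
  assumes "cring R" "\<And>L M. L \<in> set Ls \<Longrightarrow> M \<in> set L \<Longrightarrow> module R M"
  shows "multilinear R (map (tensor R) Ls) (tensor R (concat Ls)) (tensor_concat R Ls)"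
  using assms(2)
proof (induction Ls)
  case Nil
  have "pure R [] [] \<in> carrier (tensor R [])" by (rule pure_closed[OF assms(1)]) (auto simp: tuples_iff)
  then show ?case by (intro multilinearI) auto
next
  case (Cons L Ls)
  have L: "module R M" if "M \<in> set L" for M using Cons.prems[of L M] that by simp
  have Ls: "module R M" if "M \<in> set (concat Ls)" for M using Cons.prems that by auto
  have IH: "multilinear R (map (tensor R) Ls) (tensor R (concat Ls)) (tensor_concat R Ls)"
    by (rule Cons.IH[OF Cons.prems[OF list.set_intros(2)]])
  show ?case
  proof (rule multilinearI)
    fix xs assume "xs \<in> tuples (map (tensor R) (L # Ls))"
    then obtain X Xs where xs: "xs = X # Xs" and X: "X \<in> carrier (tensor R L)" and Xs: "Xs \<in> tuples (map (tensor R) Ls)"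
      by (auto simp: tuples_Cons)
    show "tensor_concat R (L # Ls) xs \<in> carrier (tensor R (concat (L # Ls)))"
      using linear_mapD(1)[OF tensor_append_linear_right[OF assms(1) L Ls X] multilinear_closed[OF IH Xs]] xs by simp
    fix i assume i: "i < length (map (tensor R) (L # Ls))"
    show "linear_map R (map (tensor R) (L # Ls) ! i) (tensor R (concat (L # Ls))) (\<lambda>y. tensor_concat R (L # Ls) (xs[i := y]))"
    proof (cases i)
      case 0
      then show ?thesis
        using tensor_append_linear_left[OF assms(1) L Ls multilinear_closed[OF IH Xs]] xs by simp
    next
      case (Suc i')
      then show ?thesis
        using linear_map_comp[OF multilinear_linear[OF IH Xs, of i'] tensor_append_linear_right[OF assms(1) L Ls X]] xs i by simp
    qed
  qed
qed

lemma tensor_concat_pure: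
  assumes "cring R" "\<And>L M. L \<in> set Ls \<Longrightarrow> M \<in> set L \<Longrightarrow> module R M"
    and "list_all2 (\<lambda>xs L. xs \<in> tuples L) xss Ls"
  shows "tensor_concat R Ls (map2 (pure R) Ls xss) = pure R (concat Ls) (concat xss) \<and> concat xss \<in> tuples (concat Ls)"
  using assms(3,2)
proof (induction rule: list_all2_induct)
  case (Cons xs xss L Ls)
  have L: "module R M" if "M \<in> set L" for M using Cons.prems[of L M] that by simp
  have Ls: "module R M" if "M \<in> set (concat Ls)" for M using Cons.prems that by auto
  have IH: "tensor_concat R Ls (map2 (pure R) Ls xss) = pure R (concat Ls) (concat xss)"
    "concat xss \<in> tuples (concat Ls)" using Cons by auto
  have "concat (xs # xss) \<in> tuples (concat (L # Ls))"
    using IH(2) Cons.hyps(1) by (auto simp: tuples_def intro: list_all2_appendI)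
  then show ?case using tensor_append_pure[OF assms(1) L Ls Cons.hyps(1) IH(2)] IH(1) by simp
qed (simp add: tuples_iff)

section \<open>The module of trees\<close>

lemma length_arity_list [simp]: "length (arity_list t) = vertices t"
  by (simp add: arity_list_def)

lemma arity_list_nth [simp]: "j < vertices t \<Longrightarrow> arity_list t ! j = Suc (count_list t j)"
  by (simp add: arity_list_def)

lemma finite_substitutable: "finite {ts. substitutable t ts}"
proof (rule finite_subset)
  show "{ts. substitutable t ts} \<subseteq> {ts. set ts \<subseteq> (\<Union>j<vertices t. Surs (count_list t j)) \<and> length ts = vertices t}"
    by (fastforce simp: substitutable_def in_set_conv_nth)
qed (rule finite_lists_length_eq; simp)

text \<open>The generator of arity \<open>a\<close> has degree \<open>a - 2\<close>, so a fully
  decorated surjection has the dimension of its cell as degree.\<close>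

lemma sum_list_arity: "t \<in> Surs n \<Longrightarrow> (\<Sum>a\<leftarrow>arity_list t. int a - 2) = int n - int (vertices t)"
  using sum_count_list[of t n]
  by (simp add: arity_list_def comp_def sum_list_subtractf interv_sum_list_conv_sum_set_nat sum_subtractf atLeast0LessThan flip: of_nat_sum)

context
  fixes R :: "('r, 'x) ring_scheme" and M :: "nat \<Rightarrow> ('r, 'a) module"
  assumes R: "cring R" and M: "\<And>n. module R (M n)"
begin

lemma module_tensor_arity: "module R (tensor R (map M al))"
  by (rule module_tensor[OF R]) (use M in auto)

lemma module_trees: "module R (trees R M n)"
  unfolding trees_def by (rule module_sum_module[OF R module_tensor_arity])

text \<open>A summand first projects the \<open>j\<close>-th argument to its component at
  \<open>ts ! j\<close>, which is linear, and then concatenates the resulting tensors, which is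
  multilinear.\<close>

lemma multilinear_trees_comp_summand:
  assumes t: "t \<in> Surs n" and ts: "substitutable t ts"
  shows "multilinear R (map (trees R M) (arity_list t)) (tensor R (map M (arity_list (sur_subst t ts))))
    (\<lambda>xs. tensor_concat R (map (\<lambda>s. map M (arity_list s)) ts) (map2 (\<lambda>x s. x s) xs ts))"
proof -
  let ?Ls = "map (\<lambda>s. map M (arity_list s)) ts"
  have len: "length ts = vertices t" by (rule substitutableD(1)[OF ts])
  \<comment> \<open>The two lists of factors are equal, order included, so no reordering isomorphism
    intervenes.\<close>
  have T: "tensor R (concat ?Ls) = tensor R (map M (arity_list (sur_subst t ts)))"
    unfolding arity_list_sur_subst[OF t ts] by (simp add: map_concat comp_def)
  have c: "multilinear R (map (tensor R) ?Ls) (tensor R (concat ?Ls)) (tensor_concat R ?Ls)"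
    by (rule multilinear_tensor_concat[OF R]) (use M in auto)
  have lin: "linear_map R (map (trees R M) (arity_list t) ! j) (map (tensor R) ?Ls ! j) (\<lambda>x. x (ts ! j))"
    if "j < length (map (trees R M) (arity_list t))" for j
    using that len linear_map_component[OF substitutableD(2)[OF ts, of j], of R "\<lambda>t. tensor R (map M (arity_list t))"]
    by (simp add: trees_def)
  have "multilinear R (map (trees R M) (arity_list t)) (tensor R (concat ?Ls))
    (\<lambda>xs. tensor_concat R ?Ls (map (\<lambda>j. (xs ! j) (ts ! j)) [0..<length (map (trees R M) (arity_list t))]))"
    by (rule multilinear_map[OF c _ lin]) (use len in simp_all)
  then show ?thesis
    unfolding T
  proof (rule multilinear_cong[rotated 2])
    fix xs assume "xs \<in> tuples (map (trees R M) (arity_list t))"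
    then have "map2 (\<lambda>x s. x s) xs ts = map (\<lambda>j. (xs ! j) (ts ! j)) [0..<length (map (trees R M) (arity_list t))]"
      using len by (intro nth_equalityI) (auto simp: tuples_iff)
    then show "tensor_concat R ?Ls (map2 (\<lambda>x s. x s) xs ts) =
      tensor_concat R ?Ls (map (\<lambda>j. (xs ! j) (ts ! j)) [0..<length (map (trees R M) (arity_list t))])" by simp
  qed (use module_trees in auto)
qed

lemma multilinear_trees_comp:
  assumes t: "t \<in> Surs n"
  shows "multilinear R (map (trees R M) (arity_list t)) (trees R M (n + 1)) (trees_comp R M t)"
proof -
  have len: "length t = n" using t by (simp add: Surs_iff)
  show ?thesis
    unfolding trees_comp_def[abs_def] trees_def[of R M "n + 1"] len add_diff_cancel_right'
  proof (intro multilinear_sum_module multilinear_sum module_tensor_arity)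
    fix u ts assume "ts \<in> {ts. substitutable t ts \<and> sur_subst t ts = u}"
    then show "multilinear R (map (trees R M) (arity_list t)) (tensor R (map M (arity_list u)))
      (\<lambda>xs. tensor_concat R (map (\<lambda>s. map M (arity_list s)) ts) (map2 (\<lambda>x s. x s) xs ts))"
      using multilinear_trees_comp_summand[OF t, of ts] by auto
  qed (use module_trees in auto)
qed

end

section \<open>Rank one tensors\<close>

lemma V_simps:
  "carrier (V R n) = (if n \<ge> 2 then carrier R else {\<zero>\<^bsub>R\<^esub>})" "\<zero>\<^bsub>V R n\<^esub> = \<zero>\<^bsub>R\<^esub>"
  "x \<oplus>\<^bsub>V R n\<^esub> y = x \<oplus>\<^bsub>R\<^esub> y" "r \<odot>\<^bsub>V R n\<^esub> x = r \<otimes>\<^bsub>R\<^esub> x"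
  by (auto simp: V_def)

lemma module_V: assumes "cring R" shows "module R (V R n)"
proof -
  interpret cring R by fact
  show ?thesis
  proof (rule moduleI[OF assms])
    show "abelian_group (V R n)"
    proof (rule abelian_groupI)
      fix x assume x: "x \<in> carrier (V R n)"
      have "\<ominus>\<^bsub>R\<^esub> x \<in> carrier (V R n)" "\<ominus>\<^bsub>R\<^esub> x \<oplus>\<^bsub>V R n\<^esub> x = \<zero>\<^bsub>V R n\<^esub>"
        using x by (auto simp: V_simps l_neg split: if_splits)
      then show "\<exists>y\<in>carrier (V R n). y \<oplus>\<^bsub>V R n\<^esub> x = \<zero>\<^bsub>V R n\<^esub>" by blast
    qed (auto simp: V_simps a_ac split: if_splits)
  qed (auto simp: V_simps l_distr r_distr m_assoc split: if_splits)
qed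

text \<open>This functional detects coefficients, as it takes the value \<open>1\<close> on the
  tensor of the generators. Its target is the ground ring, available as a module in the form
  \<open>V R 2\<close>.\<close>

lemma multilinear_product:
  assumes "cring R"
  shows "multilinear R (map (V R) al) (V R 2) (\<lambda>xs. foldr (\<otimes>\<^bsub>R\<^esub>) xs \<one>\<^bsub>R\<^esub>)"
proof -
  interpret cring R by fact
  have Vc: "x \<in> carrier R" if "x \<in> carrier (V R n)" for x n using that by (auto simp: V_simps split: if_splits)
  have cl: "foldr (\<otimes>\<^bsub>R\<^esub>) xs \<one>\<^bsub>R\<^esub> \<in> carrier R" if "set xs \<subseteq> carrier R" for xs
    using that by (induction xs) auto
  \<comment> \<open>Factoring out the entry in slot \<open>i\<close> turns linearity in this slot
    into distributivity and associativity.\<close>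
  have upd: "foldr (\<otimes>\<^bsub>R\<^esub>) (xs[i := y]) \<one>\<^bsub>R\<^esub> = y \<otimes>\<^bsub>R\<^esub> foldr (\<otimes>\<^bsub>R\<^esub>) (xs[i := \<one>\<^bsub>R\<^esub>]) \<one>\<^bsub>R\<^esub>"
    if "set xs \<subseteq> carrier R" "i < length xs" "y \<in> carrier R" for xs i y
    using that
  proof (induction xs arbitrary: i)
    case (Cons x xs)
    have "set (xs[j := \<one>\<^bsub>R\<^esub>]) \<subseteq> carrier R" for j
      using Cons.prems set_update_subset_insert[of xs j "\<one>\<^bsub>R\<^esub>"] by auto
    then show ?case using Cons cl[of xs] cl by (cases i) (auto simp: m_lcomm)
  qed simp
  have tup: "set xs \<subseteq> carrier R" if "xs \<in> tuples (map (V R) al)" for xs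
    using that by (auto simp: tuples_iff in_set_conv_nth) (metis Vc)
  show ?thesis
  proof (rule multilinearI)
    fix xs assume xs: "xs \<in> tuples (map (V R) al)"
    show "foldr (\<otimes>\<^bsub>R\<^esub>) xs \<one>\<^bsub>R\<^esub> \<in> carrier (V R 2)" using cl[OF tup[OF xs]] by (simp add: V_simps)
    fix i assume i: "i < length (map (V R) al)"
    have len: "i < length xs" using xs i by (simp add: tuples_iff)
    have "set (xs[i := \<one>\<^bsub>R\<^esub>]) \<subseteq> carrier R"
      using tup[OF xs] set_update_subset_insert[of xs i "\<one>\<^bsub>R\<^esub>"] by auto
    note c = cl[OF this]
    show "linear_map R (map (V R) al ! i) (V R 2) (\<lambda>y. foldr (\<otimes>\<^bsub>R\<^esub>) (xs[i := y]) \<one>\<^bsub>R\<^esub>)"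
    proof (rule linear_mapI)
      fix x assume x: "x \<in> carrier (map (V R) al ! i)"
      then have x': "x \<in> carrier R" using i by (auto intro: Vc)
      show "foldr (\<otimes>\<^bsub>R\<^esub>) (xs[i := x]) \<one>\<^bsub>R\<^esub> \<in> carrier (V R 2)"
        using upd[OF tup[OF xs] len x'] m_closed[OF x' c] by (simp add: V_simps)
      fix y assume "y \<in> carrier (map (V R) al ! i)"
      then have y': "y \<in> carrier R" using i by (auto intro: Vc)
      show "foldr (\<otimes>\<^bsub>R\<^esub>) (xs[i := x \<oplus>\<^bsub>map (V R) al ! i\<^esub> y]) \<one>\<^bsub>R\<^esub> =
        foldr (\<otimes>\<^bsub>R\<^esub>) (xs[i := x]) \<one>\<^bsub>R\<^esub> \<oplus>\<^bsub>V R 2\<^esub> foldr (\<otimes>\<^bsub>R\<^esub>) (xs[i := y]) \<one>\<^bsub>R\<^esub>"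
        using i upd[OF tup[OF xs] len x'] upd[OF tup[OF xs] len y'] upd[OF tup[OF xs] len a_closed[OF x' y']]
          l_distr[OF x' y' c] by (simp add: V_simps)
    next
      fix r x assume r: "r \<in> carrier R" and x: "x \<in> carrier (map (V R) al ! i)"
      then have x': "x \<in> carrier R" using i by (auto intro: Vc)
      show "foldr (\<otimes>\<^bsub>R\<^esub>) (xs[i := r \<odot>\<^bsub>map (V R) al ! i\<^esub> x]) \<one>\<^bsub>R\<^esub> =
        r \<odot>\<^bsub>V R 2\<^esub> foldr (\<otimes>\<^bsub>R\<^esub>) (xs[i := x]) \<one>\<^bsub>R\<^esub>"
        using i upd[OF tup[OF xs] len x'] upd[OF tup[OF xs] len m_closed[OF r x']] m_assoc[OF r x' c]
        by (simp add: V_simps)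
    qed
  qed
qed

definition unit_tensor :: "('r, 'x) ring_scheme \<Rightarrow> nat list \<Rightarrow> ('r list \<Rightarrow> 'r) set" where
  "unit_tensor R al = pure R (map (V R) al) (map (\<lambda>a. \<one>\<^bsub>R\<^esub>) al)"

context
  fixes R :: "('r, 'x) ring_scheme" and al :: "nat list"
  assumes R: "cring R" and al: "\<And>a. a \<in> set al \<Longrightarrow> 2 \<le> a"
begin

interpretation cring R by (rule R)

private abbreviation (input) "TV \<equiv> tensor R (map (V R) al)"

private lemma TV: "module R TV" by (rule module_tensor_arity[OF R module_V[OF R]])

private lemma ones: "map (\<lambda>a. \<one>\<^bsub>R\<^esub>) al \<in> tuples (map (V R) al)"
  using al by (auto simp: tuples_iff V_simps)

lemma unit_tensor_closed: "unit_tensor R al \<in> carrier TV"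
  unfolding unit_tensor_def by (rule pure_closed[OF R _ ones]) (auto simp: module_V[OF R])

lemma linear_unit_tensor: "linear_map R (V R 2) TV (\<lambda>c. c \<odot>\<^bsub>TV\<^esub> unit_tensor R al)"
proof -
  interpret T: module R TV by (rule TV)
  show ?thesis
    by (rule linear_mapI) (use unit_tensor_closed in \<open>auto simp: V_simps T.smult_l_distr T.smult_assoc1\<close>)
qed

text \<open>In arity at least two each factor is spanned by \<open>1\<close>, so multilinearity
  makes every pure tensor a multiple of the unit tensor.\<close>

lemma unit_tensor_generates:
  assumes "X \<in> carrier TV" shows "\<exists>c\<in>carrier R. X = c \<odot>\<^bsub>TV\<^esub> unit_tensor R al"
proof -
  interpret T: module R TV by (rule TV)
  let ?f = "\<lambda>c. c \<odot>\<^bsub>TV\<^esub> unit_tensor R al"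
  have VR: "module R M" if "M \<in> set (map (V R) al)" for M using that module_V[OF R] by auto
  have sub: "submodule (?f ` carrier R) R TV"
    using submodule_image[OF module_V[OF R] TV linear_unit_tensor module.carrier_is_submodule[OF module_V[OF R]]]
    by (simp add: V_simps)
  have "pure R (map (V R) al) xs \<in> ?f ` carrier R" if xs: "xs \<in> tuples (map (V R) al)" for xs
  proof (rule multilinear_span_subset[OF TV VR pure_multilinear[OF R VR] sub, where S = "\<lambda>_. {\<one>\<^bsub>R\<^esub>}"])
    show "length xs = length (map (V R) al)" using xs by (simp add: tuples_iff)
    fix i assume i: "i < length (map (V R) al)"
    then have ai: "2 \<le> al ! i" using al by simp
    then show one: "{\<one>\<^bsub>R\<^esub>} \<subseteq> carrier (map (V R) al ! i)" using i by (simp add: V_simps)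
    have xi: "xs ! i \<in> carrier R" using xs i ai by (auto simp: tuples_iff V_simps)
    have "xs ! i \<odot>\<^bsub>map (V R) al ! i\<^esub> \<one>\<^bsub>R\<^esub> \<in> module_span R (map (V R) al ! i) {\<one>\<^bsub>R\<^esub>}"
      using VR[OF nth_mem[OF i]] submodule_span[OF VR[OF nth_mem[OF i]] one] xi
      by (intro submoduleD(4)[of R "map (V R) al ! i"]) (use span_superset in fastforce)+
    then show "xs ! i \<in> module_span R (map (V R) al ! i) {\<one>\<^bsub>R\<^esub>}" using i xi by (simp add: V_simps)
  next
    fix xs assume "length xs = length (map (V R) al)" "\<And>i. i < length (map (V R) al) \<Longrightarrow> xs ! i \<in> {\<one>\<^bsub>R\<^esub>}"
    then have "xs = map (\<lambda>a. \<one>\<^bsub>R\<^esub>) al" by (intro nth_equalityI) auto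
    then have "pure R (map (V R) al) xs = ?f \<one>\<^bsub>R\<^esub>" using unit_tensor_closed by (simp add: unit_tensor_def)
    then show "pure R (map (V R) al) xs \<in> ?f ` carrier R" by blast
  qed
  then have "module_span R TV (pure R (map (V R) al) ` tuples (map (V R) al)) \<subseteq> ?f ` carrier R"
    by (intro span_least[OF sub]) auto
  moreover have "module_span R TV (pure R (map (V R) al) ` tuples (map (V R) al)) = carrier TV"
    by (rule tensor_span[OF R VR])
  ultimately show ?thesis using assms by auto
qed

text \<open>The product functional sends the unit tensor to \<open>1\<close> and thus recovers the
  coefficient.\<close>

lemma unit_tensor_inject:
  assumes "c \<in> carrier R" "c' \<in> carrier R" "c \<odot>\<^bsub>TV\<^esub> unit_tensor R al = c' \<odot>\<^bsub>TV\<^esub> unit_tensor R al"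
  shows "c = c'"
proof -
  interpret T: module R TV by (rule TV)
  let ?l = "tensor_lift R (V R 2) (\<lambda>xs. foldr (\<otimes>\<^bsub>R\<^esub>) xs \<one>\<^bsub>R\<^esub>)"
  have VR: "module R M" if "M \<in> set (map (V R) al)" for M using that module_V[OF R] by auto
  note lin = tensor_lift_linear[OF R VR module_V[OF R] multilinear_product[OF R]]
  have 1: "foldr (\<otimes>\<^bsub>R\<^esub>) (map (\<lambda>a. \<one>\<^bsub>R\<^esub>) zs) \<one>\<^bsub>R\<^esub> = \<one>\<^bsub>R\<^esub>" for zs :: "nat list" by (induction zs) auto
  have "?l (unit_tensor R al) = \<one>\<^bsub>R\<^esub>"
    unfolding unit_tensor_def
    using tensor_lift_pure[OF R VR module_V[OF R] multilinear_product[OF R] ones] 1 by simp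
  then have "?l (c \<odot>\<^bsub>TV\<^esub> unit_tensor R al) = c" if "c \<in> carrier R" for c
    using linear_mapD(3)[OF lin that unit_tensor_closed] that by (simp add: V_simps)
  then show ?thesis using assms by metis
qed

text \<open>Each factor is concentrated in one degree. If the total degree is different, some entry
  lies in a zero component and annihilates the tensor.\<close>

lemma tensor_deg_V:
  "tensor_deg R (map (V R) al) (map (V_deg R) al) p =
    (if p = (\<Sum>a\<leftarrow>al. int a - 2) then carrier TV else {\<zero>\<^bsub>TV\<^esub>})"
proof -
  interpret T: module R TV by (rule TV)
  have VR: "module R M" if "M \<in> set (map (V R) al)" for M using that module_V[OF R] by auto
  let ?S = "{pure R (map (V R) al) xs | xs ps. length xs = length (map (V R) al) \<and> length ps = length (map (V R) al) \<and>
    (\<forall>i<length (map (V R) al). xs ! i \<in> (map (V_deg R) al ! i) (ps ! i)) \<and> sum_list ps = p}"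
  have deg: "tensor_deg R (map (V R) al) (map (V_deg R) al) p = module_span R TV ?S"
    by (simp add: tensor_deg_def)
  have zero: "\<zero>\<^bsub>R\<^esub> \<in> carrier (V R n)" for n by (simp add: V_simps)
  have tup: "xs \<in> tuples (map (V R) al)"
    if "length xs = length al" "\<And>i. i < length al \<Longrightarrow> xs ! i \<in> V_deg R (al ! i) (ps ! i)" for xs ps
  proof -
    have "xs ! i \<in> carrier (V R (al ! i))" if "i < length al" for i
      using \<open>\<And>i. i < length al \<Longrightarrow> xs ! i \<in> V_deg R (al ! i) (ps ! i)\<close>[OF that] zero
      by (auto simp: V_deg_def split: if_splits)
    then show ?thesis using that(1) by (simp add: tuples_iff)
  qed
  have S: "?S \<subseteq> pure R (map (V R) al) ` tuples (map (V R) al)" using tup by auto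
  show ?thesis
  proof (cases "p = (\<Sum>a\<leftarrow>al. int a - 2)")
    case True
    have "pure R (map (V R) al) ` tuples (map (V R) al) \<subseteq> ?S"
    proof
      fix X assume "X \<in> pure R (map (V R) al) ` tuples (map (V R) al)"
      then obtain xs where xs: "xs \<in> tuples (map (V R) al)" "X = pure R (map (V R) al) xs" by auto
      show "X \<in> ?S"
        using xs True
        by (intro CollectI exI[of _ xs] exI[of _ "map (\<lambda>a. int a - 2) al"]) (auto simp: tuples_iff V_deg_def)
    qed
    then have "?S = pure R (map (V R) al) ` tuples (map (V R) al)" using S by blast
    moreover have "module_span R TV (pure R (map (V R) al) ` tuples (map (V R) al)) = carrier TV"
      by (rule tensor_span[OF R VR])
    ultimately show ?thesis unfolding deg using True by simp
  next
    case False
    have "X = \<zero>\<^bsub>TV\<^esub>" if "X \<in> ?S" for X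
    proof -
      obtain xs ps where X: "X = pure R (map (V R) al) xs" "length xs = length al" "length ps = length al"
        "\<And>i. i < length al \<Longrightarrow> xs ! i \<in> V_deg R (al ! i) (ps ! i)" "sum_list ps = p"
        using \<open>X \<in> ?S\<close> by auto
      have "\<exists>i<length al. ps ! i \<noteq> int (al ! i) - 2"
      proof (rule ccontr)
        assume "\<not> (\<exists>i<length al. ps ! i \<noteq> int (al ! i) - 2)"
        then have "ps = map (\<lambda>a. int a - 2) al" using X(3) by (intro nth_equalityI) auto
        then show False using False X(5) by simp
      qed
      then obtain i where i: "i < length al" "ps ! i \<noteq> int (al ! i) - 2" by blast
      then have "xs ! i = \<zero>\<^bsub>R\<^esub>" using X(4)[OF i(1)] by (simp add: V_deg_def)
      then show ?thesis
        unfolding X(1) using i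
        by (intro multilinear_zero[OF TV VR pure_multilinear[OF R VR] tup[OF X(2,4)], of i]) (auto simp: V_simps)
    qed
    then have S0: "?S \<subseteq> {\<zero>\<^bsub>TV\<^esub>}" by blast
    have "?S \<subseteq> carrier TV" by (rule subset_trans[OF S0]) simp
    note z = submoduleD(2)[OF TV submodule_span[OF TV this]]
    then have "module_span R TV ?S = {\<zero>\<^bsub>TV\<^esub>}"
      using span_least[OF submodule_zero[OF TV] S0] z by blast
    then show ?thesis unfolding deg using False by simp
  qed
qed

end

section \<open>Graded modules\<close>

definition part_sum :: "('r, 'a) module \<Rightarrow> (int \<Rightarrow> 'a) \<Rightarrow> 'a" where
  "part_sum M c = (\<Oplus>\<^bsub>M\<^esub>p\<in>{p. c p \<noteq> \<zero>\<^bsub>M\<^esub>}. c p)"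

lemma part_sum_superset:
  assumes "abelian_monoid M" "\<And>p. c p \<in> carrier M" "finite A" "{p. c p \<noteq> \<zero>\<^bsub>M\<^esub>} \<subseteq> A"
  shows "part_sum M c = (\<Oplus>\<^bsub>M\<^esub>p\<in>A. c p)"
proof -
  interpret abelian_monoid M by fact
  show ?thesis unfolding part_sum_def
    by (rule add.finprod_mono_neutral_cong_left) (use assms in auto)
qed

lemma part_sum_add:
  assumes "abelian_monoid M" "\<And>p. c p \<in> carrier M" "\<And>p. d p \<in> carrier M"
    "finite {p. c p \<noteq> \<zero>\<^bsub>M\<^esub>}" "finite {p. d p \<noteq> \<zero>\<^bsub>M\<^esub>}"
  shows "finite {p. c p \<oplus>\<^bsub>M\<^esub> d p \<noteq> \<zero>\<^bsub>M\<^esub>}"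
    and "part_sum M (\<lambda>p. c p \<oplus>\<^bsub>M\<^esub> d p) = part_sum M c \<oplus>\<^bsub>M\<^esub> part_sum M d"
proof -
  interpret abelian_monoid M by fact
  let ?A = "{p. c p \<noteq> \<zero>\<^bsub>M\<^esub>} \<union> {p. d p \<noteq> \<zero>\<^bsub>M\<^esub>}"
  have sub: "{p. c p \<oplus>\<^bsub>M\<^esub> d p \<noteq> \<zero>\<^bsub>M\<^esub>} \<subseteq> ?A" using assms(2,3) by auto
  have fin: "finite ?A" using assms(4,5) by simp
  show "finite {p. c p \<oplus>\<^bsub>M\<^esub> d p \<noteq> \<zero>\<^bsub>M\<^esub>}" by (rule finite_subset[OF sub fin])
  have "part_sum M (\<lambda>p. c p \<oplus>\<^bsub>M\<^esub> d p) = (\<Oplus>\<^bsub>M\<^esub>p\<in>?A. c p \<oplus>\<^bsub>M\<^esub> d p)"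
    by (rule part_sum_superset[OF assms(1) _ fin sub]) (use assms(2,3) in auto)
  also have "\<dots> = (\<Oplus>\<^bsub>M\<^esub>p\<in>?A. c p) \<oplus>\<^bsub>M\<^esub> (\<Oplus>\<^bsub>M\<^esub>p\<in>?A. d p)"
    using assms(2,3) by (intro finsum_addf) auto
  also have "(\<Oplus>\<^bsub>M\<^esub>p\<in>?A. c p) = part_sum M c"
    by (rule part_sum_superset[OF assms(1,2) fin, symmetric]) auto
  also have "(\<Oplus>\<^bsub>M\<^esub>p\<in>?A. d p) = part_sum M d"
    by (rule part_sum_superset[OF assms(1,3) fin, symmetric]) auto
  finally show "part_sum M (\<lambda>p. c p \<oplus>\<^bsub>M\<^esub> d p) = part_sum M c \<oplus>\<^bsub>M\<^esub> part_sum M d" .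
qed

lemma part_sum_linear:
  assumes "module R M" "module R N" "linear_map R M N f" "\<And>p. c p \<in> carrier M" "finite {p. c p \<noteq> \<zero>\<^bsub>M\<^esub>}"
  shows "finite {p. f (c p) \<noteq> \<zero>\<^bsub>N\<^esub>}" and "part_sum N (\<lambda>p. f (c p)) = f (part_sum M c)"
proof -
  interpret M: module R M by fact
  interpret N: module R N by fact
  have sub: "{p. f (c p) \<noteq> \<zero>\<^bsub>N\<^esub>} \<subseteq> {p. c p \<noteq> \<zero>\<^bsub>M\<^esub>}" using linear_map_zero[OF assms(1-3)] by auto
  show "finite {p. f (c p) \<noteq> \<zero>\<^bsub>N\<^esub>}" by (rule finite_subset[OF sub assms(5)])
  have "part_sum N (\<lambda>p. f (c p)) = (\<Oplus>\<^bsub>N\<^esub>p\<in>{p. c p \<noteq> \<zero>\<^bsub>M\<^esub>}. f (c p))"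
    by (rule part_sum_superset[OF N.abelian_monoid_axioms _ assms(5) sub])
      (rule linear_mapD(1)[OF assms(3,4)])
  then show "part_sum N (\<lambda>p. f (c p)) = f (part_sum M c)"
    using linear_map_finsum[OF assms(1-3), of c] assms(4) by (simp add: part_sum_def)
qed

lemma graded_moduleD:
  assumes "graded_module R M G"
  shows "module R M" "submodule (G p) R M"
  using assms by (auto simp: graded_module_def)

lemma homogeneous_parts_iff:
  "homogeneous_parts M G x c \<longleftrightarrow> (\<forall>p. c p \<in> G p) \<and> finite {p. c p \<noteq> \<zero>\<^bsub>M\<^esub>} \<and> part_sum M c = x"
  by (simp add: homogeneous_parts_def part_sum_def)

lemma homogeneous_parts_unique:
  assumes "graded_module R M G" "homogeneous_parts M G x c" "homogeneous_parts M G x c'"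
  shows "c = c'"
proof -
  interpret M: module R M by (rule graded_moduleD(1)[OF assms(1)])
  have "c p \<in> carrier M" for p
    using assms(2) submoduleD(1)[OF graded_moduleD[OF assms(1)]] by (auto simp: homogeneous_parts_iff)
  then have "x \<in> carrier M"
    using assms(2) by (auto simp: homogeneous_parts_def intro!: M.finsum_closed)
  then show ?thesis using assms by (metis (no_types) graded_module_def)
qed

text \<open>The decomposition is unique, so \<open>THE\<close> selects \<open>c\<close>. Changing
  signs preserves the support, hence the sum is again a \<open>part_sum\<close>.\<close>

lemma koszul_eq:
  assumes "graded_module R M G" "homogeneous_parts M G x c"
  shows "koszul M G x = part_sum M (\<lambda>p. if even p then c p else \<ominus>\<^bsub>M\<^esub> c p)"
proof -
  interpret M: module R M by (rule graded_moduleD(1)[OF assms(1)])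
  have "(THE c. homogeneous_parts M G x c) = c"
    using homogeneous_parts_unique[OF assms(1)] assms(2) by (intro the_equality) auto
  moreover have "c p \<in> carrier M" for p
    using assms(2) submoduleD(1)[OF graded_moduleD[OF assms(1)]] by (auto simp: homogeneous_parts_iff)
  then have "{p. (if even p then c p else \<ominus>\<^bsub>M\<^esub> c p) \<noteq> \<zero>\<^bsub>M\<^esub>} = {p. c p \<noteq> \<zero>\<^bsub>M\<^esub>}"
    by (auto split: if_splits)
  ultimately show ?thesis by (simp add: koszul_def part_sum_def)
qed

lemma graded_partsE:
  assumes "graded_module R M G" "x \<in> carrier M"
  obtains c where "homogeneous_parts M G x c" "\<And>p. c p \<in> carrier M"
    "finite {p. c p \<noteq> \<zero>\<^bsub>M\<^esub>}" "finite {p. (if even p then c p else \<ominus>\<^bsub>M\<^esub> c p) \<noteq> \<zero>\<^bsub>M\<^esub>}"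
proof -
  interpret M: module R M by (rule graded_moduleD(1)[OF assms(1)])
  obtain c where c: "homogeneous_parts M G x c" using assms by (auto simp: graded_module_def)
  have cM: "c p \<in> carrier M" for p
    using c submoduleD(1)[OF graded_moduleD[OF assms(1)]] by (auto simp: homogeneous_parts_iff)
  have fin: "finite {p. c p \<noteq> \<zero>\<^bsub>M\<^esub>}" using c by (simp add: homogeneous_parts_def)
  show ?thesis
    by (rule that[OF c cM fin]) (rule finite_subset[OF _ fin], use cM in \<open>auto split: if_splits\<close>)
qed

text \<open>By uniqueness, the decomposition of a sum or a multiple is the sum or multiple of the
  decompositions.\<close>

lemma koszul_linear:
  assumes g: "graded_module R M G" shows "linear_map R M M (koszul M G)"
proof (rule linear_mapI)
  interpret M: module R M by (rule graded_moduleD(1)[OF g])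
  note G = submoduleD[OF graded_moduleD[OF g]]
  let ?s = "\<lambda>c p. if even p then c p else \<ominus>\<^bsub>M\<^esub> c p"
  fix x assume x: "x \<in> carrier M"
  obtain c where c: "homogeneous_parts M G x c" "\<And>p. c p \<in> carrier M"
    "finite {p. c p \<noteq> \<zero>\<^bsub>M\<^esub>}" "finite {p. ?s c p \<noteq> \<zero>\<^bsub>M\<^esub>}" using graded_partsE[OF g x] by blast
  have sc: "?s c p \<in> carrier M" for p using c(2) by simp
  show "koszul M G x \<in> carrier M"
    unfolding koszul_eq[OF g c(1)] part_sum_def using sc by (intro M.finsum_closed) auto
  fix y assume y: "y \<in> carrier M"
  obtain d where d: "homogeneous_parts M G y d" "\<And>p. d p \<in> carrier M"
    "finite {p. d p \<noteq> \<zero>\<^bsub>M\<^esub>}" "finite {p. ?s d p \<noteq> \<zero>\<^bsub>M\<^esub>}" using graded_partsE[OF g y] by blast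
  have sd: "?s d p \<in> carrier M" for p using d(2) by simp
  have cd: "homogeneous_parts M G (x \<oplus>\<^bsub>M\<^esub> y) (\<lambda>p. c p \<oplus>\<^bsub>M\<^esub> d p)"
    using c(1) d(1) part_sum_add[OF M.abelian_monoid_axioms c(2) d(2) c(3) d(3)]
    by (auto simp: homogeneous_parts_iff intro: G(3))
  have "?s (\<lambda>p. c p \<oplus>\<^bsub>M\<^esub> d p) = (\<lambda>p. ?s c p \<oplus>\<^bsub>M\<^esub> ?s d p)"
    using c(2) d(2) by (auto simp: M.minus_add)
  then show "koszul M G (x \<oplus>\<^bsub>M\<^esub> y) = koszul M G x \<oplus>\<^bsub>M\<^esub> koszul M G y"
    unfolding koszul_eq[OF g cd] koszul_eq[OF g c(1)] koszul_eq[OF g d(1)]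
    using part_sum_add(2)[OF M.abelian_monoid_axioms sc sd c(4) d(4)] by simp
next
  interpret M: module R M by (rule graded_moduleD(1)[OF g])
  note G = submoduleD[OF graded_moduleD[OF g]]
  let ?s = "\<lambda>c p. if even p then c p else \<ominus>\<^bsub>M\<^esub> c p"
  fix r x assume r: "r \<in> carrier R" and x: "x \<in> carrier M"
  obtain c where c: "homogeneous_parts M G x c" "\<And>p. c p \<in> carrier M"
    "finite {p. c p \<noteq> \<zero>\<^bsub>M\<^esub>}" "finite {p. ?s c p \<noteq> \<zero>\<^bsub>M\<^esub>}" using graded_partsE[OF g x] by blast
  have sc: "?s c p \<in> carrier M" for p using c(2) by simp
  have lin: "linear_map R M M (\<lambda>x. r \<odot>\<^bsub>M\<^esub> x)"
    by (rule linear_map_smult[OF M.module_axioms linear_map_id r])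
  have rc: "homogeneous_parts M G (r \<odot>\<^bsub>M\<^esub> x) (\<lambda>p. r \<odot>\<^bsub>M\<^esub> c p)"
    using c(1) part_sum_linear[OF M.module_axioms M.module_axioms lin c(2,3)]
    by (auto simp: homogeneous_parts_iff intro: G(4)[OF r])
  have "?s (\<lambda>p. r \<odot>\<^bsub>M\<^esub> c p) = (\<lambda>p. r \<odot>\<^bsub>M\<^esub> ?s c p)"
    using c(2) r by (auto simp: M.smult_r_minus)
  then show "koszul M G (r \<odot>\<^bsub>M\<^esub> x) = r \<odot>\<^bsub>M\<^esub> koszul M G x"
    unfolding koszul_eq[OF g rc] koszul_eq[OF g c(1)]
    using part_sum_linear(2)[OF M.module_axioms M.module_axioms lin sc c(4)] by simp
qed

lemma koszul_homogeneous:
  assumes g: "graded_module R M G" and x: "x \<in> G p"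
  shows "koszul M G x = (if even p then x else \<ominus>\<^bsub>M\<^esub> x)"
proof -
  interpret M: module R M by (rule graded_moduleD(1)[OF g])
  note G = submoduleD[OF graded_moduleD[OF g]]
  let ?c = "\<lambda>q. if q = p then x else \<zero>\<^bsub>M\<^esub>"
  have xM: "x \<in> carrier M" by (rule G(1)[OF x])
  have single: "part_sum M (\<lambda>q. if q = p then y else \<zero>\<^bsub>M\<^esub>) = y" if "y \<in> carrier M" for y
    by (subst part_sum_superset[OF M.abelian_monoid_axioms, of _ "{p}"]) (use that in auto)
  have "finite {q. ?c q \<noteq> \<zero>\<^bsub>M\<^esub>}" by (rule finite_subset[of _ "{p}"]) auto
  then have "homogeneous_parts M G x ?c"
    unfolding homogeneous_parts_iff using x G(2) single[OF xM] by auto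
  moreover have "(\<lambda>q. if even q then ?c q else \<ominus>\<^bsub>M\<^esub> ?c q) =
    (\<lambda>q. if q = p then (if even p then x else \<ominus>\<^bsub>M\<^esub> x) else \<zero>\<^bsub>M\<^esub>)" by auto
  ultimately show ?thesis using koszul_eq[OF g] single[of "if even p then x else \<ominus>\<^bsub>M\<^esub> x"] xM by simp
qed

text \<open>The inverse of \<open>f\<close> is linear as well and maps \<open>H p\<close> into
  \<open>G p\<close>, so decompositions in \<open>N\<close> correspond to decompositions in
  \<open>M\<close>.\<close>

lemma graded_module_transport:
  assumes g: "graded_module R M G" and N: "module R N" and iso: "graded_iso R M G N H f"
  shows "graded_module R N H"
proof -
  have M: "module R M" by (rule graded_moduleD(1)[OF g])
  have f: "linear_map R M N f" "bij_betw f (carrier M) (carrier N)" "\<And>p. f ` G p = H p"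
    using iso by (auto simp: graded_iso_def)
  note G = submoduleD[OF graded_moduleD[OF g]]
  let ?i = "inv_into (carrier M) f"
  have i: "linear_map R N M ?i"
  proof (rule linear_mapI)
    interpret M: module R M by (rule M)
    have inv: "?i (f x) = x" if "x \<in> carrier M" for x by (rule bij_betw_inv_into_left[OF f(2) that])
    fix x assume "x \<in> carrier N"
    then obtain a where a: "a \<in> carrier M" "x = f a" using f(2) by (auto simp: bij_betw_def)
    show "?i x \<in> carrier M" using a inv by simp
    show "?i (r \<odot>\<^bsub>N\<^esub> x) = r \<odot>\<^bsub>M\<^esub> ?i x" if "r \<in> carrier R" for r
      using linear_mapD(3)[OF f(1) that a(1)] inv[OF M.smult_closed[OF that a(1)]] inv[OF a(1)] a(2) by simp
    fix y assume "y \<in> carrier N"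
    then obtain b where b: "b \<in> carrier M" "y = f b" using f(2) by (auto simp: bij_betw_def)
    show "?i (x \<oplus>\<^bsub>N\<^esub> y) = ?i x \<oplus>\<^bsub>M\<^esub> ?i y"
      using linear_mapD(2)[OF f(1) a(1) b(1)] inv[OF M.a_closed[OF a(1) b(1)]] inv[OF a(1)] inv[OF b(1)] a(2) b(2) by simp
  qed
  have fi: "f (?i y) = y" if "y \<in> carrier N" for y by (rule bij_betw_inv_into_right[OF f(2) that])
  have HE: "\<exists>a. a \<in> G p \<and> a \<in> carrier M \<and> x = f a" if "x \<in> H p" for x p
    using that G(1)[of _ p] unfolding f(3)[of p, symmetric] by auto
  have HN: "x \<in> carrier N" if x: "x \<in> H p" for x p
    using HE[OF x] linear_mapD(1)[OF f(1)] by auto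
  have Hi: "?i x \<in> G p" if x: "x \<in> H p" for x p
    using HE[OF x] bij_betw_inv_into_left[OF f(2)] by auto
  show ?thesis
    unfolding graded_module_def
  proof (intro conjI allI ballI)
    show "module R N" by (rule N)
    show "submodule (H p) R N" for p
      unfolding f(3)[symmetric] by (rule submodule_image[OF M N f(1) graded_moduleD(2)[OF g]])
    fix y assume y: "y \<in> carrier N"
    obtain c where c: "homogeneous_parts M G (?i y) c" "\<And>p. c p \<in> carrier M" "finite {p. c p \<noteq> \<zero>\<^bsub>M\<^esub>}"
      using graded_partsE[OF g linear_mapD(1)[OF i y]] by metis
    show "\<exists>!c. homogeneous_parts N H y c"
    proof (rule ex1I)
      have "\<And>p. f (c p) \<in> H p" using c(1) f(3) by (force simp: homogeneous_parts_iff)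
      then show "homogeneous_parts N H y (\<lambda>p. f (c p))"
        using c(1) part_sum_linear[OF M N f(1) c(2,3)] fi[OF y] by (simp add: homogeneous_parts_iff)
      fix d assume d: "homogeneous_parts N H y d"
      then have dN: "d p \<in> carrier N" "finite {p. d p \<noteq> \<zero>\<^bsub>N\<^esub>}" for p using HN by (auto simp: homogeneous_parts_iff)
      have "homogeneous_parts M G (?i y) (\<lambda>p. ?i (d p))"
        using d part_sum_linear[OF N M i dN] Hi by (simp add: homogeneous_parts_iff)
      then have "c = (\<lambda>p. ?i (d p))" by (rule homogeneous_parts_unique[OF g c(1)])
      then show "d = (\<lambda>p. f (c p))" using fi dN by auto
    qed
  qed
qed

lemma graded_module_concentrated:
  assumes M: "module R M" and G: "\<And>p. G p = (if p = q then carrier M else {\<zero>\<^bsub>M\<^esub>})"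
  shows "graded_module R M G"
  unfolding graded_module_def
proof (intro conjI allI ballI)
  interpret M: module R M by (rule M)
  show "submodule (G p) R M" for p
    unfolding G using submodule_zero[OF M] M.carrier_is_submodule by simp
  fix x assume x: "x \<in> carrier M"
  have ps: "part_sum M c = c q" if "\<And>p. p \<noteq> q \<Longrightarrow> c p = \<zero>\<^bsub>M\<^esub>" "c q \<in> carrier M" for c
  proof -
    have "c p \<in> carrier M" for p using that by (cases "p = q") auto
    then show ?thesis
      using part_sum_superset[OF M.abelian_monoid_axioms, of c "{q}"] that by auto
  qed
  show "\<exists>!c. homogeneous_parts M G x c"
  proof (rule ex1I)
    let ?c = "\<lambda>p. if p = q then x else \<zero>\<^bsub>M\<^esub>"
    have "finite {p. ?c p \<noteq> \<zero>\<^bsub>M\<^esub>}" by (rule finite_subset[of _ "{q}"]) auto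
    then show "homogeneous_parts M G x ?c"
      using ps[of ?c] x by (simp add: homogeneous_parts_iff G)
    fix c assume "homogeneous_parts M G x c"
    then have "\<forall>p. c p \<in> G p" "part_sum M c = x" by (auto simp: homogeneous_parts_iff)
    then have c: "\<And>p. p \<noteq> q \<Longrightarrow> c p = \<zero>\<^bsub>M\<^esub>" "c q \<in> carrier M"
      by (auto simp: G split: if_splits)
    show "c = ?c" using ps[of c] \<open>part_sum M c = x\<close> c by auto
  qed
qed (rule M)

section \<open>Integers as scalars\<close>

text \<open>The canonical ring homomorphism from the integers to \<open>R\<close>.\<close>

definition int_scalar :: "('r, 'x) ring_scheme \<Rightarrow> int \<Rightarrow> 'r" where
  "int_scalar R k = [k] \<cdot>\<^bsub>R\<^esub> \<one>\<^bsub>R\<^esub>"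

context cring
begin

lemma int_scalar_closed [simp]: "int_scalar R k \<in> carrier R"
  by (simp add: int_scalar_def)

lemma int_scalar_0 [simp]: "int_scalar R 0 = \<zero>"
  by (simp add: int_scalar_def add_pow_def int_pow_def2)

lemma int_scalar_1 [simp]: "int_scalar R 1 = \<one>"
  by (simp add: int_scalar_def add.int_pow_1)

lemma int_scalar_add: "int_scalar R (a + b) = int_scalar R a \<oplus> int_scalar R b"
  by (simp add: int_scalar_def add.int_pow_mult)

lemma int_scalar_mult: "int_scalar R (a * b) = int_scalar R a \<otimes> int_scalar R b"
  by (simp add: int_scalar_def add_pow_ldistr_int add.int_pow_pow mult.commute)

lemma int_scalar_minus: "int_scalar R (- a) = \<ominus> int_scalar R a"
  by (simp add: int_scalar_def add.int_pow_neg)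

lemma int_scalar_sum: "int_scalar R (sum f A) = (\<Oplus>a\<in>A. int_scalar R (f a))"
  by (induction A rule: infinite_finite_induct) (auto simp: int_scalar_add)

end

text \<open>\<open>cell_boundary\<close> uses integer multiples in the additive group; as scalar
  multiples they can be moved through linear and multilinear maps.\<close>

lemma (in module) add_pow_eq_smult:
  assumes x: "x \<in> carrier M" shows "[(k :: int)] \<cdot>\<^bsub>M\<^esub> x = int_scalar R k \<odot>\<^bsub>M\<^esub> x"
proof -
  have nat: "[int n] \<cdot>\<^bsub>M\<^esub> x = int_scalar R (int n) \<odot>\<^bsub>M\<^esub> x" for n
  proof (induction n)
    case (Suc n)
    have "[int (Suc n)] \<cdot>\<^bsub>M\<^esub> x = [int n] \<cdot>\<^bsub>M\<^esub> x \<oplus>\<^bsub>M\<^esub> x"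
      using M.add.int_pow_mult[OF x, of "int n" 1] x by (simp add: add.commute M.add.int_pow_1)
    then show ?case using Suc x by (simp add: int_scalar_add smult_l_distr add.commute M.a_comm)
  qed (use x in \<open>simp add: add_pow_def int_pow_def2\<close>)
  show ?thesis
  proof (cases "0 \<le> k")
    case True
    then show ?thesis using nat[of "nat k"] by simp
  next
    case False
    then have k: "k = - int (nat (- k))" by simp
    show ?thesis
      by (subst (1 2) k) (use nat[of "nat (- k)"] x in \<open>simp add: M.add.int_pow_neg int_scalar_minus smult_l_minus\<close>)
  qed
qed

section \<open>The complex of the permutohedron\<close>

text \<open>Since \<open>f\<close> is onto, the compatibility determines \<open>e\<close> on all of
  \<open>N\<close>. Applied to \<open>decorate\<close> it hands every property of the cellular
  boundary to \<open>permAs_diff\<close>.\<close>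

lemma dg_module_transport:
  assumes dg: "dg_module R M G d" and N: "module R N" and iso: "graded_iso R M G N H f"
    and e: "\<And>x. x \<in> carrier M \<Longrightarrow> e (f x) = f (d x)"
  shows "dg_module R N H e" and "dg_iso R M G d N H e f"
proof -
  have g: "graded_module R M G" and d: "linear_map R M M d" "\<And>p. d ` G p \<subseteq> G (p - 1)"
    "\<And>x. x \<in> carrier M \<Longrightarrow> d (d x) = \<zero>\<^bsub>M\<^esub>"
    using dg by (auto simp: dg_module_def)
  interpret M: module R M by (rule graded_moduleD(1)[OF g])
  have f: "linear_map R M N f" "f ` carrier M = carrier N" "\<And>p. f ` G p = H p"
    using iso by (auto simp: graded_iso_def bij_betw_def)
  note F = linear_mapD[OF f(1)] and D = linear_mapD[OF d(1)]
  have ex: "\<exists>a\<in>carrier M. x = f a" if "x \<in> carrier N" for x using that f(2) by auto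
  show dgN: "dg_module R N H e"
    unfolding dg_module_def
  proof (intro conjI allI ballI)
    show "graded_module R N H" by (rule graded_module_transport[OF g N iso])
    show "linear_map R N N e"
    proof (rule linear_mapI)
      fix x assume "x \<in> carrier N"
      then obtain a where a: "a \<in> carrier M" "x = f a" using ex by auto
      show "e x \<in> carrier N" using a e[OF a(1)] D(1)[OF a(1)] F(1) by simp
      show "e (r \<odot>\<^bsub>N\<^esub> x) = r \<odot>\<^bsub>N\<^esub> e x" if "r \<in> carrier R" for r
        using a e[OF a(1)] e[OF M.smult_closed[OF that a(1)]] F(3)[OF that a(1)] D(3)[OF that a(1)]
          F(3)[OF that D(1)[OF a(1)]] by simp
      fix y assume "y \<in> carrier N"
      then obtain b where b: "b \<in> carrier M" "y = f b" using ex by auto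
      show "e (x \<oplus>\<^bsub>N\<^esub> y) = e x \<oplus>\<^bsub>N\<^esub> e y"
        using a b e[OF a(1)] e[OF b(1)] e[OF M.a_closed[OF a(1) b(1)]] F(2)[OF a(1) b(1)] D(2)[OF a(1) b(1)]
          F(2)[OF D(1)[OF a(1)] D(1)[OF b(1)]] by simp
    qed
    show "e ` H p \<subseteq> H (p - 1)" for p
    proof
      fix y assume "y \<in> e ` H p"
      then obtain a where a: "a \<in> G p" "y = e (f a)" unfolding f(3)[symmetric] by auto
      have "y = f (d a)" using a e submoduleD(1)[OF graded_moduleD[OF g] a(1)] by simp
      then show "y \<in> H (p - 1)" unfolding f(3)[symmetric] using a(1) d(2)[of p] by auto
    qed
    fix x assume "x \<in> carrier N"
    then obtain a where a: "a \<in> carrier M" "x = f a" using ex by auto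
    show "e (e x) = \<zero>\<^bsub>N\<^esub>"
      using a e[OF a(1)] e[OF D(1)[OF a(1)]] d(3)[OF a(1)] linear_map_zero[OF M.module_axioms N f(1)] by simp
  qed
  then show "dg_iso R M G d N H e f" using dg iso e by (auto simp: dg_iso_def)
qed

text \<open>The fibres of a surjection are nonempty, so no vertex has an arity in which
  \<open>V\<close> vanishes.\<close>

lemma arity_list_ge: "t \<in> Surs n \<Longrightarrow> a \<in> set (arity_list t) \<Longrightarrow> 2 \<le> a"
  using count_list_pos[of t n] by (fastforce simp: arity_list_def)

definition cell_degree :: "nat list \<Rightarrow> int" where
  "cell_degree t = int (length t) - int (vertices t)"

lemma incidence_vertices:
  assumes "t \<in> Surs n" "incidence t u \<noteq> 0" shows "u \<in> Surs n" "vertices u = vertices t + 1"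
proof -
  obtain i s where i: "i < vertices t" and s: "s \<in> Sur (count_list t i) 2" "u = facet t i s"
  proof (rule ccontr)
    assume "\<not> thesis"
    then have "incidence t u = 0"
      using that unfolding incidence_def by (intro sum.neutral ballI) auto
    then show False using assms(2) by simp
  qed
  show "u \<in> Surs n" "vertices u = vertices t + 1"
    using facet_Surs[OF assms(1) i] vertices_facet[OF assms(1) i] s i by (auto simp: Sur_iff)
qed

section \<open>Cellular chains with coefficients in \<open>R\<close>\<close>

context
  fixes R :: "('r, 'x) ring_scheme" (structure)
  assumes R: "cring R"
begin

interpretation cring R by (rule R)

lemma module_perm_chains: "module R (perm_chains R n)"
  unfolding perm_chains_def by (rule module_free_module[OF R])

lemma perm_chains_app: "f \<in> carrier (perm_chains R n) \<Longrightarrow> f t \<in> carrier R"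
  unfolding perm_chains_def by (rule free_module_app[OF R])

lemma perm_chains_outside: "f \<in> carrier (perm_chains R n) \<Longrightarrow> t \<notin> Surs n \<Longrightarrow> f t = \<zero>"
  by (simp add: perm_chains_def free_module_carrier)

lemma perm_chains_carrier:
  "f \<in> carrier (perm_chains R n) \<longleftrightarrow> (\<forall>t\<in>Surs n. f t \<in> carrier R) \<and> (\<forall>t. t \<notin> Surs n \<longrightarrow> f t = \<zero>)"
  unfolding perm_chains_def free_module_carrier
  by (auto intro: finite_subset[OF _ finite_Surs[of n]])

lemma perm_chains_simps:
  "\<zero>\<^bsub>perm_chains R n\<^esub> = (\<lambda>s. \<zero>)" "f \<oplus>\<^bsub>perm_chains R n\<^esub> g = (\<lambda>s. f s \<oplus> g s)"
  "r \<odot>\<^bsub>perm_chains R n\<^esub> f = (\<lambda>s. r \<otimes> f s)"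
  by (simp_all add: perm_chains_def)

lemma finsum_perm_chains_app:
  "f \<in> A \<rightarrow> carrier (perm_chains R n) \<Longrightarrow> (\<Oplus>\<^bsub>perm_chains R n\<^esub>a\<in>A. f a) s = (\<Oplus>a\<in>A. f a s)"
  unfolding perm_chains_def by (rule finsum_free_module_app[OF R])

lemma basis_perm_chains: "t \<in> Surs n \<Longrightarrow> basis_elt R t \<in> carrier (perm_chains R n)"
  unfolding perm_chains_def by (rule basis_elt_closed[OF R])

lemma cell_boundary_closed: "t \<in> Surs n \<Longrightarrow> cell_boundary R t \<in> carrier (perm_chains R n)"
  and cell_boundary_app: "t \<in> Surs n \<Longrightarrow> cell_boundary R t u = int_scalar R (incidence t u)"
proof -
  assume t: "t \<in> Surs n"
  let ?C = "perm_chains R n"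
  interpret C: module R ?C by (rule module_perm_chains)
  have len: "length t = n" using t by (simp add: Surs_iff)
  have b: "basis_elt R (facet t i s) \<in> carrier ?C" if "i < vertices t" "s \<in> Sur (count_list t i) 2" for i s
    using facet_Surs[OF t that(1)] that(2) by (intro basis_perm_chains) (simp add: Sur_iff)
  have "cell_boundary R t = (\<Oplus>\<^bsub>?C\<^esub>i\<in>{..<vertices t}. \<Oplus>\<^bsub>?C\<^esub>s\<in>Sur (count_list t i) 2.
      [facet_coeff t i s] \<cdot>\<^bsub>?C\<^esub> basis_elt R (facet t i s))"
    by (simp add: cell_boundary_def facet_coeff_def facet_def corollas_def len)
  also have "\<dots> = (\<Oplus>\<^bsub>?C\<^esub>i\<in>{..<vertices t}. \<Oplus>\<^bsub>?C\<^esub>s\<in>Sur (count_list t i) 2.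
      int_scalar R (facet_coeff t i s) \<odot>\<^bsub>?C\<^esub> basis_elt R (facet t i s))"
    using b by (intro C.M.finsum_cong') (auto simp: C.add_pow_eq_smult intro!: C.M.finsum_cong' C.M.finsum_closed)
  finally have eq: "cell_boundary R t = \<dots>" .
  have inner: "(\<lambda>s. int_scalar R (facet_coeff t i s) \<odot>\<^bsub>?C\<^esub> basis_elt R (facet t i s)) \<in> Sur (count_list t i) 2 \<rightarrow> carrier ?C"
    if "i < vertices t" for i using b[OF that] by auto
  have outer: "(\<lambda>i. \<Oplus>\<^bsub>?C\<^esub>s\<in>Sur (count_list t i) 2. int_scalar R (facet_coeff t i s) \<odot>\<^bsub>?C\<^esub> basis_elt R (facet t i s))
    \<in> {..<vertices t} \<rightarrow> carrier ?C" using inner by (auto intro!: C.M.finsum_closed)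
  show "cell_boundary R t \<in> carrier ?C" unfolding eq using outer by (rule C.M.finsum_closed)
  have "cell_boundary R t u = (\<Oplus>i\<in>{..<vertices t}. \<Oplus>s\<in>Sur (count_list t i) 2.
      int_scalar R (facet_coeff t i s) \<otimes> basis_elt R (facet t i s) u)"
    unfolding eq finsum_perm_chains_app[OF outer]
  proof (rule finsum_cong'[OF refl])
    fix i assume "i \<in> {..<vertices t}"
    then show "(\<Oplus>\<^bsub>?C\<^esub>s\<in>Sur (count_list t i) 2. int_scalar R (facet_coeff t i s) \<odot>\<^bsub>?C\<^esub> basis_elt R (facet t i s)) u =
      (\<Oplus>s\<in>Sur (count_list t i) 2. int_scalar R (facet_coeff t i s) \<otimes> basis_elt R (facet t i s) u)"
      by (subst finsum_perm_chains_app[OF inner]) (simp_all add: perm_chains_simps)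
  qed (auto simp: basis_elt_def intro!: finsum_closed)
  also have "\<dots> = int_scalar R (incidence t u)"
    unfolding incidence_def int_scalar_sum
    by (intro finsum_cong') (auto simp: basis_elt_def intro!: finsum_cong' finsum_closed)
  finally show "cell_boundary R t u = int_scalar R (incidence t u)" .
qed

lemma linear_perm_boundary: "linear_map R (perm_chains R n) (perm_chains R n) (perm_boundary R n)"
  unfolding perm_boundary_def[abs_def]
proof (rule linear_map_sum[OF module_perm_chains module_perm_chains])
  interpret C: module R "perm_chains R n" by (rule module_perm_chains)
  fix t assume t: "t \<in> Surs n"
  note cb = cell_boundary_closed[OF t]
  show "linear_map R (perm_chains R n) (perm_chains R n) (\<lambda>f. f t \<odot>\<^bsub>perm_chains R n\<^esub> cell_boundary R t)"
  proof (rule linear_mapI)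
    fix f assume f: "f \<in> carrier (perm_chains R n)"
    note ft = perm_chains_app[OF f, of t]
    show "f t \<odot>\<^bsub>perm_chains R n\<^esub> cell_boundary R t \<in> carrier (perm_chains R n)" using ft cb by simp
    show "(r \<odot>\<^bsub>perm_chains R n\<^esub> f) t \<odot>\<^bsub>perm_chains R n\<^esub> cell_boundary R t =
      r \<odot>\<^bsub>perm_chains R n\<^esub> (f t \<odot>\<^bsub>perm_chains R n\<^esub> cell_boundary R t)" if "r \<in> carrier R" for r
      using C.smult_assoc1[OF that ft cb] by (simp add: perm_chains_simps(3)[of n _ f])
    fix g assume g: "g \<in> carrier (perm_chains R n)"
    show "(f \<oplus>\<^bsub>perm_chains R n\<^esub> g) t \<odot>\<^bsub>perm_chains R n\<^esub> cell_boundary R t =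
      f t \<odot>\<^bsub>perm_chains R n\<^esub> cell_boundary R t \<oplus>\<^bsub>perm_chains R n\<^esub> g t \<odot>\<^bsub>perm_chains R n\<^esub> cell_boundary R t"
      using C.smult_l_distr[OF ft perm_chains_app[OF g, of t] cb] by (simp add: perm_chains_simps(2)[of n f g])
  qed
qed

lemma perm_boundary_app:
  assumes f: "f \<in> carrier (perm_chains R n)"
  shows "perm_boundary R n f u = (\<Oplus>t\<in>Surs n. f t \<otimes> int_scalar R (incidence t u))"
proof -
  interpret C: module R "perm_chains R n" by (rule module_perm_chains)
  have "(\<lambda>t. f t \<odot>\<^bsub>perm_chains R n\<^esub> cell_boundary R t) \<in> Surs n \<rightarrow> carrier (perm_chains R n)"
    using perm_chains_app[OF f] cell_boundary_closed by auto
  then show ?thesis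
    unfolding perm_boundary_def
    by (subst finsum_perm_chains_app)
      (auto simp: perm_chains_simps cell_boundary_app perm_chains_app[OF f] intro!: finsum_cong')
qed

lemma perm_boundary_basis:
  assumes t: "t \<in> Surs n" shows "perm_boundary R n (basis_elt R t) = cell_boundary R t"
proof
  fix u
  have "(\<Oplus>s\<in>Surs n. basis_elt R t s \<otimes> int_scalar R (incidence s u)) = basis_elt R t t \<otimes> int_scalar R (incidence t u)"
    by (rule finsum_single) (use t in \<open>auto simp: basis_elt_def abelian_monoid_axioms\<close>)
  then show "perm_boundary R n (basis_elt R t) u = cell_boundary R t u"
    unfolding perm_boundary_app[OF basis_perm_chains[OF t]] cell_boundary_app[OF t] by (simp add: basis_elt_def)
qed

text \<open>On a basis cell the coefficients of the double boundary are images of the integral sums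
  in \<open>incidence_incidence\<close>.\<close>

lemma perm_boundary_square:
  assumes f: "f \<in> carrier (perm_chains R n)" shows "perm_boundary R n (perm_boundary R n f) = \<zero>\<^bsub>perm_chains R n\<^esub>"
proof -
  interpret C: module R "perm_chains R n" by (rule module_perm_chains)
  note lin = linear_perm_boundary[of n, unfolded perm_chains_def]
  note fm = module_free_module[OF R, of "Surs n"]
  have zero: "linear_map R (free_module R (Surs n)) (free_module R (Surs n)) (\<lambda>_. \<zero>\<^bsub>free_module R (Surs n)\<^esub>)"
    using module.axioms[OF fm] by (intro linear_mapI) (auto simp: free_module_carrier)
  have "perm_boundary R n (cell_boundary R t) = (\<lambda>s. \<zero>)" if t: "t \<in> Surs n" for t
  proof
    fix u
    show "perm_boundary R n (cell_boundary R t) u = \<zero>"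
    proof (cases "u \<in> Surs n")
      case True
      have "perm_boundary R n (cell_boundary R t) u = int_scalar R (\<Sum>v\<in>Surs n. incidence t v * incidence v u)"
        unfolding perm_boundary_app[OF cell_boundary_closed[OF t]] int_scalar_sum
        by (intro finsum_cong') (auto simp: cell_boundary_app[OF t] int_scalar_mult)
      then show ?thesis using incidence_incidence[OF t True] by simp
    next
      case False
      then show ?thesis
        using perm_chains_outside[OF linear_mapD(1)[OF linear_perm_boundary cell_boundary_closed[OF t]]] by simp
    qed
  qed
  then show ?thesis
    using linear_eq_on_basis[OF R fm linear_map_comp[OF lin lin] zero, of f] f
    by (simp add: perm_boundary_basis perm_chains_def)
qed

lemma perm_chains_deg_iff:
  "f \<in> perm_chains_deg R n p \<longleftrightarrow> f \<in> carrier (perm_chains R n) \<and> (\<forall>t\<in>Surs n. cell_degree t \<noteq> p \<longrightarrow> f t = \<zero>)"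
proof -
  have "int n - int (vertices t) = cell_degree t" if "t \<in> Surs n" for t
    using that by (simp add: cell_degree_def Surs_iff)
  then show ?thesis
    unfolding perm_chains_deg_def mem_Collect_eq using perm_chains_outside[of f n] by metis
qed

lemma submodule_perm_chains_deg: "submodule (perm_chains_deg R n p) R (perm_chains R n)"
proof -
  interpret C: module R "perm_chains R n" by (rule module_perm_chains)
  have minus: "(\<ominus>\<^bsub>perm_chains R n\<^esub> f) t = \<ominus> f t" if "f \<in> carrier (perm_chains R n)" for f t
  proof -
    have "(\<ominus> \<one>) \<odot>\<^bsub>perm_chains R n\<^esub> f = \<ominus>\<^bsub>perm_chains R n\<^esub> f"
      using that by (simp add: C.smult_l_minus)
    then have "(\<ominus>\<^bsub>perm_chains R n\<^esub> f) t = \<ominus> \<one> \<otimes> f t" by (metis perm_chains_simps(3))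
    then show ?thesis using perm_chains_app[OF that] by (simp add: l_minus)
  qed
  have 0: "(\<zero>\<^bsub>perm_chains R n\<^esub>) t = \<zero>" for t by (simp add: perm_chains_simps)
  have add: "(f \<oplus>\<^bsub>perm_chains R n\<^esub> g) t = f t \<oplus> g t" for f g t by (simp add: perm_chains_simps)
  have sm: "(r \<odot>\<^bsub>perm_chains R n\<^esub> f) t = r \<otimes> f t" for r f t by (simp add: perm_chains_simps)
  show ?thesis
    by (rule C.submoduleI) (auto simp: perm_chains_deg_iff minus 0 add sm)
qed

lemma graded_perm_chains: "graded_module R (perm_chains R n) (perm_chains_deg R n)"
  unfolding graded_module_def
proof (intro conjI allI ballI)
  let ?C = "perm_chains R n"
  interpret C: module R ?C by (rule module_perm_chains)
  show "module R ?C" by (rule module_perm_chains)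
  show "submodule (perm_chains_deg R n p) R ?C" for p by (rule submodule_perm_chains_deg)
  fix f assume f: "f \<in> carrier ?C"
  \<comment> \<open>A finite set containing every degree in which a family of homogeneous components
    can be nonzero, used as common index set of the sums.\<close>
  let ?A = "cell_degree ` Surs n"
  have supp: "{p. c p \<noteq> \<zero>\<^bsub>?C\<^esub>} \<subseteq> ?A" if "\<And>p. c p \<in> perm_chains_deg R n p" for c
  proof
    fix p assume "p \<in> {p. c p \<noteq> \<zero>\<^bsub>?C\<^esub>}"
    then obtain t where "c p t \<noteq> \<zero>" by (auto simp: perm_chains_simps)
    then show "p \<in> ?A" using \<open>\<And>p. c p \<in> perm_chains_deg R n p\<close>[of p] perm_chains_outside[of "c p" n t]
      by (metis perm_chains_deg_iff imageI)
  qed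
  have ps: "part_sum ?C c t = c (cell_degree t) t" if c: "\<And>p. c p \<in> perm_chains_deg R n p" and t: "t \<in> Surs n" for c t
  proof -
    have cC: "c p \<in> carrier ?C" for p using c[of p] by (simp add: perm_chains_deg_iff)
    have "part_sum ?C c t = (\<Oplus>p\<in>?A. c p t)"
      using part_sum_superset[OF C.M.abelian_monoid_axioms cC _ supp[OF c]] cC
      by (simp add: finsum_perm_chains_app)
    also have "\<dots> = c (cell_degree t) t"
      by (rule finsum_single) (use t c perm_chains_app[OF cC] in \<open>auto simp: abelian_monoid_axioms perm_chains_deg_iff\<close>)
    finally show ?thesis .
  qed
  have psC: "part_sum ?C c \<in> carrier ?C" if "\<And>p. c p \<in> perm_chains_deg R n p" for c
    unfolding part_sum_def using that by (intro C.M.finsum_closed) (auto simp: perm_chains_deg_iff)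
  show "\<exists>!c. homogeneous_parts ?C (perm_chains_deg R n) f c"
  proof (rule ex1I)
    let ?c = "\<lambda>p t. if cell_degree t = p then f t else \<zero>"
    have c: "?c p \<in> perm_chains_deg R n p" for p
      using f by (simp add: perm_chains_deg_iff perm_chains_carrier)
    have "part_sum ?C ?c = f"
    proof
      fix t
      show "part_sum ?C ?c t = f t"
        using ps[of ?c t, OF c] perm_chains_outside[OF f, of t] perm_chains_outside[OF psC[of ?c, OF c], of t]
        by (cases "t \<in> Surs n") auto
    qed
    then show "homogeneous_parts ?C (perm_chains_deg R n) f ?c"
      using c finite_subset[OF supp[of ?c, OF c]] by (simp add: homogeneous_parts_iff)
    fix d assume d: "homogeneous_parts ?C (perm_chains_deg R n) f d"
    then have dd: "d p \<in> perm_chains_deg R n p" for p by (simp add: homogeneous_parts_iff)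
    show "d = ?c"
    proof (intro ext)
      fix p t
      show "d p t = ?c p t"
      proof (cases "t \<in> Surs n")
        case True
        have "d (cell_degree t) t = f t" using ps[OF dd True] d by (simp add: homogeneous_parts_iff)
        then show ?thesis using dd[of p] True by (auto simp: perm_chains_deg_iff)
      next
        case False
        then show ?thesis using dd[of p] f by (simp add: perm_chains_deg_iff perm_chains_carrier)
      qed
    qed
  qed
qed

lemma perm_chains_deg_span:
  "perm_chains_deg R n p = module_span R (perm_chains R n) (basis_elt R ` {t \<in> Surs n. cell_degree t = p})"
proof
  let ?C = "perm_chains R n" and ?B = "basis_elt R ` {t \<in> Surs n. cell_degree t = p}"
  interpret C: module R ?C by (rule module_perm_chains)
  have B: "?B \<subseteq> perm_chains_deg R n p"
    using basis_perm_chains by (auto simp: perm_chains_deg_iff basis_elt_def)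
  then show "module_span R ?C ?B \<subseteq> perm_chains_deg R n p" by (rule span_least[OF submodule_perm_chains_deg])
  have BC: "?B \<subseteq> carrier ?C" using basis_perm_chains by auto
  note sm = submodule_span[OF C.module_axioms BC]
  show "perm_chains_deg R n p \<subseteq> module_span R ?C ?B"
  proof
    fix f assume f: "f \<in> perm_chains_deg R n p"
    then have fC: "f \<in> carrier ?C" by (simp add: perm_chains_deg_iff)
    have sub: "{s. f s \<noteq> \<zero>} \<subseteq> {t \<in> Surs n. cell_degree t = p}"
      using f perm_chains_outside[OF fC] by (auto simp: perm_chains_deg_iff)
    have fin: "finite {t \<in> Surs n. cell_degree t = p}" by simp
    have *: "f = (\<Oplus>\<^bsub>?C\<^esub>s\<in>{t \<in> Surs n. cell_degree t = p}. f s \<odot>\<^bsub>?C\<^esub> basis_elt R s)"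
      unfolding perm_chains_def
      by (rule free_module_expand[OF R fC[unfolded perm_chains_def] fin sub]) auto
    have "(\<Oplus>\<^bsub>?C\<^esub>s\<in>{t \<in> Surs n. cell_degree t = p}. f s \<odot>\<^bsub>?C\<^esub> basis_elt R s) \<in> module_span R ?C ?B"
      using span_superset[of ?B R ?C] perm_chains_app[OF fC]
      by (intro submodule_finsum[OF C.module_axioms sm] submoduleD(4)[OF C.module_axioms sm]) auto
    then show "f \<in> module_span R ?C ?B" by (rule ssubst[OF *])
  qed
qed

lemma dg_perm_chains: "dg_module R (perm_chains R n) (perm_chains_deg R n) (perm_boundary R n)"
  unfolding dg_module_def
proof (intro conjI allI ballI)
  show "perm_boundary R n ` perm_chains_deg R n p \<subseteq> perm_chains_deg R n (p - 1)" for p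
  proof (rule image_subsetI)
    fix f assume "f \<in> perm_chains_deg R n p"
    then have "f \<in> module_span R (perm_chains R n) (basis_elt R ` {t \<in> Surs n. cell_degree t = p})"
      by (simp add: perm_chains_deg_span)
    then show "perm_boundary R n f \<in> perm_chains_deg R n (p - 1)"
    proof (rule linear_span_subset[OF module_perm_chains module_perm_chains linear_perm_boundary submodule_perm_chains_deg, rotated -1])
      fix x assume "x \<in> basis_elt R ` {t \<in> Surs n. cell_degree t = p}"
      then obtain t where t: "t \<in> Surs n" "cell_degree t = p" "x = basis_elt R t" by auto
      have "cell_boundary R t u = \<zero>" if "u \<in> Surs n" "cell_degree u \<noteq> p - 1" for u
        using incidence_vertices[OF t(1), of u] that t(1,2)
        unfolding cell_boundary_app[OF t(1)] by (cases "incidence t u = 0") (auto simp: cell_degree_def Surs_iff)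
      then show "perm_boundary R n x \<in> perm_chains_deg R n (p - 1)"
        using cell_boundary_closed[OF t(1)] unfolding t(3) perm_boundary_basis[OF t(1)] perm_chains_deg_iff by auto
    qed (use basis_perm_chains in auto)
  qed
  show "graded_module R (perm_chains R n) (perm_chains_deg R n)" by (rule graded_perm_chains)
  show "linear_map R (perm_chains R n) (perm_chains R n) (perm_boundary R n)" by (rule linear_perm_boundary)
qed (rule perm_boundary_square)

section \<open>Decorated cells\<close>

lemma module_permAs: "module R (permAs R n)"
  unfolding permAs_def by (rule module_trees[OF R module_V[OF R]])

lemma decorate_eq:
  "decorate R n f = (\<lambda>t\<in>Surs (n - 1). f t \<odot>\<^bsub>tensor R (map (V R) (arity_list t))\<^esub> unit_tensor R (arity_list t))"
  by (simp add: decorate_def unit_tensor_def)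

lemma permAs_simps:
  "\<zero>\<^bsub>permAs R n\<^esub> = (\<lambda>t\<in>Surs (n - 1). \<zero>\<^bsub>tensor R (map (V R) (arity_list t))\<^esub>)"
  "carrier (permAs R n) = (\<Pi>\<^sub>E t\<in>Surs (n - 1). carrier (tensor R (map (V R) (arity_list t))))"
  "x \<oplus>\<^bsub>permAs R n\<^esub> y = (\<lambda>t\<in>Surs (n - 1). x t \<oplus>\<^bsub>tensor R (map (V R) (arity_list t))\<^esub> y t)"
  "r \<odot>\<^bsub>permAs R n\<^esub> x = (\<lambda>t\<in>Surs (n - 1). r \<odot>\<^bsub>tensor R (map (V R) (arity_list t))\<^esub> x t)"
  by (simp_all add: permAs_def trees_def sum_module_simps)

lemma linear_decorate: "linear_map R (perm_chains R (n - 1)) (permAs R n) (decorate R n)"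
proof -
  have m: "module R (tensor R (map (V R) al))" for al by (rule module_tensor_arity[OF R module_V[OF R]])
  have u: "unit_tensor R (arity_list t) \<in> carrier (tensor R (map (V R) (arity_list t)))" if "t \<in> Surs (n - 1)" for t
    by (rule unit_tensor_closed[OF R arity_list_ge[OF that]])
  show ?thesis
    by (rule linear_mapI)
      (auto simp: decorate_eq permAs_simps perm_chains_simps perm_chains_app u module.smult_closed[OF m]
        module.smult_l_distr[OF m] module.smult_assoc1[OF m] simp del: One_nat_def intro!: restrict_ext)
qed

text \<open>In each summand this is freeness of rank one: \<open>unit_tensor_inject\<close> gives
  injectivity and \<open>unit_tensor_generates\<close> surjectivity.\<close>

lemma bij_decorate: "bij_betw (decorate R n) (carrier (perm_chains R (n - 1))) (carrier (permAs R n))"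
proof (rule bij_betw_imageI)
  let ?T = "\<lambda>t. tensor R (map (V R) (arity_list t))"
  show "inj_on (decorate R n) (carrier (perm_chains R (n - 1)))"
  proof (rule inj_onI)
    fix f g assume f: "f \<in> carrier (perm_chains R (n - 1))" and g: "g \<in> carrier (perm_chains R (n - 1))"
      and eq: "decorate R n f = decorate R n g"
    show "f = g"
    proof
      fix t
      show "f t = g t"
      proof (cases "t \<in> Surs (n - 1)")
        case True
        then show ?thesis
          using unit_tensor_inject[OF R, of "arity_list t" "f t" "g t"] arity_list_ge[OF True]
            perm_chains_app[OF f] perm_chains_app[OF g] fun_cong[OF eq, of t] by (simp add: decorate_eq)
      next
        case False
        then show ?thesis using f g by (simp add: perm_chains_outside)
      qed
    qed
  qed
  show "decorate R n ` carrier (perm_chains R (n - 1)) = carrier (permAs R n)"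
  proof
    show "decorate R n ` carrier (perm_chains R (n - 1)) \<subseteq> carrier (permAs R n)"
      using linear_mapD(1)[OF linear_decorate] by auto
    show "carrier (permAs R n) \<subseteq> decorate R n ` carrier (perm_chains R (n - 1))"
    proof
      fix x assume x: "x \<in> carrier (permAs R n)"
      have "\<exists>c\<in>carrier R. x t = c \<odot>\<^bsub>?T t\<^esub> unit_tensor R (arity_list t)" if "t \<in> Surs (n - 1)" for t
        using unit_tensor_generates[OF R, of "arity_list t" "x t"] arity_list_ge[OF that] x that by (auto simp: permAs_simps)
      then obtain c where c: "\<And>t. t \<in> Surs (n - 1) \<Longrightarrow> c t \<in> carrier R \<and> x t = c t \<odot>\<^bsub>?T t\<^esub> unit_tensor R (arity_list t)"
        by metis
      let ?f = "\<lambda>t. if t \<in> Surs (n - 1) then c t else \<zero>"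
      have "?f \<in> carrier (perm_chains R (n - 1))" using c by (simp add: perm_chains_carrier)
      moreover have "x = decorate R n ?f"
        using c x by (auto simp: decorate_eq permAs_simps PiE_iff extensional_def restrict_def fun_eq_iff)
      ultimately show "x \<in> decorate R n ` carrier (perm_chains R (n - 1))" by blast
    qed
  qed
qed

text \<open>Both sides require vanishing at the cells of another dimension, and a decorated chain
  vanishes at a cell if and only if the chain does.\<close>

lemma decorate_deg: "decorate R n ` perm_chains_deg R (n - 1) p = permAs_deg R n p"
proof
  let ?T = "\<lambda>t. tensor R (map (V R) (arity_list t))"
  have m: "module R (?T t)" for t by (rule module_tensor_arity[OF R module_V[OF R]])
  have deg: "tensor_deg R (map (V R) (arity_list t)) (map (V_deg R) (arity_list t)) p =
    (if p = cell_degree t then carrier (?T t) else {\<zero>\<^bsub>?T t\<^esub>})" if "t \<in> Surs (n - 1)" for t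
    using tensor_deg_V[OF R, of "arity_list t" p] arity_list_ge[OF that] sum_list_arity[OF that] that
    by (simp add: cell_degree_def Surs_iff)
  have zero: "\<zero>\<^bsub>?T t\<^esub> \<in> carrier (?T t)" for t
    using submoduleD(2)[OF m module.carrier_is_submodule[OF m]] .
  have iff: "x \<in> permAs_deg R n p \<longleftrightarrow>
    x \<in> carrier (permAs R n) \<and> (\<forall>t\<in>Surs (n - 1). cell_degree t \<noteq> p \<longrightarrow> x t = \<zero>\<^bsub>?T t\<^esub>)" for x
    unfolding permAs_deg_def trees_deg_def permAs_simps PiE_iff using deg zero by (auto split: if_splits)
  have u: "unit_tensor R (arity_list t) \<in> carrier (?T t)" if "t \<in> Surs (n - 1)" for t
    by (rule unit_tensor_closed[OF R arity_list_ge[OF that]])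
  have f0: "decorate R n f t = \<zero>\<^bsub>?T t\<^esub> \<longleftrightarrow> f t = \<zero>"
    if "f \<in> carrier (perm_chains R (n - 1))" "t \<in> Surs (n - 1)" for f t
  proof -
    have "\<zero> \<odot>\<^bsub>?T t\<^esub> unit_tensor R (arity_list t) = \<zero>\<^bsub>?T t\<^esub>"
      by (rule module.smult_l_null[OF m u[OF that(2)]])
    then show ?thesis
      using unit_tensor_inject[OF R, of "arity_list t" "f t" \<zero>] arity_list_ge[OF that(2)]
        perm_chains_app[OF that(1)] that(2) by (auto simp: decorate_eq)
  qed
  show "decorate R n ` perm_chains_deg R (n - 1) p \<subseteq> permAs_deg R n p"
    using f0 linear_mapD(1)[OF linear_decorate] by (auto simp: iff perm_chains_deg_iff)
  show "permAs_deg R n p \<subseteq> decorate R n ` perm_chains_deg R (n - 1) p"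
  proof
    fix x assume x: "x \<in> permAs_deg R n p"
    then have "x \<in> carrier (permAs R n)" by (simp add: iff)
    then obtain f where f: "f \<in> carrier (perm_chains R (n - 1))" "x = decorate R n f"
      using bij_decorate[of n] by (auto simp: bij_betw_def)
    then have "f \<in> perm_chains_deg R (n - 1) p" using x f0[OF f(1)] by (auto simp: iff perm_chains_deg_iff)
    then show "x \<in> decorate R n ` perm_chains_deg R (n - 1) p" using f(2) by blast
  qed
qed

lemma graded_iso_decorate:
  "graded_iso R (perm_chains R (n - 1)) (perm_chains_deg R (n - 1)) (permAs R n) (permAs_deg R n) (decorate R n)"
  using linear_decorate bij_decorate decorate_deg by (simp add: graded_iso_def)

lemma permAs_diff_decorate:
  "f \<in> carrier (perm_chains R (n - 1)) \<Longrightarrow> permAs_diff R n (decorate R n f) = decorate R n (perm_boundary R (n - 1) f)"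
  by (simp add: permAs_diff_def bij_betw_inv_into_left[OF bij_decorate] del: One_nat_def)

lemma dg_permAs:
  "dg_module R (permAs R n) (permAs_deg R n) (permAs_diff R n)"
  "dg_iso R (perm_chains R (n - 1)) (perm_chains_deg R (n - 1)) (perm_boundary R (n - 1))
    (permAs R n) (permAs_deg R n) (permAs_diff R n) (decorate R n)"
  by (rule dg_module_transport[OF dg_perm_chains module_permAs graded_iso_decorate]; erule permAs_diff_decorate)+

end

section \<open>Scaling and differentiating the slots of a multilinear map\<close>

lemma linear_image_span:
  assumes "module R M" "module R N" "linear_map R M N f" "S \<subseteq> carrier M"
  shows "f ` module_span R M S = module_span R N (f ` S)"
proof
  have fS: "f ` S \<subseteq> carrier N" using assms(4) linear_mapD(1)[OF assms(3)] by auto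
  show "f ` module_span R M S \<subseteq> module_span R N (f ` S)"
    using linear_span_subset[OF assms(1-3) submodule_span[OF assms(2) fS] assms(4)] span_superset[of "f ` S" R N] by blast
  show "module_span R N (f ` S) \<subseteq> f ` module_span R M S"
    using span_superset[of S R M]
    by (intro span_least submodule_image[OF assms(1-3)] submodule_span[OF assms(1,4)] image_mono)
qed

text \<open>Collects the Koszul signs of the slots before a given one into a single sign.\<close>

lemma multilinear_scale:
  assumes "cring R" "module R N" "\<And>M. M \<in> set Ms \<Longrightarrow> module R M" "multilinear R Ms N f" "xs \<in> tuples Ms"
    and "i \<le> length Ms"
  shows "f (map (\<lambda>j. if j < i then int_scalar R (e j) \<odot>\<^bsub>Ms ! j\<^esub> (xs ! j) else xs ! j) [0..<length Ms]) =
    int_scalar R (\<Prod>j<i. e j) \<odot>\<^bsub>N\<^esub> f xs"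
  using assms(6)
proof (induction i)
  interpret cring R by fact
  interpret N: module R N by fact
  let ?l = "\<lambda>i. map (\<lambda>j. if j < i then int_scalar R (e j) \<odot>\<^bsub>Ms ! j\<^esub> (xs ! j) else xs ! j) [0..<length Ms]"
  have len: "length xs = length Ms" using assms(5) by (simp add: tuples_iff)
  have tup: "?l i \<in> tuples Ms" for i
    using assms(5) module.smult_closed[OF assms(3)[OF nth_mem]] by (auto simp: tuples_iff)
  note cl = multilinear_closed[OF assms(4,5)]
  {
    case 0
    have "?l 0 = xs" using len by (intro nth_equalityI) auto
    then show ?case using cl by simp
  next
    case (Suc i)
    then have i: "i < length Ms" by simp
    have xi: "xs ! i \<in> carrier (Ms ! i)" using assms(5) i by (simp add: tuples_iff)
    have 1: "?l (Suc i) = (?l i)[i := int_scalar R (e i) \<odot>\<^bsub>Ms ! i\<^esub> xs ! i]"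
      using i by (intro nth_equalityI) (auto simp: nth_list_update less_Suc_eq)
    have 2: "(?l i)[i := xs ! i] = ?l i"
      using i by (intro nth_equalityI) (auto simp: nth_list_update)
    have "f (?l (Suc i)) = int_scalar R (e i) \<odot>\<^bsub>N\<^esub> f ((?l i)[i := xs ! i])"
      unfolding 1 by (rule linear_mapD(3)[OF multilinear_linear[OF assms(4) tup i] int_scalar_closed xi])
    also note 2
    also have "f (?l i) = int_scalar R (\<Prod>j<i. e j) \<odot>\<^bsub>N\<^esub> f xs" using Suc.IH i by simp
    finally show ?case
      unfolding prod.lessThan_Suc mult.commute[of "prod e {..<i}"] int_scalar_mult
      using N.smult_assoc1[OF int_scalar_closed int_scalar_closed cl] by simp
  }
qed

text \<open>The map \<open>f\<close> is arbitrary so as to cover \<open>pure\<close>, which yields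
  the tensor differential, and the permutad composition, which yields its image under the structure
  map.\<close>

lemma multilinear_tensor_diff:
  assumes "cring R" "\<And>M. M \<in> set Ms \<Longrightarrow> module R M" "length Gs = length Ms" "length ds = length Ms"
    and K: "\<And>i. i < length Ms \<Longrightarrow> linear_map R (Ms ! i) (Ms ! i) (koszul (Ms ! i) (Gs ! i))"
    and d: "\<And>i. i < length Ms \<Longrightarrow> linear_map R (Ms ! i) (Ms ! i) (ds ! i)"
    and N: "module R N" and f: "multilinear R Ms N f"
  shows "multilinear R Ms N (\<lambda>xs. f (map (\<lambda>j. if j < i then koszul (Ms ! j) (Gs ! j) (xs ! j)
      else if j = i then (ds ! j) (xs ! j) else xs ! j) [0..<length Ms]))"
proof -
  have "multilinear R Ms N (\<lambda>xs. f (map (\<lambda>j. (if j < i then koszul (Ms ! j) (Gs ! j)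
      else if j = i then ds ! j else (\<lambda>x. x)) (xs ! j)) [0..<length Ms]))"
    by (rule multilinear_map[OF f refl]) (use K d linear_map_id in auto)
  moreover have "map (\<lambda>j. (if j < i then koszul (Ms ! j) (Gs ! j) else if j = i then ds ! j else (\<lambda>x. x)) (xs ! j)) [0..<length Ms] =
    map (\<lambda>j. if j < i then koszul (Ms ! j) (Gs ! j) (xs ! j) else if j = i then (ds ! j) (xs ! j) else xs ! j) [0..<length Ms]" for xs
    by (rule map_cong) auto
  ultimately show ?thesis by simp
qed

section \<open>The permutad structure\<close>

context
  fixes R :: "('r, 'x) ring_scheme" (structure)
  assumes R: "cring R"
begin

interpretation cring R by (rule R)

text \<open>The cell with all vertices decorated by generators \<open>m\<close>. Its arity is read
  off the word, so that lists of these elements can be formed by \<open>map\<close> although their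
  arities differ.\<close>

definition cell_gen :: "nat list \<Rightarrow> nat list \<Rightarrow> ('r list \<Rightarrow> 'r) set" where
  "cell_gen s = decorate R (length s + 1) (basis_elt R s)"

lemma gen_eq: "s \<in> Surs m \<Longrightarrow> cell_gen s = decorate R (m + 1) (basis_elt R s)"
  by (simp add: cell_gen_def Surs_iff)

lemma gen_closed: "s \<in> Surs m \<Longrightarrow> cell_gen s \<in> carrier (permAs R (m + 1))"
  unfolding gen_eq using linear_mapD(1)[OF linear_decorate[OF R, of "m + 1"]] basis_perm_chains[OF R, of s m] by simp

lemma gen_app:
  assumes s: "s \<in> Surs m" and t: "t \<in> Surs m"
  shows "cell_gen s t = (if t = s then unit_tensor R (arity_list s) else \<zero>\<^bsub>tensor R (map (V R) (arity_list t))\<^esub>)"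
proof -
  interpret T: module R "tensor R (map (V R) (arity_list t))" by (rule module_tensor_arity[OF R module_V[OF R]])
  have u: "unit_tensor R (arity_list t) \<in> carrier (tensor R (map (V R) (arity_list t)))"
    by (rule unit_tensor_closed[OF R arity_list_ge[OF t]])
  show ?thesis
    unfolding gen_eq[OF s] decorate_eq[OF R]
    using t T.smult_one[OF u] T.smult_l_null[OF u] by (cases "t = s") (simp_all add: basis_elt_def)
qed

text \<open>Formulated for an arbitrary set of cells in order to give generators both of the whole
  module and of each degree.\<close>

lemma span_gen:
  assumes "S \<subseteq> Surs m"
  shows "module_span R (permAs R (m + 1)) (cell_gen ` S) =
    decorate R (m + 1) ` module_span R (perm_chains R m) (basis_elt R ` S)"
proof -
  have "cell_gen ` S = decorate R (m + 1) ` basis_elt R ` S"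
    unfolding image_image using assms by (intro image_cong[OF refl gen_eq]) auto
  moreover have "basis_elt R ` S \<subseteq> carrier (perm_chains R m)" using assms basis_perm_chains[OF R] by auto
  ultimately show ?thesis
    using linear_image_span[OF module_perm_chains[OF R] module_permAs[OF R] linear_decorate[OF R, of "m + 1"], of "basis_elt R ` S"]
    by simp
qed

lemma permAs_span: "carrier (permAs R (m + 1)) = module_span R (permAs R (m + 1)) (cell_gen ` Surs m)"
  unfolding span_gen[OF subset_refl] using bij_decorate[OF R, of "m + 1"]
  by (simp add: bij_betw_def perm_chains_def span_basis[OF R])

lemma permAs_deg_span:
  "permAs_deg R (m + 1) p = module_span R (permAs R (m + 1)) (cell_gen ` {s \<in> Surs m. cell_degree s = p})"
proof -
  have "{s \<in> Surs m. cell_degree s = p} \<subseteq> Surs m" by auto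
  from span_gen[OF this] show ?thesis
    using decorate_deg[OF R, of "m + 1" p] by (simp add: perm_chains_deg_span[OF R])
qed

lemma multilinear_permAs_comp:
  "t \<in> Surs n \<Longrightarrow> multilinear R (map (permAs R) (arity_list t)) (permAs R (n + 1)) (permAs_comp R t)"
  unfolding permAs_def permAs_comp_def by (rule multilinear_trees_comp[OF R module_V[OF R]])

text \<open>In the sum defining the composition, a family \<open>ts'\<close> different from
  \<open>ts\<close> evaluates some generator at a foreign cell, where it vanishes. Only
  \<open>ts\<close> itself survives, and concatenating unit tensors gives the unit tensor.\<close>

lemma permAs_comp_gen:
  assumes t: "t \<in> Surs n" and ts: "substitutable t ts"
  shows "permAs_comp R t (map cell_gen ts) = cell_gen (sur_subst t ts)"
proof
  fix u
  let ?T = "\<lambda>u. tensor R (map (V R) (arity_list u))" and ?Ls = "map (\<lambda>s. map (V R) (arity_list s))"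
  let ?g = "\<lambda>ts'. tensor_concat R (?Ls ts') (map2 (\<lambda>x s. x s) (map cell_gen ts) ts')"
  let ?A = "{ts'. substitutable t ts' \<and> sur_subst t ts' = u}"
  have len: "length t = n" "length ts = vertices t" using t substitutableD(1)[OF ts] by (auto simp: Surs_iff)
  have Tm: "module R (?T u)" for u by (rule module_tensor_arity[OF R module_V[OF R]])
  interpret T: module R "?T u" by (rule Tm)
  have us: "sur_subst t ts \<in> Surs n" by (rule sur_subst_Surs[OF t ts])
  have VR: "module R M" if "L \<in> set (?Ls ts')" "M \<in> set L" for L M ts' using that module_V[OF R] by auto
  have cc: "tensor R (concat (?Ls ts')) = ?T (sur_subst t ts')" if "substitutable t ts'" for ts'
    unfolding arity_list_sur_subst[OF t that] by (simp add: map_concat comp_def)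
  show "permAs_comp R t (map cell_gen ts) u = cell_gen (sur_subst t ts) u"
  proof (cases "u \<in> Surs n")
    case u: True
    have zero: "?g ts' = \<zero>\<^bsub>?T u\<^esub>" if ts': "ts' \<in> ?A" "ts' \<noteq> ts" for ts'
    proof -
      have s: "substitutable t ts'" "sur_subst t ts' = u" "length ts' = vertices t"
        using ts'(1) substitutableD(1)[of t ts'] by auto
      obtain j where j: "j < vertices t" "ts' ! j \<noteq> ts ! j" using ts'(2) s(3) len(2) by (metis nth_equalityI)
      have entry: "cell_gen (ts ! i) (ts' ! i) = (if ts' ! i = ts ! i then unit_tensor R (arity_list (ts ! i)) else \<zero>\<^bsub>?T (ts' ! i)\<^esub>)"
        if "i < vertices t" for i
        by (rule gen_app[OF substitutableD(2)[OF ts that] substitutableD(2)[OF s(1) that]])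
      have "cell_gen (ts ! i) (ts' ! i) \<in> carrier (?T (ts' ! i))" if i: "i < vertices t" for i
      proof -
        interpret Ti: module R "?T (ts' ! i)" by (rule Tm)
        show ?thesis
          unfolding entry[OF i] using unit_tensor_closed[OF R arity_list_ge[OF substitutableD(2)[OF ts i]]] by auto
      qed
      then have tup: "map2 (\<lambda>x s. x s) (map cell_gen ts) ts' \<in> tuples (map (tensor R) (?Ls ts'))"
        using s(3) len(2) by (simp add: tuples_iff)
      show ?thesis
        unfolding s(2)[symmetric] cc[OF s(1), symmetric]
        by (rule multilinear_zero[OF _ _ multilinear_tensor_concat[OF R VR] tup, where i = j])
          (use j s(3) len(2) entry[OF j(1)] Tm[of "sur_subst t ts'"] cc[OF s(1)] in \<open>auto intro: Tm\<close>)
    qed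
    have unit: "?g ts = unit_tensor R (arity_list (sur_subst t ts))"
    proof -
      let ?xss = "map (\<lambda>s. map (\<lambda>a. \<one>) (arity_list s)) ts"
      have eq: "map2 (\<lambda>x s. x s) (map cell_gen ts) ts = map2 (pure R) (?Ls ts) ?xss"
        using len(2) gen_app[OF substitutableD(2)[OF ts] substitutableD(2)[OF ts]]
        by (intro nth_equalityI) (auto simp: unit_tensor_def)
      have tup: "list_all2 (\<lambda>xs L. xs \<in> tuples L) ?xss (?Ls ts)"
        using count_list_pos[OF substitutableD(2)[OF ts]] len(2)
        by (auto simp: list_all2_conv_all_nth tuples_iff V_simps Suc_le_eq)
      have "?g ts = pure R (concat (?Ls ts)) (concat ?xss)"
        unfolding eq by (rule conjunct1[OF tensor_concat_pure[OF R VR tup]])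
      also have "\<dots> = unit_tensor R (arity_list (sur_subst t ts))"
        unfolding unit_tensor_def arity_list_sur_subst[OF t ts] by (simp add: map_concat comp_def)
      finally show ?thesis .
    qed
    have comp: "permAs_comp R t (map cell_gen ts) u = (\<Oplus>\<^bsub>?T u\<^esub>ts'\<in>?A. ?g ts')"
      using u len by (simp add: permAs_comp_def trees_comp_def)
    show ?thesis
    proof (cases "u = sur_subst t ts")
      case True
      have "(\<Oplus>\<^bsub>?T u\<^esub>ts'\<in>?A. ?g ts') = ?g ts"
      proof (rule finsum_single[OF T.M.abelian_monoid_axioms])
        show "finite ?A" by (rule finite_subset[OF _ finite_substitutable[of t]]) auto
        show "?g ts \<in> carrier (?T u)"
          unfolding unit using unit_tensor_closed[OF R arity_list_ge[OF us]] True by simp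
      qed (use True ts zero in auto)
      then show ?thesis unfolding comp unit using gen_app[OF us u] True by simp
    next
      case False
      then have "?g ts' = \<zero>\<^bsub>?T u\<^esub>" if "ts' \<in> ?A" for ts' using zero[OF that] that by auto
      then have "(\<Oplus>\<^bsub>?T u\<^esub>ts'\<in>?A. ?g ts') = (\<Oplus>\<^bsub>?T u\<^esub>ts'\<in>?A. \<zero>\<^bsub>?T u\<^esub>)"
        by (intro T.M.finsum_cong') auto
      then show ?thesis unfolding comp using gen_app[OF us u] False by simp
    qed
  next
    \<comment> \<open>Outside \<open>Surs n\<close> both sides are extensional functions and take
      the value \<open>undefined\<close>.\<close>
    case False
    then show ?thesis
      using len us by (simp add: permAs_comp_def trees_comp_def gen_eq[OF us] decorate_eq[OF R])
  qed
qed

lemma gen_tupleE: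
  assumes "t \<in> Surs n" "length xs = vertices t" "\<And>i. i < vertices t \<Longrightarrow> xs ! i \<in> cell_gen ` Surs (count_list t i)"
  obtains ts where "substitutable t ts" "xs = map cell_gen ts"
proof -
  have "\<forall>i. \<exists>s. i < vertices t \<longrightarrow> s \<in> Surs (count_list t i) \<and> xs ! i = cell_gen s" using assms(3) by blast
  then obtain f where f: "\<And>i. i < vertices t \<Longrightarrow> f i \<in> Surs (count_list t i) \<and> xs ! i = cell_gen (f i)" by metis
  show ?thesis
  proof (rule that)
    show "substitutable t (map f [0..<vertices t])" using f by (simp add: substitutable_def)
    show "xs = map cell_gen (map f [0..<vertices t])" using f assms(2) by (intro nth_equalityI) auto
  qed
qed

lemma gen_tuples: "t \<in> Surs n \<Longrightarrow> substitutable t ts \<Longrightarrow> map cell_gen ts \<in> tuples (map (permAs R) (arity_list t))"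
  using gen_closed[OF substitutableD(2)] substitutableD(1) by (fastforce simp: tuples_iff)

lemma permAs_multilinear_eq:
  assumes t: "t \<in> Surs n" and N: "module R N"
    and fg: "multilinear R (map (permAs R) (arity_list t)) N f" "multilinear R (map (permAs R) (arity_list t)) N g"
    and base: "\<And>ts. substitutable t ts \<Longrightarrow> f (map cell_gen ts) = g (map cell_gen ts)"
    and xs: "xs \<in> tuples (map (permAs R) (arity_list t))"
  shows "f xs = g xs"
proof (rule multilinear_eq_on_span[OF N _ fg, where S = "\<lambda>i. cell_gen ` Surs (count_list t i)"])
  show "length xs = length (map (permAs R) (arity_list t))" using xs by (simp add: tuples_iff)
  fix i assume i: "i < length (map (permAs R) (arity_list t))"
  show "cell_gen ` Surs (count_list t i) \<subseteq> carrier (map (permAs R) (arity_list t) ! i)"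
    using i gen_closed by auto
  have "xs ! i \<in> carrier (permAs R (count_list t i + 1))" using i xs by (simp add: tuples_iff)
  then show "xs ! i \<in> module_span R (map (permAs R) (arity_list t) ! i) (cell_gen ` Surs (count_list t i))"
    unfolding permAs_span using i by simp
next
  fix ys assume "length ys = length (map (permAs R) (arity_list t))"
    "\<And>i. i < length (map (permAs R) (arity_list t)) \<Longrightarrow> ys ! i \<in> cell_gen ` Surs (count_list t i)"
  then obtain ts where "substitutable t ts" "ys = map cell_gen ts" using gen_tupleE[OF t, of ys] by auto
  then show "f ys = g ys" using base by simp
qed (use module_permAs[OF R] in auto)

text \<open>The entries of \<open>\<nu>s\<close> are themselves tuples, so multilinearity is used on
  two levels: \<open>coordinate_induct\<close> replaces one inner tuple at a time, and
  \<open>permAs_multilinear_eq\<close> reduces that tuple to generators. On generators the claim is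
  \<open>sur_subst_assoc\<close>.\<close>

lemma permAs_comp_assoc:
  assumes t: "t \<in> Surs n" and ts: "substitutable t ts"
    and \<nu>s: "list_all2 (\<lambda>\<mu>s s. \<mu>s \<in> tuples (map (permAs R) (arity_list s))) \<nu>s ts"
  shows "permAs_comp R (sur_subst t ts) (concat \<nu>s) = permAs_comp R t (map2 (permAs_comp R) ts \<nu>s)"
proof -
  let ?L = "\<lambda>s. map (permAs R) (arity_list s)"
  have len: "length ts = vertices t" by (rule substitutableD(1)[OF ts])
  note tsj = substitutableD(2)[OF ts]
  note u = sur_subst_Surs[OF t ts]
  have Lu: "?L (sur_subst t ts) = concat (map ?L ts)"
    unfolding arity_list_sur_subst[OF t ts] by (simp add: map_concat comp_def)
  have PR: "module R M" if "M \<in> set (?L s)" for M s using that module_permAs[OF R] by auto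
  show ?thesis
  proof (rule coordinate_induct[where xs = \<nu>s and n = "vertices t" and C = "\<lambda>j. tuples (?L (ts ! j))"
        and B = "\<lambda>j. map cell_gen ` {rs. substitutable (ts ! j) rs}"])
    show "length \<nu>s = vertices t" "\<And>i. i < vertices t \<Longrightarrow> \<nu>s ! i \<in> tuples (?L (ts ! i))"
      using \<nu>s len by (auto simp: list_all2_conv_all_nth)
    show "map cell_gen ` {rs. substitutable (ts ! i) rs} \<subseteq> tuples (?L (ts ! i))" if "i < vertices t" for i
      using gen_tuples[OF tsj[OF that]] by auto
  next
    fix xss assume xss: "length xss = vertices t" "\<And>i. i < vertices t \<Longrightarrow> xss ! i \<in> map cell_gen ` {rs. substitutable (ts ! i) rs}"
    then have "\<forall>i. \<exists>rs. i < vertices t \<longrightarrow> substitutable (ts ! i) rs \<and> xss ! i = map cell_gen rs" by blast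
    then obtain r where r: "\<And>i. i < vertices t \<Longrightarrow> substitutable (ts ! i) (r i) \<and> xss ! i = map cell_gen (r i)" by metis
    let ?rss = "map r [0..<vertices t]"
    have rss: "length ?rss = vertices t" "\<And>j. j < vertices t \<Longrightarrow> substitutable (ts ! j) (?rss ! j)" using r by auto
    have 1: "xss = map (map cell_gen) ?rss" using xss(1) r by (intro nth_equalityI) auto
    have 2: "map2 (permAs_comp R) ts xss = map cell_gen (map2 sur_subst ts ?rss)"
      using xss(1) len r permAs_comp_gen[OF tsj] by (intro nth_equalityI) auto
    have "permAs_comp R (sur_subst t ts) (concat xss) = cell_gen (sur_subst (sur_subst t ts) (concat ?rss))"
      using permAs_comp_gen[OF u substitutable_concat[OF t ts rss]] by (simp add: 1 map_concat comp_def)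
    moreover have "permAs_comp R t (map2 (permAs_comp R) ts xss) = cell_gen (sur_subst t (map2 sur_subst ts ?rss))"
      unfolding 2 by (rule permAs_comp_gen[OF t substitutable_map2[OF t ts rss]])
    ultimately show "permAs_comp R (sur_subst t ts) (concat xss) = permAs_comp R t (map2 (permAs_comp R) ts xss)"
      using sur_subst_assoc(3)[OF t ts rss] by simp
  next
    fix xss i
    assume xss: "length xss = vertices t" "\<And>j. j < vertices t \<Longrightarrow> xss ! j \<in> tuples (?L (ts ! j))" and i: "i < vertices t"
      and base: "\<And>ys. ys \<in> map cell_gen ` {rs. substitutable (ts ! i) rs} \<Longrightarrow>
        permAs_comp R (sur_subst t ts) (concat (xss[i := ys])) = permAs_comp R t (map2 (permAs_comp R) ts (xss[i := ys]))"
    have cl: "permAs_comp R (ts ! j) (xss ! j) \<in> carrier (permAs R (count_list t j + 1))" if "j < vertices t" for j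
      by (rule multilinear_closed[OF multilinear_permAs_comp[OF tsj[OF that]] xss(2)[OF that]])
    \<comment> \<open>Here the varying tuple occupies a consecutive stretch of the concatenated
      tuple.\<close>
    have "multilinear R (?L (ts ! i)) (permAs R (n + 1)) (\<lambda>ys. permAs_comp R (sur_subst t ts) (concat (xss[i := ys])))"
    proof -
      have split: "concat (xss[i := ys]) = concat (take i xss) @ ys @ concat (drop (Suc i) xss)" for ys
        using i xss(1) by (simp add: upd_conv_take_nth_drop)
      have Ls: "?L (sur_subst t ts) = concat (map ?L (take i ts)) @ ?L (ts ! i) @ concat (map ?L (drop (Suc i) ts))"
      proof -
        have "concat (map ?L ts) = concat (map ?L (take i ts @ ts ! i # drop (Suc i) ts))"
          using i len id_take_nth_drop[of i ts] by simp
        then show ?thesis unfolding Lu by simp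
      qed
      have tup: "concat yss \<in> tuples (concat (map ?L ss))" if "list_all2 (\<lambda>ys s. ys \<in> tuples (?L s)) yss ss" for yss ss
        using that by (induction rule: list_all2_induct) (auto simp: tuples_def intro: list_all2_appendI)
      have all: "list_all2 (\<lambda>ys s. ys \<in> tuples (?L s)) xss ts"
        using xss len by (simp add: list_all2_conv_all_nth)
      show ?thesis
        unfolding split
        by (rule multilinear_append[OF multilinear_permAs_comp[OF u, unfolded Ls]])
          (intro tup list_all2_takeI list_all2_dropI all)+
    qed
    \<comment> \<open>Here it enters only through its inner composite, which is one entry of the
      outer tuple.\<close>
    moreover have "multilinear R (?L (ts ! i)) (permAs R (n + 1)) (\<lambda>ys. permAs_comp R t (map2 (permAs_comp R) ts (xss[i := ys])))"
    proof -
      let ?ys = "map2 (permAs_comp R) ts xss"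
      have upd: "map2 (permAs_comp R) ts (xss[i := ys]) = ?ys[i := permAs_comp R (ts ! i) ys]" for ys
        using i xss(1) len by (intro nth_equalityI) (auto simp: nth_list_update)
      have "?ys \<in> tuples (?L t)" using cl xss(1) len by (simp add: tuples_iff)
      then have "linear_map R (permAs R (count_list t i + 1)) (permAs R (n + 1)) (\<lambda>y. permAs_comp R t (?ys[i := y]))"
        using multilinear_linear[OF multilinear_permAs_comp[OF t], of ?ys i] i by simp
      then show ?thesis
        unfolding upd by (rule multilinear_comp_linear[OF multilinear_permAs_comp[OF tsj[OF i]]])
    qed
    ultimately have "permAs_comp R (sur_subst t ts) (concat (xss[i := xss ! i])) = permAs_comp R t (map2 (permAs_comp R) ts (xss[i := xss ! i]))"
    proof (rule permAs_multilinear_eq[OF tsj[OF i] module_permAs[OF R] _ _ _ xss(2)[OF i]])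
      show "permAs_comp R (sur_subst t ts) (concat (xss[i := map cell_gen rs])) =
        permAs_comp R t (map2 (permAs_comp R) ts (xss[i := map cell_gen rs]))" if "substitutable (ts ! i) rs" for rs
        using base[of "map cell_gen rs"] that by blast
    qed
    then show "permAs_comp R (sur_subst t ts) (concat xss) = permAs_comp R t (map2 (permAs_comp R) ts xss)" by simp
  qed
qed

lemma permAs_comp_corolla:
  assumes n: "1 \<le> n" and \<mu>: "\<mu> \<in> carrier (permAs R (n + 1))"
  shows "permAs_comp R (corolla n) [\<mu>] = \<mu>"
proof -
  have c: "corolla n \<in> Surs n" and v: "vertices (corolla n) = 1" using n corolla_Surs vertices_corolla by auto
  have al: "arity_list (corolla n) = [n + 1]" by (simp add: arity_list_def v count_corolla)
  \<comment> \<open>Writing \<open>\<mu>\<close> as \<open>hd [\<mu>]\<close> presents the identity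
    as a multilinear map in one slot, so that the comparison on generators applies.\<close>
  have "(\<lambda>xs. permAs_comp R (corolla n) xs) [\<mu>] = hd [\<mu>]"
  proof (rule permAs_multilinear_eq[OF c module_permAs[OF R] multilinear_permAs_comp[OF c]])
    show "multilinear R (map (permAs R) (arity_list (corolla n))) (permAs R (n + 1)) hd"
    proof (rule multilinearI)
      fix xs i assume "xs \<in> tuples (map (permAs R) (arity_list (corolla n)))"
      then obtain x where x: "xs = [x]" "x \<in> carrier (permAs R (n + 1))" by (auto simp: al tuples_iff length_Suc_conv)
      then show "hd xs \<in> carrier (permAs R (n + 1))" by simp
      assume "i < length (map (permAs R) (arity_list (corolla n)))"
      then show "linear_map R (map (permAs R) (arity_list (corolla n)) ! i) (permAs R (n + 1)) (\<lambda>y. hd (xs[i := y]))"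
        using x linear_map_id[of R "permAs R (n + 1)"] by (simp add: al)
    qed
    show "[\<mu>] \<in> tuples (map (permAs R) (arity_list (corolla n)))" using \<mu> by (simp add: al tuples_iff)
    fix ts assume ts: "substitutable (corolla n) ts"
    then obtain s where s: "ts = [s]" "s \<in> Surs n"
      using count_corolla[of n] by (auto simp: substitutable_def v length_Suc_conv)
    then show "permAs_comp R (corolla n) (map cell_gen ts) = hd (map cell_gen ts)"
      unfolding permAs_comp_gen[OF c ts] using sur_subst_corolla[of s n] by (simp add: Surs_iff)
  qed
  then show ?thesis by simp
qed

lemma permutad_permAs: "permutad R (permAs R) (permAs_comp R)"
  unfolding permutad_def
proof (intro conjI allI ballI impI)
  show "module R (permAs R n)" for n by (rule module_permAs[OF R])
  \<comment> \<open>The empty surjection has no vertices to fill, so composing along it produces the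
    decorated empty cell.\<close>
  have e: "[] \<in> Surs 0" "vertices [] = 0" "substitutable [] []" "sur_subst [] [] = []"
    by (auto simp: Surs_0 vertices_def substitutable_def sur_subst_def)
  have id: "permAs_comp R [] [] = cell_gen []" using permAs_comp_gen[OF e(1,3)] e(4) by simp
  show "permAs_comp R [] [] \<in> carrier (permAs R 1)" unfolding id using gen_closed[OF e(1)] by simp
  \<comment> \<open>In arity one there is a single cell, the empty word, so a chain is the same as
    one element of \<open>R\<close>.\<close>
  show "bij_betw (\<lambda>r. r \<odot>\<^bsub>permAs R 1\<^esub> permAs_comp R [] []) (carrier R) (carrier (permAs R 1))"
  proof -
    let ?h = "\<lambda>r. r \<odot>\<^bsub>perm_chains R 0\<^esub> basis_elt R []"
    have h: "?h r = (\<lambda>t. if t = [] then r else \<zero>)" if "r \<in> carrier R" for r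
      using that by (auto simp: perm_chains_simps[OF R] basis_elt_def)
    have "bij_betw ?h (carrier R) (carrier (perm_chains R 0))"
    proof (rule bij_betw_imageI)
      show "inj_on ?h (carrier R)" by (rule inj_onI) (auto simp: h dest: fun_cong[of _ _ "[]"])
      show "?h ` carrier R = carrier (perm_chains R 0)"
      proof
        show "?h ` carrier R \<subseteq> carrier (perm_chains R 0)"
          using h by (auto simp: perm_chains_carrier[OF R] Surs_0)
        show "carrier (perm_chains R 0) \<subseteq> ?h ` carrier R"
        proof
          fix f assume f: "f \<in> carrier (perm_chains R 0)"
          then have "f [] \<in> carrier R" "f = ?h (f [])"
            using h[of "f []"] by (auto simp: perm_chains_carrier[OF R] Surs_0)
          then show "f \<in> ?h ` carrier R" by (intro image_eqI)
        qed
      qed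
    qed
    moreover have "bij_betw (decorate R 1) (carrier (perm_chains R 0)) (carrier (permAs R 1))"
      using bij_decorate[OF R, of 1] by simp
    ultimately have b: "bij_betw (decorate R 1 \<circ> ?h) (carrier R) (carrier (permAs R 1))" by (rule bij_betw_trans)
    have lin: "linear_map R (perm_chains R 0) (permAs R 1) (decorate R 1)" using linear_decorate[OF R, of 1] by simp
    have "(decorate R 1 \<circ> ?h) r = r \<odot>\<^bsub>permAs R 1\<^esub> permAs_comp R [] []" if "r \<in> carrier R" for r
      unfolding id gen_eq[OF e(1)] using linear_mapD(3)[OF lin that basis_perm_chains[OF R e(1)]] by simp
    then show ?thesis by (rule iffD1[OF bij_betw_cong b])
  qed
  show "multilinear R (map (permAs R) (arity_list t)) (permAs R (n + 1)) (permAs_comp R t)" if "t \<in> Surs n" for n t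
    by (rule multilinear_permAs_comp[OF that])
  show "permAs_comp R (corolla n) [\<mu>] = \<mu>" if "1 \<le> n" "\<mu> \<in> carrier (permAs R (n + 1))" for n \<mu>
    by (rule permAs_comp_corolla[OF that])
qed (rule permAs_comp_assoc)

end

section \<open>Compatibility with the differentials\<close>

context
  fixes R :: "('r, 'x) ring_scheme" (structure)
  assumes R: "cring R"
begin

interpretation cring R by (rule R)

private abbreviation (input) "P \<equiv> permAs R"
private abbreviation (input) "D \<equiv> permAs_diff R"
private abbreviation (input) "G \<equiv> permAs_deg R"

private lemma PM: "module R (P n)" by (rule module_permAs[OF R])
private lemma PG: "graded_module R (P n) (G n)" using dg_permAs(1)[OF R, of n] by (simp add: dg_module_def)
private lemma PD: "linear_map R (P n) (P n) (D n)" using dg_permAs(1)[OF R, of n] by (simp add: dg_module_def)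

lemma koszul_gen:
  assumes s: "s \<in> Surs m"
  shows "koszul (P (m + 1)) (G (m + 1)) (cell_gen R s) = int_scalar R ((- 1) ^ (m - vertices s)) \<odot>\<^bsub>P (m + 1)\<^esub> cell_gen R s"
proof -
  interpret M: module R "P (m + 1)" by (rule PM)
  have "cell_gen R s \<in> cell_gen R ` {s' \<in> Surs m. cell_degree s' = cell_degree s}" using s by simp
  then have deg: "cell_gen R s \<in> G (m + 1) (cell_degree s)"
    unfolding permAs_deg_span[OF R] by (rule subsetD[OF span_superset])
  \<comment> \<open>The bound keeps the truncated difference \<open>m - vertices s\<close> equal to
    the degree of the cell.\<close>
  have "vertices s \<le> m" using s card_length[of s] by (simp add: Surs_iff vertices_def)
  then have e: "even (cell_degree s) \<longleftrightarrow> even (m - vertices s)" using s by (simp add: cell_degree_def Surs_iff)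
  have "int_scalar R (- 1) \<odot>\<^bsub>P (m + 1)\<^esub> cell_gen R s = \<ominus>\<^bsub>P (m + 1)\<^esub> cell_gen R s"
    unfolding int_scalar_minus int_scalar_1 M.smult_l_minus[OF one_closed gen_closed[OF R s]]
      M.smult_one[OF gen_closed[OF R s]] ..
  then show ?thesis
    unfolding koszul_homogeneous[OF PG deg] e
    using M.smult_one[OF gen_closed[OF R s]] by (cases "even (m - vertices s)") simp_all
qed

lemma permAs_diff_gen: "s \<in> Surs m \<Longrightarrow> D (m + 1) (cell_gen R s) = decorate R (m + 1) (cell_boundary R s)"
  using permAs_diff_decorate[OF R, of "basis_elt R s" "m + 1"] basis_perm_chains[OF R, of s m]
  by (simp add: gen_eq[OF R, of s m] perm_boundary_basis[OF R])

lemma cell_boundary_expand: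
  assumes s: "s \<in> Surs m"
  shows "cell_boundary R s = (\<Oplus>\<^bsub>perm_chains R m\<^esub>v\<in>Surs m. int_scalar R (incidence s v) \<odot>\<^bsub>perm_chains R m\<^esub> basis_elt R v)"
proof -
  have c: "cell_boundary R s \<in> carrier (free_module R (Surs m))"
    using cell_boundary_closed[OF R s] by (simp add: perm_chains_def)
  have "{v. cell_boundary R s v \<noteq> \<zero>} \<subseteq> Surs m" using c by (auto simp: free_module_carrier)
  note expand = free_module_expand[OF R c finite_Surs this subset_refl, folded perm_chains_def]
  interpret C: module R "perm_chains R m" by (rule module_perm_chains[OF R])
  show ?thesis
  proof (rule trans[OF expand C.M.finsum_cong'[OF refl]])
    show "(\<lambda>v. int_scalar R (incidence s v) \<odot>\<^bsub>perm_chains R m\<^esub> basis_elt R v) \<in> Surs m \<rightarrow> carrier (perm_chains R m)"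
      by (intro Pi_I C.smult_closed int_scalar_closed basis_perm_chains[OF R])
    show "cell_boundary R s v \<odot>\<^bsub>perm_chains R m\<^esub> basis_elt R v = int_scalar R (incidence s v) \<odot>\<^bsub>perm_chains R m\<^esub> basis_elt R v" for v
      unfolding cell_boundary_app[OF R s, of v] ..
  qed
qed

lemma permAs_diff_expand:
  assumes s: "s \<in> Surs m"
  shows "D (m + 1) (cell_gen R s) = (\<Oplus>\<^bsub>P (m + 1)\<^esub>v\<in>Surs m. int_scalar R (incidence s v) \<odot>\<^bsub>P (m + 1)\<^esub> cell_gen R v)"
proof -
  interpret C: module R "perm_chains R m" by (rule module_perm_chains[OF R])
  interpret M: module R "P (m + 1)" by (rule PM)
  have lin: "linear_map R (perm_chains R m) (P (m + 1)) (decorate R (m + 1))"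
    using linear_decorate[OF R, of "m + 1"] by simp
  note b = basis_perm_chains[OF R, of _ m]
  have "D (m + 1) (cell_gen R s) = (\<Oplus>\<^bsub>P (m + 1)\<^esub>v\<in>Surs m.
      decorate R (m + 1) (int_scalar R (incidence s v) \<odot>\<^bsub>perm_chains R m\<^esub> basis_elt R v))"
    unfolding permAs_diff_gen[OF s] cell_boundary_expand[OF s]
    by (rule linear_map_finsum[OF C.module_axioms M.module_axioms lin]) (use b in auto)
  also have "\<dots> = (\<Oplus>\<^bsub>P (m + 1)\<^esub>v\<in>Surs m. int_scalar R (incidence s v) \<odot>\<^bsub>P (m + 1)\<^esub> cell_gen R v)"
  proof (rule M.M.finsum_cong'[OF refl])
    show "(\<lambda>v. int_scalar R (incidence s v) \<odot>\<^bsub>P (m + 1)\<^esub> cell_gen R v) \<in> Surs m \<rightarrow> carrier (P (m + 1))"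
      by (intro Pi_I M.smult_closed int_scalar_closed gen_closed[OF R])
    show "decorate R (m + 1) (int_scalar R (incidence s v) \<odot>\<^bsub>perm_chains R m\<^esub> basis_elt R v) =
      int_scalar R (incidence s v) \<odot>\<^bsub>P (m + 1)\<^esub> cell_gen R v" if "v \<in> Surs m" for v
      unfolding linear_mapD(3)[OF lin int_scalar_closed b[OF that]] gen_eq[OF R that] ..
  qed
  finally show ?thesis .
qed

text \<open>One term of the Leibniz rule without its Koszul sign, pulled back to chains, where it
  can be compared with the boundary of the composite.\<close>

lemma permAs_comp_diff_slot:
  assumes t: "t \<in> Surs m" and ts: "substitutable t ts" and i: "i < vertices t"
  shows "permAs_comp R t ((map (cell_gen R) ts)[i := D (count_list t i + 1) (cell_gen R (ts ! i))]) =
    decorate R (m + 1) (\<Oplus>\<^bsub>perm_chains R m\<^esub>v\<in>Surs (count_list t i).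
      int_scalar R (incidence (ts ! i) v) \<odot>\<^bsub>perm_chains R m\<^esub> basis_elt R (sur_subst t (ts[i := v])))"
proof -
  let ?c = "count_list t i"
  interpret C: module R "perm_chains R m" by (rule module_perm_chains[OF R])
  interpret M: module R "P (m + 1)" by (rule PM)
  interpret Mc: module R "P (?c + 1)" by (rule PM)
  have len: "length ts = vertices t" by (rule substitutableD(1)[OF ts])
  have tsi: "ts ! i \<in> Surs ?c" by (rule substitutableD(2)[OF ts i])
  have sv: "substitutable t (ts[i := v])" if "v \<in> Surs ?c" for v by (rule substitutable_update[OF ts that])
  have us: "sur_subst t (ts[i := v]) \<in> Surs m" if "v \<in> Surs ?c" for v by (rule sur_subst_Surs[OF t sv[OF that]])
  have lin: "linear_map R (perm_chains R m) (P (m + 1)) (decorate R (m + 1))"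
    using linear_decorate[OF R, of "m + 1"] by simp
  let ?f = "\<lambda>y. permAs_comp R t ((map (cell_gen R) ts)[i := y])"
  have f: "linear_map R (P (?c + 1)) (P (m + 1)) ?f"
    using multilinear_linear[OF multilinear_permAs_comp[OF R t] gen_tuples[OF R t ts], of i] i by simp
  have fg: "?f (cell_gen R v) = cell_gen R (sur_subst t (ts[i := v]))" if "v \<in> Surs ?c" for v
    using permAs_comp_gen[OF R t sv[OF that]] by (simp add: map_update)
  have "?f (D (?c + 1) (cell_gen R (ts ! i))) =
    (\<Oplus>\<^bsub>P (m + 1)\<^esub>v\<in>Surs ?c. ?f (int_scalar R (incidence (ts ! i) v) \<odot>\<^bsub>P (?c + 1)\<^esub> cell_gen R v))"
    unfolding permAs_diff_expand[OF tsi]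
    by (rule linear_map_finsum[OF Mc.module_axioms M.module_axioms f])
      (intro Pi_I Mc.smult_closed int_scalar_closed gen_closed[OF R])
  also have "\<dots> = (\<Oplus>\<^bsub>P (m + 1)\<^esub>v\<in>Surs ?c.
      decorate R (m + 1) (int_scalar R (incidence (ts ! i) v) \<odot>\<^bsub>perm_chains R m\<^esub> basis_elt R (sur_subst t (ts[i := v]))))"
  proof (rule M.M.finsum_cong'[OF refl])
    fix v assume v: "v \<in> Surs ?c"
    note b = basis_perm_chains[OF R us[OF v]]
    show "?f (int_scalar R (incidence (ts ! i) v) \<odot>\<^bsub>P (?c + 1)\<^esub> cell_gen R v) =
      decorate R (m + 1) (int_scalar R (incidence (ts ! i) v) \<odot>\<^bsub>perm_chains R m\<^esub> basis_elt R (sur_subst t (ts[i := v])))"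
      unfolding linear_mapD(3)[OF f int_scalar_closed gen_closed[OF R v]] linear_mapD(3)[OF lin int_scalar_closed b] fg[OF v] gen_eq[OF R us[OF v]] ..
  next
    show "(\<lambda>v. decorate R (m + 1) (int_scalar R (incidence (ts ! i) v) \<odot>\<^bsub>perm_chains R m\<^esub> basis_elt R (sur_subst t (ts[i := v]))))
      \<in> Surs ?c \<rightarrow> carrier (P (m + 1))"
      using linear_mapD(1)[OF lin C.smult_closed[OF int_scalar_closed basis_perm_chains[OF R us]]] by auto
  qed
  also have "\<dots> = decorate R (m + 1) (\<Oplus>\<^bsub>perm_chains R m\<^esub>v\<in>Surs ?c.
      int_scalar R (incidence (ts ! i) v) \<odot>\<^bsub>perm_chains R m\<^esub> basis_elt R (sur_subst t (ts[i := v])))"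
    by (rule linear_map_finsum[OF C.module_axioms M.module_axioms lin, symmetric])
      (use basis_perm_chains[OF R us] in auto)
  finally show ?thesis .
qed

text \<open>\<open>incidence_sur_subst\<close> read coefficient by coefficient.\<close>

lemma cell_boundary_sur_subst:
  assumes t: "t \<in> Surs m" and ts: "substitutable t ts"
  shows "cell_boundary R (sur_subst t ts) = (\<Oplus>\<^bsub>perm_chains R m\<^esub>i\<in>{..<vertices t}.
    int_scalar R ((- 1) ^ (\<Sum>j<i. count_list t j - vertices (ts ! j))) \<odot>\<^bsub>perm_chains R m\<^esub>
      (\<Oplus>\<^bsub>perm_chains R m\<^esub>v\<in>Surs (count_list t i).
        int_scalar R (incidence (ts ! i) v) \<odot>\<^bsub>perm_chains R m\<^esub> basis_elt R (sur_subst t (ts[i := v]))))"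
proof
  fix w
  let ?C = "perm_chains R m"
  interpret C: module R ?C by (rule module_perm_chains[OF R])
  let ?e = "\<lambda>i. (- 1) ^ (\<Sum>j<i. count_list t j - vertices (ts ! j)) :: int"
  let ?b = "\<lambda>i v. int_scalar R (incidence (ts ! i) v) \<odot>\<^bsub>?C\<^esub> basis_elt R (sur_subst t (ts[i := v]))"
  have b: "basis_elt R (sur_subst t (ts[i := v])) \<in> carrier ?C" if "v \<in> Surs (count_list t i)" for i v
    by (intro basis_perm_chains[OF R] sur_subst_Surs[OF t] substitutable_update[OF ts that])
  have inner: "?b i \<in> Surs (count_list t i) \<rightarrow> carrier ?C" for i
    using b by (auto intro!: C.smult_closed)
  have sum: "(\<Oplus>\<^bsub>?C\<^esub>v\<in>Surs (count_list t i). ?b i v) \<in> carrier ?C" for i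
    by (rule C.M.finsum_closed[OF inner])
  have outer: "(\<lambda>i. int_scalar R (?e i) \<odot>\<^bsub>?C\<^esub> (\<Oplus>\<^bsub>?C\<^esub>v\<in>Surs (count_list t i). ?b i v)) \<in> {..<vertices t} \<rightarrow> carrier ?C"
    using sum by (auto intro!: C.smult_closed)
  have sm: "(r \<odot>\<^bsub>?C\<^esub> f) w = r \<otimes> f w" for r f by (simp add: perm_chains_simps[OF R])
  have innerw: "(\<Oplus>\<^bsub>?C\<^esub>v\<in>Surs (count_list t i). ?b i v) w =
      int_scalar R (\<Sum>v\<in>Surs (count_list t i). if w = sur_subst t (ts[i := v]) then incidence (ts ! i) v else 0)" for i
    unfolding finsum_perm_chains_app[OF R inner] int_scalar_sum sm
    by (rule finsum_cong'[OF refl]) (auto simp: basis_elt_def)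
  have "cell_boundary R (sur_subst t ts) w = (\<Oplus>i\<in>{..<vertices t}. int_scalar R (?e i) \<otimes>
      int_scalar R (\<Sum>v\<in>Surs (count_list t i). if w = sur_subst t (ts[i := v]) then incidence (ts ! i) v else 0))"
    unfolding cell_boundary_app[OF R sur_subst_Surs[OF t ts]] incidence_sur_subst[OF t ts] int_scalar_sum[of _ "{..<vertices t}"] int_scalar_mult ..
  also have "\<dots> = (\<Oplus>\<^bsub>?C\<^esub>i\<in>{..<vertices t}. int_scalar R (?e i) \<odot>\<^bsub>?C\<^esub> (\<Oplus>\<^bsub>?C\<^esub>v\<in>Surs (count_list t i). ?b i v)) w"
    unfolding finsum_perm_chains_app[OF R outer] sm innerw ..
  finally show "cell_boundary R (sur_subst t ts) w =
    (\<Oplus>\<^bsub>?C\<^esub>i\<in>{..<vertices t}. int_scalar R (?e i) \<odot>\<^bsub>?C\<^esub> (\<Oplus>\<^bsub>?C\<^esub>v\<in>Surs (count_list t i). ?b i v)) w" .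
qed

text \<open>On generators each Koszul operator is multiplication by a sign. The signs before slot
  \<open>i\<close> multiply to -1 to the total degree of the earlier cells, which is the sign of the
  term \<open>i\<close> in \<open>cell_boundary_sur_subst\<close>; the two sums then agree term by
  term.\<close>

lemma permAs_comp_leibniz:
  assumes t: "t \<in> Surs m" and ts: "substitutable t ts"
  defines "Ms \<equiv> map P (arity_list t)" and "Gs \<equiv> map G (arity_list t)" and "ds \<equiv> map D (arity_list t)"
    and "xs \<equiv> map (cell_gen R) ts"
  shows "(\<Oplus>\<^bsub>P (m + 1)\<^esub>i\<in>{..<length Ms}. permAs_comp R t (map (\<lambda>j. if j < i then koszul (Ms ! j) (Gs ! j) (xs ! j)
      else if j = i then (ds ! j) (xs ! j) else xs ! j) [0..<length Ms])) = D (m + 1) (permAs_comp R t xs)"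
proof -
  let ?C = "perm_chains R m"
  interpret C: module R ?C by (rule module_perm_chains[OF R])
  interpret M: module R "P (m + 1)" by (rule PM)
  have len: "length ts = vertices t" "length Ms = vertices t" "length xs = vertices t"
    using substitutableD(1)[OF ts] by (auto simp: Ms_def xs_def)
  have Mj: "Ms ! j = P (count_list t j + 1)" "Gs ! j = G (count_list t j + 1)" "ds ! j = D (count_list t j + 1)"
    "xs ! j = cell_gen R (ts ! j)" if "j < vertices t" for j
    using that len by (auto simp: Ms_def Gs_def ds_def xs_def)
  note tsj = substitutableD(2)[OF ts]
  have MsM: "module R M" if "M \<in> set Ms" for M using that PM by (auto simp: Ms_def)
  have tup: "xs \<in> tuples Ms" unfolding xs_def Ms_def by (rule gen_tuples[OF R t ts])
  have ml: "multilinear R Ms (P (m + 1)) (permAs_comp R t)" unfolding Ms_def by (rule multilinear_permAs_comp[OF R t])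
  have lin: "linear_map R ?C (P (m + 1)) (decorate R (m + 1))" using linear_decorate[OF R, of "m + 1"] by simp
  let ?e = "\<lambda>i. (- 1) ^ (\<Sum>j<i. count_list t j - vertices (ts ! j)) :: int"
  let ?S = "\<lambda>i. \<Oplus>\<^bsub>?C\<^esub>v\<in>Surs (count_list t i).
      int_scalar R (incidence (ts ! i) v) \<odot>\<^bsub>?C\<^esub> basis_elt R (sur_subst t (ts[i := v]))"
  have S: "?S i \<in> carrier ?C" for i
    by (intro C.M.finsum_closed Pi_I C.smult_closed int_scalar_closed basis_perm_chains[OF R] sur_subst_Surs[OF t] substitutable_update[OF ts])
  have summand: "permAs_comp R t (map (\<lambda>j. if j < i then koszul (Ms ! j) (Gs ! j) (xs ! j)
      else if j = i then (ds ! j) (xs ! j) else xs ! j) [0..<length Ms]) =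
    decorate R (m + 1) (int_scalar R (?e i) \<odot>\<^bsub>?C\<^esub> ?S i)" if i: "i < vertices t" for i
  proof -
    let ?d = "\<lambda>j. (- 1) ^ (count_list t j - vertices (ts ! j)) :: int"
    let ?ys = "xs[i := D (count_list t i + 1) (cell_gen R (ts ! i))]"
    \<comment> \<open>The Koszul slots become rescalings of the tuple \<open>?ys\<close>, in which
      only slot \<open>i\<close> has been differentiated.\<close>
    have eq: "map (\<lambda>j. if j < i then koszul (Ms ! j) (Gs ! j) (xs ! j)
      else if j = i then (ds ! j) (xs ! j) else xs ! j) [0..<length Ms] =
      map (\<lambda>j. if j < i then int_scalar R (?d j) \<odot>\<^bsub>Ms ! j\<^esub> (?ys ! j) else ?ys ! j) [0..<length Ms]"
    proof (rule map_cong[OF refl])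
      fix j assume "j \<in> set [0..<length Ms]"
      then have j: "j < vertices t" using len by simp
      show "(if j < i then koszul (Ms ! j) (Gs ! j) (xs ! j) else if j = i then (ds ! j) (xs ! j) else xs ! j) =
        (if j < i then int_scalar R (?d j) \<odot>\<^bsub>Ms ! j\<^esub> (?ys ! j) else ?ys ! j)"
        using koszul_gen[OF tsj[OF j]] len j by (simp add: Mj)
    qed
    have ys: "?ys \<in> tuples Ms"
      by (rule tuples_update[OF tup])
        (use linear_mapD(1)[OF PD gen_closed[OF R tsj[OF i]]] i in \<open>simp add: Mj\<close>)
    have "permAs_comp R t (map (\<lambda>j. if j < i then koszul (Ms ! j) (Gs ! j) (xs ! j)
      else if j = i then (ds ! j) (xs ! j) else xs ! j) [0..<length Ms]) =
      int_scalar R (\<Prod>j<i. ?d j) \<odot>\<^bsub>P (m + 1)\<^esub> permAs_comp R t ?ys"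
      unfolding eq by (rule multilinear_scale[OF R PM MsM ml ys]) (use i len in auto)
    also have "(\<Prod>j<i. ?d j) = ?e i" by (simp add: power_sum)
    also have "permAs_comp R t ?ys = decorate R (m + 1) (?S i)"
      unfolding xs_def by (rule permAs_comp_diff_slot[OF t ts i])
    finally show ?thesis using linear_mapD(3)[OF lin int_scalar_closed S] by simp
  qed
  have "D (m + 1) (permAs_comp R t xs) = decorate R (m + 1) (\<Oplus>\<^bsub>?C\<^esub>i\<in>{..<vertices t}. int_scalar R (?e i) \<odot>\<^bsub>?C\<^esub> ?S i)"
    unfolding xs_def permAs_comp_gen[OF R t ts] permAs_diff_gen[OF sur_subst_Surs[OF t ts]] cell_boundary_sur_subst[OF t ts] ..
  also have "\<dots> = (\<Oplus>\<^bsub>P (m + 1)\<^esub>i\<in>{..<vertices t}. decorate R (m + 1) (int_scalar R (?e i) \<odot>\<^bsub>?C\<^esub> ?S i))"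
    by (rule linear_map_finsum[OF C.module_axioms M.module_axioms lin]) (use S in auto)
  finally have D: "D (m + 1) (permAs_comp R t xs) = \<dots>" .
  show ?thesis
    unfolding D len(2)
    by (rule M.M.finsum_cong'[OF refl])
      (use summand len(2) linear_mapD(1)[OF lin C.smult_closed[OF int_scalar_closed S]] in auto)
qed

text \<open>Both sides are linear in the tensor and are compared on pure tensors; there both are
  multilinear in the entries and are compared on generators, where
  \<open>permAs_comp_leibniz\<close> applies.\<close>

lemma permAs_comp_chain_map:
  assumes t: "t \<in> Surs m" and X: "X \<in> carrier (tensor R (map P (arity_list t)))"
  shows "tensor_lift R (P (m + 1)) (permAs_comp R t)
      (tensor_diff R (map P (arity_list t)) (map G (arity_list t)) (map D (arity_list t)) X) =
    D (m + 1) (tensor_lift R (P (m + 1)) (permAs_comp R t) X)"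
    and "tensor_diff R (map P (arity_list t)) (map G (arity_list t)) (map D (arity_list t)) X \<in> carrier (tensor R (map P (arity_list t)))"
proof -
  define Ms where "Ms = map P (arity_list t)"
  define Gs where "Gs = map G (arity_list t)"
  define ds where "ds = map D (arity_list t)"
  let ?T = "tensor R Ms" and ?N = "P (m + 1)" and ?f = "permAs_comp R t"
  let ?s = "\<lambda>i xs. map (\<lambda>j. if j < i then koszul (Ms ! j) (Gs ! j) (xs ! j)
      else if j = i then (ds ! j) (xs ! j) else xs ! j) [0..<length Ms]"
  let ?d = "\<lambda>xs. \<Oplus>\<^bsub>?T\<^esub>i\<in>{..<length Ms}. pure R Ms (?s i xs)"
  have MsM: "module R M" if "M \<in> set Ms" for M using that PM by (auto simp: Ms_def)
  have T: "module R ?T" by (rule module_tensor[OF R MsM])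
  have ml: "multilinear R Ms ?N ?f" unfolding Ms_def by (rule multilinear_permAs_comp[OF R t])
  have K: "linear_map R (Ms ! i) (Ms ! i) (koszul (Ms ! i) (Gs ! i))" "linear_map R (Ms ! i) (Ms ! i) (ds ! i)"
    if "i < length Ms" for i using that koszul_linear[OF PG] PD by (auto simp: Ms_def Gs_def ds_def)
  have len: "length Gs = length Ms" "length ds = length Ms" by (auto simp: Ms_def Gs_def ds_def)
  note step = multilinear_tensor_diff[OF R MsM len K]
  have d: "multilinear R Ms ?T ?d"
    by (rule multilinear_sum[OF T MsM step[OF _ _ _ T pure_multilinear[OF R MsM]]])
  have td: "tensor_diff R Ms Gs ds = tensor_lift R ?T ?d" by (simp add: tensor_diff_def)
  have td_lin: "linear_map R ?T ?T (tensor_diff R Ms Gs ds)"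
    unfolding td by (rule tensor_lift_linear[OF R MsM T d])
  have f_lin: "linear_map R ?T ?N (tensor_lift R ?N ?f)" by (rule tensor_lift_linear[OF R MsM PM ml])
  have X': "X \<in> carrier ?T" using X by (simp add: Ms_def)
  have lift_d: "tensor_lift R ?T ?d (pure R Ms xs) = ?d xs" if "xs \<in> tuples Ms" for xs
    by (rule tensor_lift_pure[OF R MsM T d that])
  have lift_f: "tensor_lift R ?N ?f (pure R Ms xs) = ?f xs" if "xs \<in> tuples Ms" for xs
    by (rule tensor_lift_pure[OF R MsM PM ml that])
  have s_tup: "?s i xs \<in> tuples Ms" if "xs \<in> tuples Ms" for i xs
    using that linear_mapD(1)[OF K(1)] linear_mapD(1)[OF K(2)] by (auto simp: tuples_iff)
  have "tensor_lift R ?N ?f (tensor_diff R Ms Gs ds X) = D (m + 1) (tensor_lift R ?N ?f X)"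
  proof (rule linear_eq_on_tensor[OF R MsM PM linear_map_comp[OF td_lin f_lin] linear_map_comp[OF f_lin PD] _ X'])
    fix xs assume xs: "xs \<in> tuples Ms"
    have "tensor_lift R ?N ?f (tensor_diff R Ms Gs ds (pure R Ms xs)) = tensor_lift R ?N ?f (?d xs)"
      unfolding td lift_d[OF xs] ..
    also have "\<dots> = (\<Oplus>\<^bsub>?N\<^esub>i\<in>{..<length Ms}. tensor_lift R ?N ?f (pure R Ms (?s i xs)))"
      by (rule linear_map_finsum[OF T PM f_lin]) (use pure_closed[OF R MsM s_tup[OF xs]] in auto)
    also have "\<dots> = (\<Oplus>\<^bsub>?N\<^esub>i\<in>{..<length Ms}. ?f (?s i xs))"
      unfolding lift_f[OF s_tup[OF xs]] ..
    also have "\<dots> = D (m + 1) (?f xs)"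
    proof (rule permAs_multilinear_eq[OF R t PM])
      show "xs \<in> tuples (map P (arity_list t))" using xs by (simp add: Ms_def)
      show "multilinear R (map P (arity_list t)) ?N (\<lambda>xs. D (m + 1) (?f xs))"
        using multilinear_comp_linear[OF ml PD] by (simp add: Ms_def)
      show "multilinear R (map P (arity_list t)) ?N (\<lambda>xs. \<Oplus>\<^bsub>?N\<^esub>i\<in>{..<length Ms}. ?f (?s i xs))"
        using multilinear_sum[OF PM MsM step[OF _ _ _ PM ml]] by (simp add: Ms_def)
      show "(\<Oplus>\<^bsub>?N\<^esub>i\<in>{..<length Ms}. ?f (?s i (map (cell_gen R) ts))) = D (m + 1) (?f (map (cell_gen R) ts))"
        if "substitutable t ts" for ts
        unfolding Ms_def Gs_def ds_def by (rule permAs_comp_leibniz[OF t that])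
    qed
    also have "\<dots> = D (m + 1) (tensor_lift R ?N ?f (pure R Ms xs))"
      unfolding lift_f[OF xs] ..
    finally show "tensor_lift R ?N ?f (tensor_diff R Ms Gs ds (pure R Ms xs)) = D (m + 1) (tensor_lift R ?N ?f (pure R Ms xs))" .
  qed
  then show "tensor_lift R (P (m + 1)) (permAs_comp R t)
      (tensor_diff R (map P (arity_list t)) (map G (arity_list t)) (map D (arity_list t)) X) =
    D (m + 1) (tensor_lift R (P (m + 1)) (permAs_comp R t) X)" by (simp add: Ms_def Gs_def ds_def)
  show "tensor_diff R (map P (arity_list t)) (map G (arity_list t)) (map D (arity_list t)) X \<in> carrier (tensor R (map P (arity_list t)))"
    using linear_mapD(1)[OF td_lin X'] by (simp add: Ms_def Gs_def ds_def)
qed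

lemma permAs_structure_map_commutes: "structure_map_commutes R P G D (permAs_comp R)"
  unfolding structure_map_commutes_def
proof (intro allI impI ballI)
  fix n :: nat and x assume n: "1 \<le> n" and x: "x \<in> carrier (trees R P n)"
  define m where "m = n - 1"
  have nm: "n = m + 1" using n by (simp add: m_def)
  interpret M: module R "P (m + 1)" by (rule PM)
  have xt: "x t \<in> carrier (tensor R (map P (arity_list t)))" if "t \<in> Surs m" for t
    using x that by (auto simp: nm trees_def sum_module_simps)
  have cl: "tensor_lift R (P (m + 1)) (permAs_comp R t) Y \<in> carrier (P (m + 1))"
    if "t \<in> Surs m" "Y \<in> carrier (tensor R (map P (arity_list t)))" for t Y
    by (rule linear_mapD(1)[OF tensor_lift_linear[OF R _ PM multilinear_permAs_comp[OF R that(1)]] that(2)]) (use PM in auto)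
  have "structure_map R P (permAs_comp R) n (trees_diff R P G D n x) =
    (\<Oplus>\<^bsub>P (m + 1)\<^esub>t\<in>Surs m. D (m + 1) (tensor_lift R (P (m + 1)) (permAs_comp R t) (x t)))"
    unfolding structure_map_def nm add_diff_cancel_right'
    by (rule M.M.finsum_cong'[OF refl])
      (use permAs_comp_chain_map(1)[OF _ xt] cl[OF _ xt] linear_mapD(1)[OF PD] in \<open>auto simp: trees_diff_def\<close>)
  also have "\<dots> = D (m + 1) (\<Oplus>\<^bsub>P (m + 1)\<^esub>t\<in>Surs m. tensor_lift R (P (m + 1)) (permAs_comp R t) (x t))"
    by (rule linear_map_finsum[OF PM PM PD, symmetric]) (use cl[OF _ xt] in auto)
  finally show "structure_map R P (permAs_comp R) n (trees_diff R P G D n x) = D n (structure_map R P (permAs_comp R) n x)"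
    by (simp add: structure_map_def nm)
qed

text \<open>Elements and vertices both add up under substitution, hence so do degrees.
  Multilinearity reduces the claim to generators of the prescribed degrees.\<close>

lemma permAs_structure_map_degree:
  assumes n: "1 \<le> n" and x: "x \<in> trees_deg R P G n p"
  shows "structure_map R P (permAs_comp R) n x \<in> G n p"
proof -
  define m where "m = n - 1"
  have nm: "n = m + 1" using n by (simp add: m_def)
  note sub = graded_moduleD(2)[OF PG]
  note Gc = submoduleD(1)[OF PM sub]
  have "tensor_lift R (P (m + 1)) (permAs_comp R t) (x t) \<in> G (m + 1) p" if t: "t \<in> Surs m" for t
  proof -
    define Ms where "Ms = map P (arity_list t)"
    define Gs where "Gs = map G (arity_list t)"
    have MsM: "module R M" if "M \<in> set Ms" for M using that PM by (auto simp: Ms_def)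
    have ml: "multilinear R Ms (P (m + 1)) (permAs_comp R t)" unfolding Ms_def by (rule multilinear_permAs_comp[OF R t])
    let ?S = "{pure R Ms xs | xs ps. length xs = length Ms \<and> length ps = length Ms \<and>
      (\<forall>i<length Ms. xs ! i \<in> (Gs ! i) (ps ! i)) \<and> sum_list ps = p}"
    have len: "length Ms = vertices t" by (simp add: Ms_def)
    have MG: "Ms ! i = P (count_list t i + 1)" "Gs ! i = G (count_list t i + 1)" if "i < vertices t" for i
      using that by (auto simp: Ms_def Gs_def)
    have tup: "xs \<in> tuples Ms" if "length xs = length Ms" "\<forall>i<length Ms. xs ! i \<in> (Gs ! i) (ps ! i)" for xs ps
      using that Gc by (auto simp: tuples_iff len MG)
    have xS: "x t \<in> module_span R (tensor R Ms) ?S"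
      using x t by (auto simp: trees_deg_def tensor_deg_def nm Ms_def Gs_def)
    show ?thesis
    proof (rule linear_span_subset[OF module_tensor[OF R MsM] PM tensor_lift_linear[OF R MsM PM ml] sub _ _ xS])
      show "?S \<subseteq> carrier (tensor R Ms)" using pure_closed[OF R MsM tup] by auto
      fix X assume "X \<in> ?S"
      then obtain xs ps where X: "X = pure R Ms xs" "length xs = length Ms" "length ps = length Ms"
        "\<forall>i<length Ms. xs ! i \<in> (Gs ! i) (ps ! i)" "sum_list ps = p" by auto
      have "permAs_comp R t xs \<in> G (m + 1) p"
      proof (rule multilinear_span_subset[OF PM MsM ml sub, where S = "\<lambda>i. cell_gen R ` {s \<in> Surs (count_list t i). cell_degree s = ps ! i}"])
        show "length xs = length Ms" by fact
        fix i assume i: "i < length Ms"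
        show "cell_gen R ` {s \<in> Surs (count_list t i). cell_degree s = ps ! i} \<subseteq> carrier (Ms ! i)"
          using i gen_closed[OF R] by (auto simp: len MG)
        have "xs ! i \<in> G (count_list t i + 1) (ps ! i)" using X(4) i by (simp add: len MG)
        then show "xs ! i \<in> module_span R (Ms ! i) (cell_gen R ` {s \<in> Surs (count_list t i). cell_degree s = ps ! i})"
          unfolding permAs_deg_span[OF R] using i by (simp add: len MG)
      next
        fix ys assume ys: "length ys = length Ms"
          "\<And>i. i < length Ms \<Longrightarrow> ys ! i \<in> cell_gen R ` {s \<in> Surs (count_list t i). cell_degree s = ps ! i}"
        then have "\<forall>i. \<exists>s. i < vertices t \<longrightarrow> s \<in> Surs (count_list t i) \<and> cell_degree s = ps ! i \<and> ys ! i = cell_gen R s"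
          unfolding len by blast
        then obtain f where f: "\<And>i. i < vertices t \<Longrightarrow> f i \<in> Surs (count_list t i) \<and> cell_degree (f i) = ps ! i \<and> ys ! i = cell_gen R (f i)"
          by metis
        let ?ts = "map f [0..<vertices t]"
        have ts: "substitutable t ?ts" using f by (simp add: substitutable_def)
        have ysts: "ys = map (cell_gen R) ?ts" using f ys(1) len by (intro nth_equalityI) auto
        have u: "sur_subst t ?ts \<in> Surs m" by (rule sur_subst_Surs[OF t ts])
        have "cell_degree (sur_subst t ?ts) = p"
        proof -
          have "p = (\<Sum>i<vertices t. cell_degree (f i))"
            unfolding X(5)[symmetric] sum_list_sum_nth X(3) len atLeast0LessThan using f by (intro sum.cong) auto
          also have "\<dots> = (\<Sum>i<vertices t. int (count_list t i) - int (vertices (f i)))"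
            using f by (intro sum.cong) (auto simp: cell_degree_def Surs_iff)
          also have "\<dots> = int m - int (\<Sum>i<vertices t. vertices (f i))"
            using sum_count_list[OF t] by (simp add: sum_subtractf flip: of_nat_sum)
          also have "\<dots> = cell_degree (sur_subst t ?ts)"
            using u vertices_sur_subst[OF t ts] by (simp add: cell_degree_def Surs_iff)
          finally show ?thesis by simp
        qed
        then have "cell_gen R (sur_subst t ?ts) \<in> cell_gen R ` {s \<in> Surs m. cell_degree s = p}" using u by blast
        then show "permAs_comp R t ys \<in> G (m + 1) p"
          unfolding ysts permAs_comp_gen[OF R t ts] permAs_deg_span[OF R] by (rule subsetD[OF span_superset])
      qed
      then show "tensor_lift R (P (m + 1)) (permAs_comp R t) X \<in> G (m + 1) p"
        unfolding X(1) by (subst tensor_lift_pure[OF R MsM PM ml tup[OF X(2,4)]])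
    qed
  qed
  then show ?thesis
    unfolding structure_map_def nm add_diff_cancel_right' by (rule submodule_finsum[OF PM sub])
qed

lemma dg_permutad_permAs: "dg_permutad R P G D (permAs_comp R)"
  unfolding dg_permutad_def
  using permutad_permAs[OF R] dg_permAs(1)[OF R] permAs_structure_map_degree permAs_structure_map_commutes by auto

text \<open>As a graded permutad \<open>permAs\<close> is defined as the trees on \<open>V\<close>,
  so the identity is an isomorphism of the required kind.\<close>

lemma quasi_free_permAs: "quasi_free_on R (V R) (V_deg R) P G (permAs_comp R)"
  unfolding quasi_free_on_def
proof (intro conjI allI impI)
  show "graded_module R (V R n) (V_deg R n)" for n
    by (rule graded_module_concentrated[OF module_V[OF R], where q = "int n - 2"]) (simp add: V_deg_def V_simps(2))
  show "carrier (V R 1) = {\<zero>\<^bsub>V R 1\<^esub>}" by (simp add: V_simps)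
  have "graded_permutad_iso R P G (permAs_comp R) P G (permAs_comp R) (\<lambda>_ x. x)"
    unfolding graded_permutad_iso_def
  proof (intro conjI allI impI ballI)
    show "graded_iso R (P n) (G n) (P n) (G n) (\<lambda>x. x)" for n
      by (auto simp: graded_iso_def linear_map_id bij_betw_def)
    fix t xs assume "xs \<in> tuples (map P (arity_list t))"
    then have "map2 (\<lambda>_ x. x) (arity_list t) xs = xs" by (intro nth_equalityI) (auto simp: tuples_iff)
    then show "permAs_comp R t xs = permAs_comp R t (map2 (\<lambda>_ x. x) (arity_list t) xs)" by simp
  qed
  then show "\<exists>f. graded_permutad_iso R (trees R (V R)) (trees_deg R (V R) (V_deg R)) (trees_comp R (V R)) P G (permAs_comp R) f"
    unfolding permAs_def permAs_deg_def permAs_comp_def by blast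
qed

end

theorem theorem5p3:
  fixes R :: "('r, 'x) ring_scheme"
  assumes "cring R"
  shows "structure_map_commutes R (permAs R) (permAs_deg R) (permAs_diff R) (permAs_comp R)
    \<and> dg_permutad R (permAs R) (permAs_deg R) (permAs_diff R) (permAs_comp R)
    \<and> quasi_free_on R (V R) (V_deg R) (permAs R) (permAs_deg R) (permAs_comp R)
    \<and> (\<forall>n\<ge>2. dg_iso R
          (perm_chains R (n - 1)) (perm_chains_deg R (n - 1)) (perm_boundary R (n - 1))
          (permAs R n) (permAs_deg R n) (permAs_diff R n)
          (decorate R n))"
  using permAs_structure_map_commutes[OF assms] dg_permutad_permAs[OF assms] quasi_free_permAs[OF assms]
    dg_permAs(2)[OF assms] by blast

end
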